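(* Let $(A,B,P)$ be a c.n.u. $\mathbb E$-contraction on a Hilbert space $\mathcal H$ such that $A^*,B^*$ commute with $P$. Let $\mathcal H=\mathcal H_1'\oplus\mathcal H_2'$ be the unique orthogonal decomposition in which $\mathcal H_1'$ is the maximal subspace of $\mathcal H$, invariant under $P$, such that $P|_{\mathcal H_1'}$ is a c.n.u. isometry. Then: (1) $\mathcal H_1'$ is a maximal joint invariant subspace for $A,B,P$ such that $(A|_{\mathcal H_1'},B|_{\mathcal H_1'},P|_{\mathcal H_1'})$ is a c.n.u. $\mathbb E$-isometry; (2) $\mathcal H_2'$ is a maximal joint invariant subspace for $A^*,B^*,P^*$ such that $(A^*|_{\mathcal H_2'},B^*|_{\mathcal H_2'},P^*|_{\mathcal H_2'})$ is a c.n.u. $\mathbb E$-contraction.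
   Context: All operators are bounded linear operators on complex Hilbert spaces; subspaces are closed. The tetrablock is $\mathbb E=\{(x_1,x_2,x_3)\in\mathbb C^3:1-zx_1-wx_2+zwx_3\ne0\ \ \forall z,w\in\overline{\mathbb D}\}$, and $b\mathbb E=\{(a,b,p)\in\overline{\mathbb E}:|p|=1\}$. A compact set $K\subset\mathbb C^3$ is a spectral set for a commuting triple $\underline T$ if the Taylor joint spectrum of $\underline T$ lies in $K$ and $\|f(\underline T)\|\le\sup_K|f|$ for every rational function $f$ with poles off $K$. An $\mathbb E$-contraction is a commuting triple $(A,B,P)$ having $\overline{\mathbb E}$ as a spectral set (then $P$ is a contraction). An $\mathbb E$-unitary is a commuting triple of normal operators with Taylor joint spectrum contained in $b\mathbb E$. An $\mathbb E$-isometry is the restriction of an $\mathbb E$-unitary to a joint invariant subspace. A contraction is c.n.u. (completely non-unitary) if no nonzero reducing subspace exists on which it is unitary; an $\mathbb E$-contraction is c.n.u. if its last component is a c.n.u. contraction. Levan's theorem: for a c.n.u. contraction $P$ on $\mathcal H$ there is a unique orthogonal decomposition $\mathcal H=\mathcal H_1'\oplus\mathcal H_2'$ where $\mathcal H_1'$ is the maximal subspace such that $P|_{\mathcal H_1'}$ is a c.n.u. isometry, and $P^*|_{\mathcal H_2'}$ is a c.n.u. contraction; $\mathcal H_1'$ is invariant for $P$, $\mathcal H_2'$ is invariant for $P^*$, and $\lim_k\|P^kx\|<\|x\|$ for all nonzero $x\in\mathcal H_2'$. Explicitly, $\mathcal H_1'=\{h\in\mathcal H:\|P^kh\|=\|h\|\text{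 for all }k\ge1\}$.
   Formalization: In (2), maximality is among subspaces that also satisfy lim‖P^k x‖<‖x‖ for all nonzero x; literally (2) fails if H₁′≠{0}, e.g. (0,0,S), S the shift. E-unitary extensions are taken inside ℓ²(ℕ,H), which suffices by minimal extensions. *)

theory Defs
  imports "HOL-Analysis.Analysis" "HOL-Library.Poly_Mapping"
begin

section \<open>Complex Hilbert spaces\<close>

text \<open>
  The inner product is linear in its first argument. Its real part is the library's real inner
  product, so that positive definiteness, the norm and the topology come from
  \<^class>\<open>real_inner\<close>.
\<close>

class complex_inner = real_inner +
  fixes scaleC :: "complex \<Rightarrow> 'a \<Rightarrow> 'a" (infixr "*\<^sub>C" 75)
    and cinner :: "'a \<Rightarrow> 'a \<Rightarrow> complex"
  assumes scaleC_add_right: "c *\<^sub>C (x + y) = c *\<^sub>C x + c *\<^sub>C y"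
    and scaleC_add_left: "(c + d) *\<^sub>C x = c *\<^sub>C x + d *\<^sub>C x"
    and scaleC_scaleC: "c *\<^sub>C (d *\<^sub>C x) = (c * d) *\<^sub>C x"
    and scaleR_scaleC: "r *\<^sub>R x = complex_of_real r *\<^sub>C x"
    and cinner_commute: "cinner x y = cnj (cinner y x)"
    and cinner_add_left: "cinner (x + y) z = cinner x z + cinner y z"
    and cinner_scaleC_left: "cinner (c *\<^sub>C x) y = c * cinner x y"
    and inner_Re_cinner: "inner x y = Re (cinner x y)"

class complex_hilbert = complex_inner + complete_space

definition closed_csubspace :: "'a::complex_hilbert set \<Rightarrow> bool" where
  "closed_csubspace M \<longleftrightarrow>
     0 \<in> M \<and> (\<forall>x\<in>M. \<forall>y\<in>M. x + y \<in> M) \<and> (\<forall>c. \<forall>x\<in>M. c *\<^sub>C x \<in> M) \<and> closed M"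

definition orthogonal_decomposition :: "'a::complex_hilbert set \<Rightarrow> 'a set \<Rightarrow> bool" where
  "orthogonal_decomposition H\<^sub>1 H\<^sub>2 \<longleftrightarrow>
     closed_csubspace H\<^sub>1 \<and> closed_csubspace H\<^sub>2 \<and>
     (\<forall>x\<in>H\<^sub>1. \<forall>y\<in>H\<^sub>2. cinner x y = 0) \<and> (\<forall>h. \<exists>x\<in>H\<^sub>1. \<exists>y\<in>H\<^sub>2. h = x + y)"

definition maximal_subspace :: "('a::complex_hilbert set \<Rightarrow> bool) \<Rightarrow> 'a set \<Rightarrow> bool" where
  "maximal_subspace Q M \<longleftrightarrow>
     closed_csubspace M \<and> Q M \<and> (\<forall>L. closed_csubspace L \<and> Q L \<and> M \<subseteq> L \<longrightarrow> L = M)"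


section \<open>Operators on a closed subspace\<close>

text \<open>
  Every notion below is relative to a closed subspace \<open>S\<close> of the ambient type, regarded as a
  Hilbert space of its own: only the values of an operator on \<open>S\<close> matter. The restriction of \<open>T\<close>
  to an invariant subspace \<open>M\<close> is therefore \<open>T\<close> itself, considered on \<open>M\<close>, and the whole Hilbert
  space is \<open>UNIV\<close>.
\<close>

definition bounded_op_on :: "'a::complex_hilbert set \<Rightarrow> ('a \<Rightarrow> 'a) \<Rightarrow> bool" where
  "bounded_op_on S T \<longleftrightarrow>
     T ` S \<subseteq> S \<and>
     (\<forall>x\<in>S. \<forall>y\<in>S. T (x + y) = T x + T y) \<and>
     (\<forall>c. \<forall>x\<in>S. T (c *\<^sub>C x) = c *\<^sub>C T x) \<and>
     (\<exists>C. \<forall>x\<in>S. norm (T x) \<le> C * norm x)"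

definition adj_on :: "'a::complex_hilbert set \<Rightarrow> ('a \<Rightarrow> 'a) \<Rightarrow> 'a \<Rightarrow> 'a" where
  "adj_on S T y = (THE z. z \<in> S \<and> (\<forall>x\<in>S. cinner (T x) y = cinner x z))"

abbreviation adj :: "('a::complex_hilbert \<Rightarrow> 'a) \<Rightarrow> 'a \<Rightarrow> 'a" where
  "adj \<equiv> adj_on UNIV"

definition normal_on :: "'a::complex_hilbert set \<Rightarrow> ('a \<Rightarrow> 'a) \<Rightarrow> bool" where
  "normal_on S T \<longleftrightarrow> bounded_op_on S T \<and> (\<forall>x\<in>S. T (adj_on S T x) = adj_on S T (T x))"

definition contraction_on :: "'a::complex_hilbert set \<Rightarrow> ('a \<Rightarrow> 'a) \<Rightarrow> bool" where
  "contraction_on S T \<longleftrightarrow> bounded_op_on S T \<and> (\<forall>x\<in>S. norm (T x) \<le> norm x)"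

definition isometry_on :: "'a::complex_hilbert set \<Rightarrow> ('a \<Rightarrow> 'a) \<Rightarrow> bool" where
  "isometry_on S T \<longleftrightarrow> bounded_op_on S T \<and> (\<forall>x\<in>S. norm (T x) = norm x)"

definition unitary_on :: "'a::complex_hilbert set \<Rightarrow> ('a \<Rightarrow> 'a) \<Rightarrow> bool" where
  "unitary_on S T \<longleftrightarrow> isometry_on S T \<and> T ` S = S"

definition cnu_contraction_on :: "'a::complex_hilbert set \<Rightarrow> ('a \<Rightarrow> 'a) \<Rightarrow> bool" where
  "cnu_contraction_on S T \<longleftrightarrow>
     contraction_on S T \<and>
     (\<forall>M. closed_csubspace M \<and> M \<subseteq> S \<and> T ` M \<subseteq> M \<and> adj_on S T ` M \<subseteq> M \<and> unitary_on M T
        \<longrightarrow> M = {0})"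

definition commuting_triple_on ::
    "'a::complex_hilbert set \<Rightarrow> ('a \<Rightarrow> 'a) \<Rightarrow> ('a \<Rightarrow> 'a) \<Rightarrow> ('a \<Rightarrow> 'a) \<Rightarrow> bool" where
  "commuting_triple_on S A B P \<longleftrightarrow>
     bounded_op_on S A \<and> bounded_op_on S B \<and> bounded_op_on S P \<and>
     (\<forall>x\<in>S. A (B x) = B (A x) \<and> A (P x) = P (A x) \<and> B (P x) = P (B x))"


section \<open>The Taylor joint spectrum of a triple\<close>

text \<open>
  The Koszul complex \<open>0 \<rightarrow> S \<rightarrow> S\<^sup>3 \<rightarrow> S\<^sup>3 \<rightarrow> S \<rightarrow> 0\<close> of a commuting triple. With respect to the
  standard generators \<open>e\<^sub>1, e\<^sub>2, e\<^sub>3\<close> of the exterior algebra, the coordinates in degree 1 belong to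
  \<open>e\<^sub>1, e\<^sub>2, e\<^sub>3\<close> and those in degree 2 to \<open>e\<^sub>1\<and>e\<^sub>2, e\<^sub>1\<and>e\<^sub>3, e\<^sub>2\<and>e\<^sub>3\<close>; the differential is
  \<open>\<xi> \<mapsto> \<Sum>i. e\<^sub>i \<and> T\<^sub>i \<xi>\<close>.
\<close>

definition koszul0 ::
    "('a::complex_hilbert \<Rightarrow> 'a) \<Rightarrow> ('a \<Rightarrow> 'a) \<Rightarrow> ('a \<Rightarrow> 'a) \<Rightarrow> 'a \<Rightarrow> 'a \<times> 'a \<times> 'a" where
  "koszul0 T\<^sub>1 T\<^sub>2 T\<^sub>3 x = (T\<^sub>1 x, T\<^sub>2 x, T\<^sub>3 x)"

definition koszul1 ::
    "('a::complex_hilbert \<Rightarrow> 'a) \<Rightarrow> ('a \<Rightarrow> 'a) \<Rightarrow> ('a \<Rightarrow> 'a) \<Rightarrow> 'a \<times> 'a \<times> 'a \<Rightarrow> 'a \<times> 'a \<times> 'a" where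
  "koszul1 T\<^sub>1 T\<^sub>2 T\<^sub>3 = (\<lambda>(x\<^sub>1, x\<^sub>2, x\<^sub>3). (T\<^sub>1 x\<^sub>2 - T\<^sub>2 x\<^sub>1, T\<^sub>1 x\<^sub>3 - T\<^sub>3 x\<^sub>1, T\<^sub>2 x\<^sub>3 - T\<^sub>3 x\<^sub>2))"

definition koszul2 ::
    "('a::complex_hilbert \<Rightarrow> 'a) \<Rightarrow> ('a \<Rightarrow> 'a) \<Rightarrow> ('a \<Rightarrow> 'a) \<Rightarrow> 'a \<times> 'a \<times> 'a \<Rightarrow> 'a" where
  "koszul2 T\<^sub>1 T\<^sub>2 T\<^sub>3 = (\<lambda>(y\<^sub>1\<^sub>2, y\<^sub>1\<^sub>3, y\<^sub>2\<^sub>3). T\<^sub>1 y\<^sub>2\<^sub>3 - T\<^sub>2 y\<^sub>1\<^sub>3 + T\<^sub>3 y\<^sub>1\<^sub>2)"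

definition koszul_exact_on ::
    "'a::complex_hilbert set \<Rightarrow> ('a \<Rightarrow> 'a) \<Rightarrow> ('a \<Rightarrow> 'a) \<Rightarrow> ('a \<Rightarrow> 'a) \<Rightarrow> bool" where
  "koszul_exact_on S T\<^sub>1 T\<^sub>2 T\<^sub>3 \<longleftrightarrow>
     {x \<in> S. koszul0 T\<^sub>1 T\<^sub>2 T\<^sub>3 x = 0} = {0} \<and>
     {u \<in> S \<times> S \<times> S. koszul1 T\<^sub>1 T\<^sub>2 T\<^sub>3 u = 0} = koszul0 T\<^sub>1 T\<^sub>2 T\<^sub>3 ` S \<and>
     {v \<in> S \<times> S \<times> S. koszul2 T\<^sub>1 T\<^sub>2 T\<^sub>3 v = 0} = koszul1 T\<^sub>1 T\<^sub>2 T\<^sub>3 ` (S \<times> S \<times> S) \<and>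
     S = koszul2 T\<^sub>1 T\<^sub>2 T\<^sub>3 ` (S \<times> S \<times> S)"

definition taylor_spectrum_on ::
    "'a::complex_hilbert set \<Rightarrow> ('a \<Rightarrow> 'a) \<Rightarrow> ('a \<Rightarrow> 'a) \<Rightarrow> ('a \<Rightarrow> 'a) \<Rightarrow> (complex \<times> complex \<times> complex) set"
  where
  "taylor_spectrum_on S A B P =
     {(a, b, p). \<not> koszul_exact_on S (\<lambda>x. A x - a *\<^sub>C x) (\<lambda>x. B x - b *\<^sub>C x) (\<lambda>x. P x - p *\<^sub>C x)}"


section \<open>Spectral sets\<close>

text \<open>Polynomials in three variables, as finitely supported families of coefficients.\<close>

type_synonym poly3 = "(nat \<times> nat \<times> nat) \<Rightarrow>\<^sub>0 complex"

definition poly3_eval :: "poly3 \<Rightarrow> complex \<times> complex \<times> complex \<Rightarrow> complex" where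
  "poly3_eval f = (\<lambda>(x\<^sub>1, x\<^sub>2, x\<^sub>3).
     \<Sum>(i, j, k)\<in>Poly_Mapping.keys f. Poly_Mapping.lookup f (i, j, k) * x\<^sub>1 ^ i * x\<^sub>2 ^ j * x\<^sub>3 ^ k)"

definition poly3_op ::
    "poly3 \<Rightarrow> ('a::complex_hilbert \<Rightarrow> 'a) \<Rightarrow> ('a \<Rightarrow> 'a) \<Rightarrow> ('a \<Rightarrow> 'a) \<Rightarrow> 'a \<Rightarrow> 'a" where
  "poly3_op f A B P x =
     (\<Sum>(i, j, k)\<in>Poly_Mapping.keys f.
        Poly_Mapping.lookup f (i, j, k) *\<^sub>C (A ^^ i) ((B ^^ j) ((P ^^ k) x)))"

text \<open>
  A rational function with poles off \<open>K\<close> is \<open>f / g\<close> with \<open>g\<close> zero-free on \<open>K\<close>, and its value at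
  the triple is \<open>f(A,B,P) g(A,B,P)\<inverse>\<close>. That \<open>g(A,B,P)\<close> is invertible is a consequence of the
  spectral mapping theorem; the clause on \<^const>\<open>bij_betw\<close> only records that the value makes sense.
\<close>

definition spectral_set_on ::
    "'a::complex_hilbert set \<Rightarrow> ('a \<Rightarrow> 'a) \<Rightarrow> ('a \<Rightarrow> 'a) \<Rightarrow> ('a \<Rightarrow> 'a)
      \<Rightarrow> (complex \<times> complex \<times> complex) set \<Rightarrow> bool" where
  "spectral_set_on S A B P K \<longleftrightarrow>
     compact K \<and> taylor_spectrum_on S A B P \<subseteq> K \<and>
     (\<forall>f g. (\<forall>z\<in>K. poly3_eval g z \<noteq> 0) \<longrightarrow>
        bij_betw (poly3_op g A B P) S S \<and>
        (\<forall>x\<in>S. norm (poly3_op f A B P (inv_into S (poly3_op g A B P) x))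
            \<le> (SUP z\<in>K. cmod (poly3_eval f z / poly3_eval g z)) * norm x))"


section \<open>The tetrablock\<close>

definition tetrablock :: "(complex \<times> complex \<times> complex) set" where
  "tetrablock = {(x\<^sub>1, x\<^sub>2, x\<^sub>3).
     \<forall>z w. cmod z \<le> 1 \<and> cmod w \<le> 1 \<longrightarrow> 1 - z * x\<^sub>1 - w * x\<^sub>2 + z * w * x\<^sub>3 \<noteq> 0}"

definition tetrablock_dist_boundary :: "(complex \<times> complex \<times> complex) set" where
  "tetrablock_dist_boundary = {(a, b, p). (a, b, p) \<in> closure tetrablock \<and> cmod p = 1}"

definition tetra_contraction_on ::
    "'a::complex_hilbert set \<Rightarrow> ('a \<Rightarrow> 'a) \<Rightarrow> ('a \<Rightarrow> 'a) \<Rightarrow> ('a \<Rightarrow> 'a) \<Rightarrow> bool" where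
  "tetra_contraction_on S A B P \<longleftrightarrow>
     commuting_triple_on S A B P \<and> spectral_set_on S A B P (closure tetrablock)"

definition tetra_unitary_on ::
    "'a::complex_hilbert set \<Rightarrow> ('a \<Rightarrow> 'a) \<Rightarrow> ('a \<Rightarrow> 'a) \<Rightarrow> ('a \<Rightarrow> 'a) \<Rightarrow> bool" where
  "tetra_unitary_on S A B P \<longleftrightarrow>
     commuting_triple_on S A B P \<and> normal_on S A \<and> normal_on S B \<and> normal_on S P \<and>
     taylor_spectrum_on S A B P \<subseteq> tetrablock_dist_boundary"


section \<open>The Hilbert space of square summable sequences\<close>

definition square_summable :: "(nat \<Rightarrow> 'a::real_inner) \<Rightarrow> bool" where
  "square_summable f \<longleftrightarrow> summable (\<lambda>n. (norm (f n))\<^sup>2)"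

lemma square_summable_zero: "square_summable (\<lambda>n. 0)"
  by (simp add: square_summable_def)

lemma square_summable_add:
  assumes "square_summable f" "square_summable g"
  shows "square_summable (\<lambda>n. f n + g n)"
  unfolding square_summable_def
proof (rule summable_comparison_test)
  show "\<exists>N. \<forall>n\<ge>N. norm ((norm (f n + g n))\<^sup>2) \<le> 2 * (norm (f n))\<^sup>2 + 2 * (norm (g n))\<^sup>2"
  proof (intro exI allI impI)
    fix n
    have "(norm (f n + g n))\<^sup>2 \<le> (norm (f n) + norm (g n))\<^sup>2"
      by (simp add: norm_triangle_ineq power_mono)
    also have "\<dots> \<le> 2 * (norm (f n))\<^sup>2 + 2 * (norm (g n))\<^sup>2"
      using sum_squares_bound[of "norm (f n)" "norm (g n)"] by (simp add: power2_sum)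
    finally show "norm ((norm (f n + g n))\<^sup>2) \<le> 2 * (norm (f n))\<^sup>2 + 2 * (norm (g n))\<^sup>2"
      by simp
  qed
  show "summable (\<lambda>n. 2 * (norm (f n))\<^sup>2 + 2 * (norm (g n))\<^sup>2)"
    using assms unfolding square_summable_def by (intro summable_add summable_mult)
qed

lemma square_summable_scaleR: "square_summable f \<Longrightarrow> square_summable (\<lambda>n. r *\<^sub>R f n)"
  unfolding square_summable_def by (simp add: power_mult_distrib summable_mult)

lemma square_summable_uminus: "square_summable f \<Longrightarrow> square_summable (\<lambda>n. - f n)"
  unfolding square_summable_def by simp

lemma square_summable_minus:
  "square_summable f \<Longrightarrow> square_summable g \<Longrightarrow> square_summable (\<lambda>n. f n - g n)"
  using square_summable_add[of f "\<lambda>n. - g n"] square_summable_uminus[of g] by simp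

lemma norm_scaleC: "norm (c *\<^sub>C x) = cmod c * norm (x::'a::complex_inner)"
proof -
  have self: "inner x x * (cmod c)\<^sup>2 = inner (c *\<^sub>C x) (c *\<^sub>C x)"
  proof -
    have im: "Im (cinner x x) = 0"
      using cinner_commute[of x x] by (metis cnj.simps(2) neg_equal_zero)
    have "cinner (c *\<^sub>C x) (c *\<^sub>C x) = c * cnj (cinner (c *\<^sub>C x) x)"
      using cinner_commute[of x "c *\<^sub>C x"] by (simp add: cinner_scaleC_left)
    also have "\<dots> = (c * cnj c) * cnj (cinner x x)"
      by (simp add: cinner_scaleC_left)
    finally have "cinner (c *\<^sub>C x) (c *\<^sub>C x) = complex_of_real ((cmod c)\<^sup>2) * cnj (cinner x x)"
      by (simp only: complex_norm_square)
    then show ?thesis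
      by (simp add: inner_Re_cinner im)
  qed
  have "(norm (c *\<^sub>C x))\<^sup>2 = (cmod c * norm x)\<^sup>2"
    by (simp add: power2_norm_eq_inner power_mult_distrib self[symmetric] mult.commute)
  then show ?thesis
    by (metis abs_norm_cancel abs_mult power2_eq_iff_nonneg norm_ge_zero zero_le_mult_iff)
qed

lemma square_summable_scaleC:
  "square_summable f \<Longrightarrow> square_summable (\<lambda>n. c *\<^sub>C (f n :: 'a::complex_inner))"
  unfolding square_summable_def by (simp add: norm_scaleC power_mult_distrib summable_mult)

lemma norm_mult_le_squares: "norm x * norm y \<le> (norm x)\<^sup>2 + (norm y)\<^sup>2"
proof -
  have "2 * norm x * norm y \<le> (norm x)\<^sup>2 + (norm y)\<^sup>2"
    by (rule sum_squares_bound)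
  moreover have "0 \<le> norm x * norm y" by simp
  ultimately show ?thesis by linarith
qed

lemma summable_inner:
  assumes "square_summable f" "square_summable g"
  shows "summable (\<lambda>n. inner (f n) (g n))"
proof (rule summable_comparison_test)
  show "\<exists>N. \<forall>n\<ge>N. norm (inner (f n) (g n)) \<le> (norm (f n))\<^sup>2 + (norm (g n))\<^sup>2"
    by (auto intro!: exI[of _ 0] order_trans[OF Cauchy_Schwarz_ineq2 norm_mult_le_squares])
  show "summable (\<lambda>n. (norm (f n))\<^sup>2 + (norm (g n))\<^sup>2)"
    using assms unfolding square_summable_def by (rule summable_add)
qed

lemma Im_cinner: "Im (cinner x y) = - inner (\<i> *\<^sub>C x) (y::'a::complex_inner)"
  by (simp add: inner_Re_cinner cinner_scaleC_left)

lemma summable_cinner: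
  assumes "square_summable f" "square_summable (g :: nat \<Rightarrow> 'a::complex_inner)"
  shows "summable (\<lambda>n. cinner (f n) (g n))"
proof -
  have "summable (\<lambda>n. Re (cinner (f n) (g n)))"
    using summable_inner[OF assms] by (simp add: inner_Re_cinner)
  moreover have "summable (\<lambda>n. Im (cinner (f n) (g n)))"
    unfolding Im_cinner
    by (intro summable_minus summable_inner square_summable_scaleC assms)
  ultimately show ?thesis
    by (simp add: summable_complex_iff)
qed

typedef (overloaded) 'a ell2 = "{f :: nat \<Rightarrow> 'a::real_inner. square_summable f}"
  morphisms coord Abs_ell2
  using square_summable_zero by blast

lemma square_summable_coord: "square_summable (coord x)"
  using coord by blast

lemmas coord_Abs = Abs_ell2_inverse[unfolded mem_Collect_eq]

lemma ell2_eqI: "(\<And>n. coord x n = coord y n) \<Longrightarrow> x = y"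
  using coord_inject by (metis ext)

instantiation ell2 :: (real_inner) real_inner
begin

definition "0 = Abs_ell2 (\<lambda>n. 0)"
definition "x + y = Abs_ell2 (\<lambda>n. coord x n + coord y n)"
definition "x - y = Abs_ell2 (\<lambda>n. coord x n - coord y n)"
definition "- x = Abs_ell2 (\<lambda>n. - coord x n)"
definition "r *\<^sub>R x = Abs_ell2 (\<lambda>n. r *\<^sub>R coord x n)"
definition "inner x y = suminf (\<lambda>n. inner (coord x n) (coord y n))"
definition "norm (x :: 'a ell2) = sqrt (inner x x)"
definition "dist x y = norm (x - y :: 'a ell2)"
definition "sgn x = inverse (norm x) *\<^sub>R (x :: 'a ell2)"
definition [code del]:
  "(uniformity :: ('a ell2 \<times> 'a ell2) filter) = (INF e\<in>{0 <..}. principal {(x, y). dist x y < e})"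
definition [code del]:
  "open (U :: 'a ell2 set) \<longleftrightarrow> (\<forall>x\<in>U. eventually (\<lambda>(x', y). x' = x \<longrightarrow> y \<in> U) uniformity)"

lemma coord_zero: "coord 0 n = 0"
  by (simp add: zero_ell2_def coord_Abs square_summable_zero)
lemma coord_add: "coord (x + y) n = coord x n + coord y n"
  by (simp add: plus_ell2_def coord_Abs square_summable_add square_summable_coord)
lemma coord_minus: "coord (x - y) n = coord x n - coord y n"
  by (simp add: minus_ell2_def coord_Abs square_summable_minus square_summable_coord)
lemma coord_uminus: "coord (- x) n = - coord x n"
  by (simp add: uminus_ell2_def coord_Abs square_summable_uminus square_summable_coord)
lemma coord_scaleR: "coord (r *\<^sub>R x) n = r *\<^sub>R coord x n"
  by (simp add: scaleR_ell2_def coord_Abs square_summable_scaleR square_summable_coord)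

instance
proof
  fix x y z :: "'a ell2" and r s :: real and U :: "'a ell2 set"
  note coords = coord_zero coord_add coord_minus coord_uminus coord_scaleR
  note sq = square_summable_coord
  show "x + y + z = x + (y + z)" by (rule ell2_eqI) (simp add: coords)
  show "x + y = y + x" by (rule ell2_eqI) (simp add: coords)
  show "0 + x = x" by (rule ell2_eqI) (simp add: coords)
  show "- x + x = 0" by (rule ell2_eqI) (simp add: coords)
  show "x - y = x + - y" by (rule ell2_eqI) (simp add: coords)
  show "r *\<^sub>R (x + y) = r *\<^sub>R x + r *\<^sub>R y" by (rule ell2_eqI) (simp add: coords scaleR_add_right)
  show "(r + s) *\<^sub>R x = r *\<^sub>R x + s *\<^sub>R x" by (rule ell2_eqI) (simp add: coords scaleR_add_left)
  show "r *\<^sub>R s *\<^sub>R x = (r * s) *\<^sub>R x" by (rule ell2_eqI) (simp add: coords)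
  show "1 *\<^sub>R x = x" by (rule ell2_eqI) (simp add: coords)
  show "dist x y = norm (x - y)" by (rule dist_ell2_def)
  show "sgn x = inverse (norm x) *\<^sub>R x" by (rule sgn_ell2_def)
  show "uniformity = (INF e\<in>{0 <..}. principal {(x, y :: 'a ell2). dist x y < e})"
    by (rule uniformity_ell2_def)
  show "open U \<longleftrightarrow> (\<forall>x\<in>U. \<forall>\<^sub>F (x', y) in uniformity. x' = x \<longrightarrow> y \<in> U)"
    by (rule open_ell2_def)
  show "inner x y = inner y x" by (simp add: inner_ell2_def inner_commute)
  show "inner (x + y) z = inner x z + inner y z"
    by (simp add: inner_ell2_def coords inner_add_left suminf_add summable_inner sq)
  show "inner (r *\<^sub>R x) y = r * inner x y"
    by (simp add: inner_ell2_def coords suminf_mult summable_inner sq)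
  show "0 \<le> inner x x"
    by (simp add: inner_ell2_def suminf_nonneg summable_inner sq)
  show "inner x x = 0 \<longleftrightarrow> x = 0"
  proof
    assume "inner x x = 0"
    then have "\<forall>n. inner (coord x n) (coord x n) = 0"
      unfolding inner_ell2_def
      by (subst (asm) suminf_eq_zero_iff) (auto simp: summable_inner sq)
    then show "x = 0" by (intro ell2_eqI) (simp add: coords)
  next
    assume "x = 0"
    then show "inner x x = 0" by (simp add: inner_ell2_def coords)
  qed
  show "norm x = sqrt (inner x x)" by (rule norm_ell2_def)
qed

end

instantiation ell2 :: (complex_inner) complex_inner
begin

definition "c *\<^sub>C x = Abs_ell2 (\<lambda>n. c *\<^sub>C coord x n)"
definition "cinner x y = suminf (\<lambda>n. cinner (coord x n) (coord y n))"

lemma coord_scaleC: "coord (c *\<^sub>C x) n = c *\<^sub>C coord x n"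
  by (simp add: scaleC_ell2_def coord_Abs square_summable_scaleC square_summable_coord)

instance
proof
  fix x y z :: "'a ell2" and c d :: complex and r :: real
  note sq = square_summable_coord
  note sums = summable_cinner[OF sq sq]
  show "c *\<^sub>C (x + y) = c *\<^sub>C x + c *\<^sub>C y"
    by (rule ell2_eqI) (simp add: coord_scaleC coord_add scaleC_add_right)
  show "(c + d) *\<^sub>C x = c *\<^sub>C x + d *\<^sub>C x"
    by (rule ell2_eqI) (simp add: coord_scaleC coord_add scaleC_add_left)
  show "c *\<^sub>C (d *\<^sub>C x) = (c * d) *\<^sub>C x"
    by (rule ell2_eqI) (simp add: coord_scaleC scaleC_scaleC)
  show "r *\<^sub>R x = complex_of_real r *\<^sub>C x"
    by (rule ell2_eqI) (simp add: coord_scaleC coord_scaleR scaleR_scaleC)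
  have "(\<lambda>n. cinner (coord x n) (coord y n)) = (\<lambda>n. cnj (cinner (coord y n) (coord x n)))"
    using cinner_commute by blast
  then show "cinner x y = cnj (cinner y x)"
    unfolding cinner_ell2_def
    using bounded_linear.suminf[OF bounded_linear_cnj sums[of y x]] by simp
  show "cinner (x + y) z = cinner x z + cinner y z"
    by (simp add: cinner_ell2_def coord_add cinner_add_left suminf_add sums)
  show "cinner (c *\<^sub>C x) y = c * cinner x y"
    by (simp add: cinner_ell2_def coord_scaleC cinner_scaleC_left suminf_mult sums)
  show "inner x y = Re (cinner x y)"
    unfolding inner_ell2_def cinner_ell2_def
    using bounded_linear.suminf[OF bounded_linear_Re sums[of x y]]
    by (simp add: inner_Re_cinner)
qed

end

lemma norm_sq_ell2: "(norm x)\<^sup>2 = suminf (\<lambda>n. (norm (coord x n))\<^sup>2)"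
  by (simp add: power2_norm_eq_inner inner_ell2_def)

lemma sum_coord_le_norm_sq: "finite I \<Longrightarrow> (\<Sum>n\<in>I. (norm (coord x n))\<^sup>2) \<le> (norm x)\<^sup>2"
  unfolding norm_sq_ell2
  using square_summable_coord by (intro sum_le_suminf) (auto simp: square_summable_def)

lemma norm_coord_le: "norm (coord x n) \<le> norm x"
proof (rule power2_le_imp_le)
  show "(norm (coord x n))\<^sup>2 \<le> (norm x)\<^sup>2"
    using sum_coord_le_norm_sq[of "{n}" x] by simp
qed simp

instance ell2 :: (complex_hilbert) complex_hilbert
proof
  fix X :: "nat \<Rightarrow> 'a ell2"
  assume X: "Cauchy X"
  have "Cauchy (\<lambda>m. coord (X m) n)" for n
  proof (rule metric_CauchyI)
    fix e :: real
    assume "e > 0"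
    then obtain M where M: "\<And>m k. m \<ge> M \<Longrightarrow> k \<ge> M \<Longrightarrow> dist (X m) (X k) < e"
      using metric_CauchyD[OF X] by blast
    have "dist (coord (X m) n) (coord (X k) n) < e" if "m \<ge> M" "k \<ge> M" for m k
      using M[OF that] norm_coord_le[of "X m - X k" n] by (simp add: dist_norm coord_minus)
    then show "\<exists>M. \<forall>m\<ge>M. \<forall>k\<ge>M. dist (coord (X m) n) (coord (X k) n) < e" by blast
  qed
  then have "\<exists>l. (\<lambda>m. coord (X m) n) \<longlonglongrightarrow> l" for n
    using Cauchy_convergent_iff convergent_def by blast
  then obtain f where f: "\<And>n. (\<lambda>m. coord (X m) n) \<longlonglongrightarrow> f n"
    by metis
  have tail: "\<exists>M. \<forall>m\<ge>M. \<forall>N. (\<Sum>n<N. (norm (coord (X m) n - f n))\<^sup>2) \<le> e\<^sup>2" if "e > 0" for e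
  proof -
    from that obtain M where M: "\<And>m k. m \<ge> M \<Longrightarrow> k \<ge> M \<Longrightarrow> dist (X m) (X k) < e"
      using metric_CauchyD[OF X] by blast
    have "(\<Sum>n<N. (norm (coord (X m) n - f n))\<^sup>2) \<le> e\<^sup>2" if m: "m \<ge> M" for m N
    proof (rule tendsto_upperbound)
      show "(\<lambda>k. \<Sum>n<N. (norm (coord (X m) n - coord (X k) n))\<^sup>2)
              \<longlonglongrightarrow> (\<Sum>n<N. (norm (coord (X m) n - f n))\<^sup>2)"
        by (intro tendsto_intros f)
      have "(\<Sum>n<N. (norm (coord (X m) n - coord (X k) n))\<^sup>2) \<le> e\<^sup>2" if "k \<ge> M" for k
      proof -
        have "(\<Sum>n<N. (norm (coord (X m) n - coord (X k) n))\<^sup>2) \<le> (norm (X m - X k))\<^sup>2"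
          using sum_coord_le_norm_sq[of "{..<N}" "X m - X k"] by (simp add: coord_minus)
        also have "\<dots> \<le> e\<^sup>2"
          using M[OF m that] by (intro power_mono) (auto simp: dist_norm)
        finally show ?thesis .
      qed
      then show "\<forall>\<^sub>F k in sequentially. (\<Sum>n<N. (norm (coord (X m) n - coord (X k) n))\<^sup>2) \<le> e\<^sup>2"
        using eventually_sequentially by blast
    qed simp
    then show ?thesis by blast
  qed
  have sq_diff: "square_summable (\<lambda>n. coord (X m) n - f n)"
    if "\<forall>N. (\<Sum>n<N. (norm (coord (X m) n - f n))\<^sup>2) \<le> e\<^sup>2" for m e
    unfolding square_summable_def
    using that by (intro summableI_nonneg_bounded[where x = "e\<^sup>2"]) auto
  obtain M where "\<forall>N. (\<Sum>n<N. (norm (coord (X M) n - f n))\<^sup>2) \<le> 1\<^sup>2"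
    using tail[of 1] by auto
  from square_summable_minus[OF square_summable_coord[of "X M"] sq_diff[OF this]]
  have sq_f: "square_summable f" by simp
  have "X \<longlonglongrightarrow> Abs_ell2 f"
  proof (rule metric_LIMSEQ_I)
    fix e :: real
    assume e: "e > 0"
    then obtain M where
      M: "\<And>m N. m \<ge> M \<Longrightarrow> (\<Sum>n<N. (norm (coord (X m) n - f n))\<^sup>2) \<le> (e/2)\<^sup>2"
      using tail[of "e/2"] by auto
    have "dist (X m) (Abs_ell2 f) < e" if m: "m \<ge> M" for m
    proof -
      have "summable (\<lambda>n. (norm (coord (X m) n - f n))\<^sup>2)"
        using sq_diff M[OF m] unfolding square_summable_def by blast
      then have "suminf (\<lambda>n. (norm (coord (X m) n - f n))\<^sup>2) \<le> (e/2)\<^sup>2"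
        using M[OF m] by (rule suminf_le_const)
      then have "(norm (X m - Abs_ell2 f))\<^sup>2 \<le> (e/2)\<^sup>2"
        by (simp add: norm_sq_ell2 coord_minus coord_Abs sq_f)
      moreover have "0 \<le> e/2" using e by simp
      ultimately have "norm (X m - Abs_ell2 f) \<le> e/2"
        by (rule power2_le_imp_le)
      then show ?thesis using e by (simp add: dist_norm)
    qed
    then show "\<exists>M. \<forall>m\<ge>M. dist (X m) (Abs_ell2 f) < e" by blast
  qed
  then show "convergent X" unfolding convergent_def by blast
qed


section \<open>Isometries associated with the tetrablock\<close>

text \<open>
  A triple is the restriction of an \<open>\<E>\<close>-unitary on \<open>K\<close> to a joint invariant subspace if, up to
  an isometric embedding \<open>V\<close> of \<open>S\<close> into \<open>K\<close>, it is what the \<open>\<E>\<close>-unitary does on \<open>V ` S\<close>. As one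
  cannot quantify over types, \<open>K\<close> ranges over the closed subspaces of \<open>\<ell>\<^sup>2(\<nat>, 'a)\<close>. This is no loss
  of generality: an \<open>\<E>\<close>-unitary extending a triple on \<open>S\<close> may be cut down to the smallest reducing
  subspace containing \<open>S\<close>, which is the closed span of countably many bounded linear images of
  \<open>S\<close>; its Hilbert dimension is at most \<open>\<aleph>\<^sub>0 \<cdot> dim S\<close>, that is, at most the one of
  \<open>\<ell>\<^sup>2(\<nat>, 'a)\<close>.
\<close>

definition tetra_isometry_on ::
    "'a::complex_hilbert set \<Rightarrow> ('a \<Rightarrow> 'a) \<Rightarrow> ('a \<Rightarrow> 'a) \<Rightarrow> ('a \<Rightarrow> 'a) \<Rightarrow> bool" where
  "tetra_isometry_on S A B P \<longleftrightarrow>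
     A ` S \<subseteq> S \<and> B ` S \<subseteq> S \<and> P ` S \<subseteq> S \<and>
     (\<exists>(K :: 'a ell2 set) N\<^sub>1 N\<^sub>2 U V.
        closed_csubspace K \<and> tetra_unitary_on K N\<^sub>1 N\<^sub>2 U \<and> V ` S \<subseteq> K \<and>
        (\<forall>x\<in>S. \<forall>y\<in>S. V (x + y) = V x + V y) \<and>
        (\<forall>c. \<forall>x\<in>S. V (c *\<^sub>C x) = c *\<^sub>C V x) \<and>
        (\<forall>x\<in>S. norm (V x) = norm x) \<and>
        (\<forall>x\<in>S. V (A x) = N\<^sub>1 (V x) \<and> V (B x) = N\<^sub>2 (V x) \<and> V (P x) = U (V x)))"

definition cnu_tetra_contraction_on ::
    "'a::complex_hilbert set \<Rightarrow> ('a \<Rightarrow> 'a) \<Rightarrow> ('a \<Rightarrow> 'a) \<Rightarrow> ('a \<Rightarrow> 'a) \<Rightarrow> bool" where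
  "cnu_tetra_contraction_on S A B P \<longleftrightarrow> tetra_contraction_on S A B P \<and> cnu_contraction_on S P"

definition cnu_tetra_isometry_on ::
    "'a::complex_hilbert set \<Rightarrow> ('a \<Rightarrow> 'a) \<Rightarrow> ('a \<Rightarrow> 'a) \<Rightarrow> ('a \<Rightarrow> 'a) \<Rightarrow> bool" where
  "cnu_tetra_isometry_on S A B P \<longleftrightarrow> tetra_isometry_on S A B P \<and> cnu_contraction_on S P"

definition joint_invariant ::
    "('a::complex_hilbert \<Rightarrow> 'a) \<Rightarrow> ('a \<Rightarrow> 'a) \<Rightarrow> ('a \<Rightarrow> 'a) \<Rightarrow> 'a set \<Rightarrow> bool" where
  "joint_invariant A B P M \<longleftrightarrow> A ` M \<subseteq> M \<and> B ` M \<subseteq> M \<and> P ` M \<subseteq> M"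

text \<open>
  The property of the second summand in Levan's decomposition: no nonzero vector of \<open>M\<close> keeps its
  norm under all powers of the contraction \<open>P\<close>. The limit exists since the norms decrease.
  It is what the maximality of that summand refers to: every subspace invariant under
  \<open>P\<^sup>*\<close>, in particular the whole space, carries a completely non-unitary restriction of \<open>P\<^sup>*\<close>,
  so complete non-unitarity alone does not single out the second summand.
\<close>

definition levan_strict :: "('a::complex_hilbert \<Rightarrow> 'a) \<Rightarrow> 'a set \<Rightarrow> bool" where
  "levan_strict P M \<longleftrightarrow> (\<forall>x\<in>M. x \<noteq> 0 \<longrightarrow> lim (\<lambda>k. norm ((P ^^ k) x)) < norm x)"

end

theory Submission
  imports Defs "HOL-Complex_Analysis.Cauchy_Integral_Formula"
begin

text \<open>
  Write \<open>I\<close> for the set of vectors whose norm is preserved by all powers of \<open>P\<close>, that is, the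
  vectors \<open>h\<close> with \<open>P\<^sup>*P P\<^sup>k h = P\<^sup>k h\<close> for all \<open>k\<close>. It contains every invariant subspace
  on which \<open>P\<close> is isometric, and \<open>P\<close> is a completely non-unitary isometry on it; so \<open>H\<^sub>1 = I\<close>. Since \<open>A\<close>
  and \<open>B\<close> commute with \<open>P\<close> and \<open>P\<^sup>*\<close>, the subspace \<open>H\<^sub>1\<close> reduces both of them, while \<open>P\<close>
  maps \<open>H\<^sub>1\<close> into itself and \<open>P\<^sup>*\<close> maps \<open>H\<^sub>2\<close> into itself.

  On \<open>H\<^sub>1\<close> the double commutativity is very restrictive. The tetrablock inequality
  \<open>\<parallel>A h - w P h\<parallel> \<le> \<parallel>h - w B h\<parallel>\<close> and its mirror image (\<open>tetra_contraction_fractional\<close>), taken for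
  all unimodular \<open>w\<close>, yield \<open>B = A\<^sup>*P\<close> there. As \<open>A\<^sup>*\<close> commutes with the pure isometry \<open>P\<close>, this
  forces \<open>A = B = 0\<close> on \<open>H\<^sub>1\<close> (\<open>doubly_commuting_vanish\<close>). So the triple on \<open>H\<^sub>1\<close> is
  \<open>(0, 0, P)\<close>, and it extends to \<open>(0, 0, U)\<close> with a bilateral shift \<open>U\<close>
  (\<open>cnu_isometry_tetra_isometry\<close>).

  Maximality of \<open>H\<^sub>1\<close> comes down to the fact that the last component of a tetrablock unitary, whose
  spectrum is known only through the Taylor spectrum of the triple, is isometric
  (\<open>tetra_unitary_isometric\<close>). If it were not, the commuting normal operators would have joint
  approximate eigenvectors at a point with \<open>\<bar>p\<bar> \<noteq> 1\<close>. They are built one self-adjoint operator at a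
  time (\<open>approx_null_extend\<close>), after the Fuglede theorem (\<open>fuglede\<close>) has made the adjoints
  commute, and such a point belongs to the Taylor spectrum
  (\<open>approx_eigenvalue_in_taylor_spectrum\<close>).

  For \<open>H\<^sub>2\<close>, the adjoint triple inherits all norm estimates by duality, and the tetrablock being
  starlike for a weighted scaling keeps the invertibility of polynomials under restriction to an
  invariant subspace (\<open>adjoint_restriction_tetra_contraction\<close>). A reducing subspace on which \<open>P\<^sup>*\<close>
  is unitary is one on which \<open>P\<close> is unitary, so \<open>P\<^sup>*\<close> is completely non-unitary on \<open>H\<^sub>2\<close>. Strict
  decrease of the norms on a subspace means that it meets \<open>H\<^sub>1\<close> only in zero, and a subspace that
  contains \<open>H\<^sub>2\<close> and meets \<open>H\<^sub>1\<close> trivially equals \<open>H\<^sub>2\<close>.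
\<close>

section \<open>Geometry of complex Hilbert spaces\<close>

subclass (in complex_hilbert) banach ..

lemma scaleC_zero_left [simp]: "0 *\<^sub>C (x::'a::complex_inner) = 0"
  by (metis norm_scaleC mult_zero_left norm_eq_zero norm_zero)

lemma scaleC_zero_right [simp]: "c *\<^sub>C (0::'a::complex_inner) = 0"
  by (metis norm_scaleC mult_zero_right norm_eq_zero norm_zero)

lemma scaleC_one [simp]: "1 *\<^sub>C (x::'a::complex_inner) = x"
  by (metis scaleR_scaleC of_real_1 scaleR_one)

lemma scaleC_minus_right: "c *\<^sub>C (- x) = - (c *\<^sub>C (x::'a::complex_inner))"
  by (metis scaleC_add_right scaleC_zero_right add.right_inverse add_eq_0_iff)

lemma scaleC_minus_left: "(- c) *\<^sub>C x = - (c *\<^sub>C (x::'a::complex_inner))"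
  by (metis scaleC_add_left scaleC_zero_left add.right_inverse add_eq_0_iff)

lemma scaleC_diff_right: "c *\<^sub>C (x - y) = c *\<^sub>C x - c *\<^sub>C (y::'a::complex_inner)"
  using scaleC_add_right[of c x "- y"] by (simp add: scaleC_minus_right)

lemma scaleC_diff_left: "(c - d) *\<^sub>C x = c *\<^sub>C x - d *\<^sub>C (x::'a::complex_inner)"
  using scaleC_add_left[of c "- d" x] by (simp add: scaleC_minus_left)

lemma scaleC_minus_one [simp]: "(- 1) *\<^sub>C x = - (x::'a::complex_inner)"
  by (simp add: scaleC_minus_left)

lemmas scaleC_ring = scaleC_add_right scaleC_add_left scaleC_diff_right scaleC_diff_left scaleC_scaleC
  scaleC_minus_right scaleC_minus_left

lemma cinner_add_right: "cinner x (y + z) = cinner x y + cinner x (z::'a::complex_inner)"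
  by (metis cinner_commute cinner_add_left complex_cnj_add)

lemma cinner_scaleC_right: "cinner x (c *\<^sub>C y) = cnj c * cinner x (y::'a::complex_inner)"
  by (metis cinner_commute cinner_scaleC_left complex_cnj_mult)

lemma cinner_zero_left [simp]: "cinner 0 (x::'a::complex_inner) = 0"
  by (metis cinner_scaleC_left scaleC_zero_left mult_zero_left)

lemma cinner_zero_right [simp]: "cinner (x::'a::complex_inner) 0 = 0"
  by (metis cinner_scaleC_right scaleC_zero_left mult_zero_left complex_cnj_zero)

lemma cinner_minus_left: "cinner (- x) y = - cinner x (y::'a::complex_inner)"
  using cinner_scaleC_left[of "-1" x y] by simp

lemma cinner_minus_right: "cinner x (- y) = - cinner x (y::'a::complex_inner)"
  using cinner_scaleC_right[of x "-1" y] by simp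

lemma cinner_diff_left: "cinner (x - y) z = cinner x z - cinner y (z::'a::complex_inner)"
  using cinner_add_left[of x "- y" z] by (simp add: cinner_minus_left)

lemma cinner_diff_right: "cinner x (y - z) = cinner x y - cinner x (z::'a::complex_inner)"
  using cinner_add_right[of x y "- z"] by (simp add: cinner_minus_right)

lemma cinner_sum_left: "cinner (\<Sum>i\<in>I. f i) y = (\<Sum>i\<in>I. cinner (f i) (y::'a::complex_inner))"
  by (induction I rule: infinite_finite_induct) (simp_all add: cinner_add_left)

lemma cinner_sum_right: "cinner y (\<Sum>i\<in>I. f i) = (\<Sum>i\<in>I. cinner y (f i :: 'a::complex_inner))"
  by (induction I rule: infinite_finite_induct) (simp_all add: cinner_add_right)

lemmas cinner_ring = cinner_add_left cinner_add_right cinner_diff_left cinner_diff_right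
  cinner_minus_left cinner_minus_right cinner_scaleC_left cinner_scaleC_right

lemma cinner_self: "cinner x (x::'a::complex_inner) = of_real ((norm x)\<^sup>2)"
proof (rule complex_eqI)
  show "Im (cinner x x) = Im (of_real ((norm x)\<^sup>2))"
    using cinner_commute[of x x] by (metis cnj.simps(2) neg_equal_zero Im_complex_of_real)
qed (simp add: power2_norm_eq_inner inner_Re_cinner)

lemma cinner_eq_zero_commute: "cinner x y = 0 \<longleftrightarrow> cinner y (x::'a::complex_inner) = 0"
  by (metis cinner_commute complex_cnj_zero)

lemma cmod_cinner_le: "cmod (cinner x y) \<le> norm x * norm (y::'a::complex_inner)"
proof (cases "cinner x y = 0")
  case False
  \<comment> \<open>rotate \<open>x\<close> so that the inner product becomes real\<close>
  define c where "c = cnj (cinner x y) / of_real (cmod (cinner x y))"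
  have c: "cmod c = 1" using False by (simp add: c_def norm_divide)
  have "cinner (c *\<^sub>C x) y = of_real (cmod (cinner x y))"
    using False unfolding c_def cinner_scaleC_left
    by (simp add: field_simps complex_norm_square[symmetric] power2_eq_square)
  then have "cmod (cinner x y) = inner (c *\<^sub>C x) y" by (simp add: inner_Re_cinner)
  also have "\<dots> \<le> norm (c *\<^sub>C x) * norm y" by (rule norm_cauchy_schwarz)
  finally show ?thesis by (simp add: norm_scaleC c)
qed simp

lemma bounded_bilinear_cinner: "bounded_bilinear (cinner :: 'a::complex_inner \<Rightarrow> 'a \<Rightarrow> complex)"
proof
  show "cinner (r *\<^sub>R a) b = r *\<^sub>R cinner a b" for r and a b :: 'a
    by (simp add: scaleR_scaleC cinner_scaleC_left scaleR_conv_of_real)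
  show "cinner a (r *\<^sub>R b) = r *\<^sub>R cinner a b" for r and a b :: 'a
    by (simp add: scaleR_scaleC cinner_scaleC_right scaleR_conv_of_real)
  show "\<exists>K. \<forall>a b::'a. cmod (cinner a b) \<le> norm a * norm b * K"
    using cmod_cinner_le by (metis mult.right_neutral)
qed (simp_all add: cinner_add_left cinner_add_right)

lemmas tendsto_cinner = bounded_bilinear.tendsto[OF bounded_bilinear_cinner]

lemma norm_sq_add: "(norm (x + y))\<^sup>2 = (norm x)\<^sup>2 + (norm y)\<^sup>2 + 2 * Re (cinner x (y::'a::complex_inner))"
  by (simp add: power2_norm_eq_inner inner_add_left inner_add_right inner_commute flip: inner_Re_cinner)

lemma norm_sq_diff: "(norm (x - y))\<^sup>2 = (norm x)\<^sup>2 + (norm y)\<^sup>2 - 2 * Re (cinner x (y::'a::complex_inner))"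
  using norm_sq_add[of x "- y"] by (simp add: cinner_minus_right)

text \<open>
  The diagonal values at \<open>x + y\<close> and \<open>\<i> x + y\<close> determine the two symmetric combinations of
  \<open>\<langle>T x, y\<rangle>\<close> and \<open>\<langle>T y, x\<rangle>\<close>.
\<close>

lemma cinner_polarization_zero:
  fixes T :: "'a::complex_hilbert \<Rightarrow> 'a"
  assumes add: "\<And>x y. x \<in> S \<Longrightarrow> y \<in> S \<Longrightarrow> x + y \<in> S \<and> T (x + y) = T x + T y"
    and scale: "\<And>c x. x \<in> S \<Longrightarrow> c *\<^sub>C x \<in> S \<and> T (c *\<^sub>C x) = c *\<^sub>C T x"
    and diag: "\<And>x. x \<in> S \<Longrightarrow> cinner (T x) x = 0"
    and "x \<in> S" "y \<in> S"
  shows "cinner (T x) y = 0"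
proof -
  have ix: "\<i> *\<^sub>C x \<in> S" using scale assms(4) by blast
  have 1: "cinner (T x) y + cinner (T y) x = 0"
    using diag[of "x + y"] add[OF assms(4,5)] diag[OF assms(4)] diag[OF assms(5)]
    by (simp add: cinner_ring add.commute)
  have "cinner (T (\<i> *\<^sub>C x)) y + cinner (T y) (\<i> *\<^sub>C x) = 0"
    using diag[of "\<i> *\<^sub>C x + y"] add[OF ix assms(5)] diag[OF ix] diag[OF assms(5)]
    by (simp add: cinner_ring)
  then have 2: "cinner (T x) y - cinner (T y) x = 0"
    using scale[OF assms(4), of \<i>] by (simp add: cinner_ring flip: right_diff_distrib)
  from 1 2 have "2 * cinner (T x) y = 0" by (simp add: algebra_simps)
  then show ?thesis by simp
qed

lemma csubspaceD:
  assumes "closed_csubspace S"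
  shows "0 \<in> S" "\<And>x y. x \<in> S \<Longrightarrow> y \<in> S \<Longrightarrow> x + y \<in> S" "\<And>c x. x \<in> S \<Longrightarrow> c *\<^sub>C x \<in> S"
    "\<And>x. x \<in> S \<Longrightarrow> - x \<in> S" "\<And>x y. x \<in> S \<Longrightarrow> y \<in> S \<Longrightarrow> x - y \<in> S" "closed S"
    "\<And>r x. x \<in> S \<Longrightarrow> r *\<^sub>R x \<in> S"
proof -
  show 1: "0 \<in> S" "\<And>x y. x \<in> S \<Longrightarrow> y \<in> S \<Longrightarrow> x + y \<in> S" "\<And>c x. x \<in> S \<Longrightarrow> c *\<^sub>C x \<in> S" "closed S"
    using assms unfolding closed_csubspace_def by auto
  show 2: "- x \<in> S" if "x \<in> S" for x
    using 1(3)[OF that, of "-1"] by simp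
  show "x - y \<in> S" if "x \<in> S" "y \<in> S" for x y
    using 1(2)[OF that(1) 2[OF that(2)]] by simp
  show "r *\<^sub>R x \<in> S" if "x \<in> S" for r x
    using 1(3)[OF that] by (simp add: scaleR_scaleC)
qed

lemma csubspace_sum:
  assumes "closed_csubspace S" "\<And>i. i \<in> I \<Longrightarrow> f i \<in> S"
  shows "(\<Sum>i\<in>I. f i) \<in> S"
  using assms(2) by (induction I rule: infinite_finite_induct) (auto intro: csubspaceD[OF assms(1)])

lemma csubspace_UNIV: "closed_csubspace UNIV"
  by (simp add: closed_csubspace_def)

lemma csubspace_limit:
  assumes "closed_csubspace S" "\<And>n::nat. f n \<in> S" "f \<longlonglongrightarrow> l"
  shows "l \<in> S"
  using closed_sequentially[OF csubspaceD(6)[OF assms(1)]] assms(2,3) by blast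

subsection \<open>Orthogonal projection and the Riesz representation\<close>

text \<open>
  A minimizing sequence for the distance of \<open>x\<close> to \<open>S\<close> is Cauchy by the parallelogram law.
\<close>

lemma projection_exists:
  fixes S :: "'a::complex_hilbert set"
  assumes S: "closed_csubspace S"
  shows "\<exists>y\<in>S. \<forall>z\<in>S. cinner (x - y) z = 0"
proof -
  note SD = csubspaceD[OF S]
  define d where "d = (INF y\<in>S. (norm (x - y))\<^sup>2)"
  have bdd: "bdd_below ((\<lambda>y. (norm (x - y))\<^sup>2) ` S)"
    by (rule bdd_belowI[of _ 0]) auto
  have d_le: "d \<le> (norm (x - y))\<^sup>2" if "y \<in> S" for y
    unfolding d_def by (rule cINF_lower[OF bdd that])
  have "\<exists>y\<in>S. (norm (x - y))\<^sup>2 < d + 1 / Suc n" for n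
    using cINF_less_iff[OF _ bdd, of "d + 1 / Suc n"] SD(1) unfolding d_def by fastforce
  then obtain u where u: "\<And>n. u n \<in> S" "\<And>n. (norm (x - u n))\<^sup>2 < d + 1 / Suc n"
    by metis
  have dist_bound: "(norm (u m - u n))\<^sup>2 \<le> 2 / Suc m + 2 / Suc n" for m n
  proof -
    define a b where "a = x - u m" and "b = x - u n"
    have "(1/2) *\<^sub>R (u m + u n) \<in> S" by (intro SD u)
    then have "d \<le> (norm (x - (1/2) *\<^sub>R (u m + u n)))\<^sup>2" by (rule d_le)
    also have "x - (1/2) *\<^sub>R (u m + u n) = (1/2) *\<^sub>R (a + b)"
    proof -
      have "a + b = 2 *\<^sub>R x - (u m + u n)" by (simp add: a_def b_def scaleR_2)
      then show ?thesis by (simp add: scaleR_diff_right)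
    qed
    finally have "4 * d \<le> (norm (a + b))\<^sup>2" by (simp add: power_divide)
    moreover have "(norm (a + b))\<^sup>2 + (norm (b - a))\<^sup>2 = 2 * (norm a)\<^sup>2 + 2 * (norm b)\<^sup>2"
      using norm_sq_add[of b a] norm_sq_diff[of b a] by (simp add: add.commute)
    moreover have "b - a = u m - u n" by (simp add: a_def b_def)
    ultimately show ?thesis using u(2)[of m] u(2)[of n] by (simp add: a_def b_def)
  qed
  have "Cauchy u"
  proof (rule metric_CauchyI)
    fix e :: real assume e: "e > 0"
    obtain N :: nat where N: "4 / e\<^sup>2 < N" using reals_Archimedean2 by blast
    have "dist (u m) (u n) < e" if "m \<ge> N" "n \<ge> N" for m n
    proof -
      have Np: "real N > 0" using N e by (smt (verit) divide_pos_pos zero_less_power)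
      have "2 / real (Suc k) < e\<^sup>2 / 2" if "k \<ge> N" for k
      proof -
        have "4 < e\<^sup>2 * real N" using N e by (simp add: field_simps)
        also have "\<dots> \<le> e\<^sup>2 * real (Suc k)" using that by (intro mult_left_mono) auto
        finally show ?thesis by (simp add: field_simps)
      qed
      from this[OF that(1)] this[OF that(2)] dist_bound[of m n]
      have "(norm (u m - u n))\<^sup>2 < e\<^sup>2" by linarith
      then show ?thesis using e by (simp add: dist_norm power2_less_imp_less)
    qed
    then show "\<exists>M. \<forall>m\<ge>M. \<forall>n\<ge>M. dist (u m) (u n) < e" by blast
  qed
  then obtain y where y: "u \<longlonglongrightarrow> y" using Cauchy_convergent_iff convergent_def by blast
  have yS: "y \<in> S" by (rule csubspace_limit[OF S u(1) y])
  have "(norm (x - y))\<^sup>2 \<le> d"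
  proof (rule LIMSEQ_le)
    show "(\<lambda>n. (norm (x - u n))\<^sup>2) \<longlonglongrightarrow> (norm (x - y))\<^sup>2" by (intro tendsto_intros y)
    show "(\<lambda>n. d + 1 / Suc n) \<longlonglongrightarrow> d"
      using tendsto_add[OF tendsto_const LIMSEQ_inverse_real_of_nat, of d] by (simp add: inverse_eq_divide)
    show "\<exists>N. \<forall>n\<ge>N. (norm (x - u n))\<^sup>2 \<le> d + 1 / Suc n" using u(2) by (meson less_le)
  qed
  then have min: "(norm (x - y))\<^sup>2 \<le> (norm (x - y - w))\<^sup>2" if "w \<in> S" for w
    using d_le[of "y + w"] SD(2)[OF yS that] by (metis diff_diff_eq order_trans)
  have "cinner (x - y) z = 0" if z: "z \<in> S" for z
  proof (cases "z = 0")
    case False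
    \<comment> \<open>moving \<open>y\<close> by \<open>w\<close>, the component of \<open>x - y\<close> along \<open>z\<close>, would decrease the distance\<close>
    define w where "w = (cinner (x - y) z / of_real ((norm z)\<^sup>2)) *\<^sub>C z"
    have "cinner (x - y) w = of_real ((cmod (cinner (x - y) z))\<^sup>2 / (norm z)\<^sup>2)"
      using False by (simp add: w_def cinner_scaleC_right mult.commute flip: complex_norm_square)
    moreover have "(norm w)\<^sup>2 = (cmod (cinner (x - y) z))\<^sup>2 / (norm z)\<^sup>2"
      using False by (simp add: w_def norm_scaleC norm_divide norm_mult norm_power field_simps
          power2_eq_square)
    moreover have "(norm (x - y))\<^sup>2 \<le> (norm (x - y - w))\<^sup>2"
      by (rule min) (auto simp: w_def intro: SD z)
    ultimately have "(cmod (cinner (x - y) z))\<^sup>2 / (norm z)\<^sup>2 \<le> 0"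
      using norm_sq_diff[of "x - y" w] by simp
    then show ?thesis using False by (simp add: divide_le_0_iff)
  qed simp
  with yS show ?thesis by blast
qed

text \<open>
  A vector orthogonal to the kernel of the functional represents it after rescaling, because the
  kernel has codimension one.
\<close>

lemma riesz_representation:
  fixes S :: "'a::complex_hilbert set"
  assumes S: "closed_csubspace S"
    and add: "\<And>x y. x \<in> S \<Longrightarrow> y \<in> S \<Longrightarrow> \<phi> (x + y) = \<phi> x + \<phi> y"
    and scale: "\<And>c x. x \<in> S \<Longrightarrow> \<phi> (c *\<^sub>C x) = c * \<phi> x"
    and bound: "\<And>x. x \<in> S \<Longrightarrow> cmod (\<phi> x) \<le> C * norm x"
  shows "\<exists>z\<in>S. \<forall>x\<in>S. \<phi> x = cinner x z"
proof (cases "\<forall>x\<in>S. \<phi> x = 0")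
  case True
  then show ?thesis by (auto intro!: bexI[of _ 0] csubspaceD[OF S])
next
  case False
  note SD = csubspaceD[OF S]
  have diff: "\<phi> (x - y) = \<phi> x - \<phi> y" if "x \<in> S" "y \<in> S" for x y
    using add[OF that(1) SD(4)[OF that(2)]] scale[OF that(2), of "-1"] by simp
  define M where "M = {x \<in> S. \<phi> x = 0}"
  have M: "closed_csubspace M"
    unfolding closed_csubspace_def
  proof (intro conjI ballI allI)
    show "0 \<in> M" using scale[of 0 0] SD(1) by (simp add: M_def)
    show "x + y \<in> M" if "x \<in> M" "y \<in> M" for x y
      using that SD(2) by (auto simp: M_def add)
    show "c *\<^sub>C x \<in> M" if "x \<in> M" for c x
      using that SD(3) by (auto simp: M_def scale)
    show "closed M" unfolding closed_sequential_limits
    proof (intro allI impI, elim conjE)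
      fix f l assume f: "\<forall>n. f n \<in> M" and l: "f \<longlonglongrightarrow> l"
      have fS: "\<And>n. f n \<in> S" using f by (auto simp: M_def)
      have lS: "l \<in> S" by (rule csubspace_limit[OF S fS l])
      have "cmod (\<phi> l) \<le> C * norm (f n - l)" for n
      proof -
        have "\<phi> (f n - l) = - \<phi> l" using diff[OF fS lS] f by (simp add: M_def)
        then show ?thesis using bound[OF SD(5)[OF fS lS], of n] by simp
      qed
      moreover have "(\<lambda>n. C * norm (f n - l)) \<longlonglongrightarrow> C * norm (l - l)"
        by (intro tendsto_intros l)
      ultimately have "cmod (\<phi> l) \<le> 0"
        by (intro LIMSEQ_le_const[where X = "\<lambda>n. C * norm (f n - l)"]) auto
      then show "l \<in> M" using lS by (simp add: M_def)
    qed
  qed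
  obtain x0 where x0: "x0 \<in> S" "\<phi> x0 \<noteq> 0" using False by blast
  obtain p where p: "p \<in> M" "\<And>z. z \<in> M \<Longrightarrow> cinner (x0 - p) z = 0"
    using projection_exists[OF M, of x0] by blast
  define e where "e = x0 - p"
  have pS: "p \<in> S" and \<phi>p: "\<phi> p = 0" using p by (auto simp: M_def)
  have e: "e \<in> S" "\<phi> e = \<phi> x0" using diff[OF x0(1) pS] \<phi>p SD(5)[OF x0(1) pS] by (simp_all add: e_def)
  then have \<phi>e: "\<phi> e \<noteq> 0" using x0 by simp
  have ene: "e \<noteq> 0" using scale[OF e(1), of 0] \<phi>e by auto
  define z where "z = (cnj (\<phi> e) / of_real ((norm e)\<^sup>2)) *\<^sub>C e"
  have "\<phi> x = cinner x z" if x: "x \<in> S" for x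
  proof -
    \<comment> \<open>the component of \<open>x\<close> in the kernel \<open>M\<close>\<close>
    define v where "v = x - (\<phi> x / \<phi> e) *\<^sub>C e"
    have "v \<in> M" using diff[OF x SD(3)[OF e(1)]] scale[OF e(1)] SD(5)[OF x SD(3)[OF e(1)]] \<phi>e
      by (simp add: M_def v_def)
    then have "cinner v e = 0" using p(2) e_def cinner_eq_zero_commute by blast
    then have "cinner x e = (\<phi> x / \<phi> e) * of_real ((norm e)\<^sup>2)"
      by (simp add: v_def cinner_ring cinner_self)
    then show ?thesis using \<phi>e ene by (simp add: z_def cinner_scaleC_right)
  qed
  moreover have "z \<in> S" by (simp add: z_def SD(3) e(1))
  ultimately show ?thesis by blast
qed

section \<open>Bounded operators on a closed subspace and their adjoints\<close>

lemma bounded_opD: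
  assumes "bounded_op_on S T"
  shows "\<And>x. x \<in> S \<Longrightarrow> T x \<in> S" "\<And>x y. x \<in> S \<Longrightarrow> y \<in> S \<Longrightarrow> T (x + y) = T x + T y"
    "\<And>c x. x \<in> S \<Longrightarrow> T (c *\<^sub>C x) = c *\<^sub>C T x"
  using assms unfolding bounded_op_on_def by auto

lemma bounded_op_bound:
  assumes "bounded_op_on S T"
  obtains C where "C > 0" "\<And>x. x \<in> S \<Longrightarrow> norm (T x) \<le> C * norm x"
proof -
  obtain C where C: "\<And>x. x \<in> S \<Longrightarrow> norm (T x) \<le> C * norm x"
    using assms unfolding bounded_op_on_def by metis
  have "norm (T x) \<le> max C 1 * norm x" if "x \<in> S" for x
    using C[OF that] mult_right_mono[of C "max C 1" "norm x"] by fastforce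
  then show ?thesis by (intro that[of "max C 1"]) auto
qed

lemma bounded_op_onI:
  assumes "\<And>x. x \<in> S \<Longrightarrow> T x \<in> S" "\<And>x y. x \<in> S \<Longrightarrow> y \<in> S \<Longrightarrow> T (x + y) = T x + T y"
    "\<And>c x. x \<in> S \<Longrightarrow> T (c *\<^sub>C x) = c *\<^sub>C T x" "\<And>x. x \<in> S \<Longrightarrow> norm (T x) \<le> C * norm x"
  shows "bounded_op_on S T"
  using assms unfolding bounded_op_on_def by blast

lemma bounded_op_zero:
  assumes "bounded_op_on S T" "closed_csubspace S"
  shows "T 0 = 0"
  using bounded_opD(3)[OF assms(1) csubspaceD(1)[OF assms(2)], of 0] by simp

lemma bounded_op_minus:
  assumes "bounded_op_on S T" "closed_csubspace S" "x \<in> S"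
  shows "T (- x) = - T x"
  using bounded_opD(3)[OF assms(1,3), of "-1"] by simp

lemma bounded_op_diff:
  assumes "bounded_op_on S T" "closed_csubspace S" "x \<in> S" "y \<in> S"
  shows "T (x - y) = T x - T y"
  using bounded_opD(2)[OF assms(1) assms(3) csubspaceD(4)[OF assms(2,4)]]
    bounded_op_minus[OF assms(1,2,4)] by simp

lemma bounded_op_sum:
  assumes "bounded_op_on S T" "closed_csubspace S" "\<And>i. i \<in> I \<Longrightarrow> f i \<in> S"
  shows "T (\<Sum>i\<in>I. f i) = (\<Sum>i\<in>I. T (f i))"
  using assms(3)
proof (induction I rule: infinite_finite_induct)
  case (insert i I)
  then show ?case
    using bounded_opD(2)[OF assms(1), of "f i" "sum f I"] csubspace_sum[OF assms(2), of I f] by simp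
qed (simp_all add: bounded_op_zero[OF assms(1,2)])

lemma bounded_op_tendsto:
  assumes T: "bounded_op_on S T" and S: "closed_csubspace S"
    and f: "\<And>n. f n \<in> S" and l: "l \<in> S" and lim: "(f \<longlongrightarrow> l) F"
  shows "((\<lambda>n. T (f n)) \<longlongrightarrow> T l) F"
proof -
  obtain C where C: "\<And>x. x \<in> S \<Longrightarrow> norm (T x) \<le> C * norm x"
    using bounded_op_bound[OF T] by blast
  have "((\<lambda>n. C * norm (f n - l)) \<longlongrightarrow> C * norm (l - l)) F" by (intro tendsto_intros lim)
  then have "((\<lambda>n. C * norm (f n - l)) \<longlongrightarrow> 0) F" by simp
  then have "((\<lambda>n. T (f n) - T l) \<longlongrightarrow> 0) F"
    by (rule Lim_null_comparison[rotated])
      (use C csubspaceD(5)[OF S f l] in \<open>simp add: bounded_op_diff[OF T S f l, symmetric]\<close>)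
  then show ?thesis by (simp add: LIM_zero_iff)
qed

lemma bounded_op_comp:
  assumes "bounded_op_on S T" "bounded_op_on S R"
  shows "bounded_op_on S (\<lambda>x. T (R x))"
proof -
  obtain C where C: "C > 0" "\<And>x. x \<in> S \<Longrightarrow> norm (T x) \<le> C * norm x"
    using bounded_op_bound[OF assms(1)] by blast
  obtain D where D: "D > 0" "\<And>x. x \<in> S \<Longrightarrow> norm (R x) \<le> D * norm x"
    using bounded_op_bound[OF assms(2)] by blast
  have "norm (T (R x)) \<le> (C * D) * norm x" if "x \<in> S" for x
    using C(2)[OF bounded_opD(1)[OF assms(2) that]] mult_left_mono[OF D(2)[OF that] less_imp_le[OF C(1)]]
    by (simp add: mult.assoc)
  then show ?thesis by (intro bounded_op_onI) (auto simp: bounded_opD[OF assms(1)] bounded_opD[OF assms(2)])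
qed

lemma bounded_op_add:
  assumes "closed_csubspace S" "bounded_op_on S T" "bounded_op_on S R"
  shows "bounded_op_on S (\<lambda>x. T x + R x)"
proof -
  obtain C where C: "C > 0" "\<And>x. x \<in> S \<Longrightarrow> norm (T x) \<le> C * norm x"
    using bounded_op_bound[OF assms(2)] by blast
  obtain D where D: "D > 0" "\<And>x. x \<in> S \<Longrightarrow> norm (R x) \<le> D * norm x"
    using bounded_op_bound[OF assms(3)] by blast
  have "norm (T x + R x) \<le> (C + D) * norm x" if "x \<in> S" for x
    using norm_triangle_ineq[of "T x" "R x"] C(2)[OF that] D(2)[OF that] by (simp add: algebra_simps)
  then show ?thesis
    by (intro bounded_op_onI)
      (auto simp: bounded_opD[OF assms(2)] bounded_opD[OF assms(3)] scaleC_ring intro: csubspaceD[OF assms(1)])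
qed

lemma bounded_op_scaleC:
  assumes "closed_csubspace S" "bounded_op_on S T"
  shows "bounded_op_on S (\<lambda>x. c *\<^sub>C T x)"
proof -
  obtain C where C: "C > 0" "\<And>x. x \<in> S \<Longrightarrow> norm (T x) \<le> C * norm x"
    using bounded_op_bound[OF assms(2)] by blast
  have "norm (c *\<^sub>C T x) \<le> (cmod c * C) * norm x" if "x \<in> S" for x
    using mult_left_mono[OF C(2)[OF that], of "cmod c"] by (simp add: norm_scaleC mult.assoc)
  then show ?thesis
    by (intro bounded_op_onI[where C = "cmod c * C"])
      (auto simp: bounded_opD[OF assms(2)] scaleC_ring mult.commute intro: csubspaceD[OF assms(1)])
qed

lemma bounded_op_ident: "bounded_op_on S (\<lambda>x. x)"
  by (rule bounded_op_onI[where C = 1]) auto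

lemma bounded_op_subtract:
  assumes "closed_csubspace S" "bounded_op_on S T" "bounded_op_on S R"
  shows "bounded_op_on S (\<lambda>x. T x - R x)"
  using bounded_op_add[OF assms(1,2) bounded_op_scaleC[OF assms(1,3), of "-1"]] by simp

lemma bounded_op_funpow:
  assumes "bounded_op_on S T"
  shows "bounded_op_on S (T ^^ n)"
proof (induction n)
  case 0
  then show ?case using bounded_op_ident by (simp add: id_def)
next
  case (Suc n)
  then show ?case using bounded_op_comp[OF assms Suc] by (simp add: comp_def)
qed

lemma bounded_op_restrict:
  assumes "bounded_op_on S T" "M \<subseteq> S" "T ` M \<subseteq> M"
  shows "bounded_op_on M T"
  using assms unfolding bounded_op_on_def by (meson subsetD)

lemma csubspace_kernel:
  assumes S: "closed_csubspace S" and T: "bounded_op_on S T"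
  shows "closed_csubspace {x \<in> S. T x = 0}"
  unfolding closed_csubspace_def
proof (intro conjI ballI allI)
  note SD = csubspaceD[OF S] and TD = bounded_opD[OF T]
  show "0 \<in> {x \<in> S. T x = 0}" using bounded_op_zero[OF T S] SD(1) by simp
  show "x + y \<in> {x \<in> S. T x = 0}" if "x \<in> {x \<in> S. T x = 0}" "y \<in> {x \<in> S. T x = 0}" for x y
    using that TD(2) SD(2) by simp
  show "c *\<^sub>C x \<in> {x \<in> S. T x = 0}" if "x \<in> {x \<in> S. T x = 0}" for c x
    using that TD(3) SD(3) by simp
  show "closed {x \<in> S. T x = 0}" unfolding closed_sequential_limits
  proof (intro allI impI, elim conjE)
    fix f l assume f: "\<forall>n. f n \<in> {x \<in> S. T x = 0}" and l: "f \<longlonglongrightarrow> l"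
    have fS: "f n \<in> S" for n using f by auto
    have lS: "l \<in> S" by (rule csubspace_limit[OF S fS l])
    have "(\<lambda>n. T (f n)) \<longlonglongrightarrow> T l" by (rule bounded_op_tendsto[OF T S fS lS l])
    then show "l \<in> {x \<in> S. T x = 0}" using f lS by (simp add: LIMSEQ_const_iff)
  qed
qed

lemma csubspace_INT: "(\<And>i. closed_csubspace (M i)) \<Longrightarrow> closed_csubspace (\<Inter>i. M i)"
  unfolding closed_csubspace_def by (auto intro: closed_INT)

lemma funpow_norm_le:
  assumes T: "bounded_op_on S T" and C: "C > 0" "\<And>x. x \<in> S \<Longrightarrow> norm (T x) \<le> C * norm x" and x: "x \<in> S"
  shows "norm ((T ^^ n) x) \<le> C ^ n * norm x"
proof (induction n)
  case (Suc n)
  have "norm ((T ^^ Suc n) x) \<le> C * norm ((T ^^ n) x)"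
    using C(2)[OF bounded_opD(1)[OF bounded_op_funpow[OF T] x]] by simp
  also have "\<dots> \<le> C * (C ^ n * norm x)" using C(1) Suc by (intro mult_left_mono) auto
  finally show ?case by simp
qed simp

lemma cinner_eqI:
  assumes "closed_csubspace S" "y \<in> S" "z \<in> S" "\<And>x. x \<in> S \<Longrightarrow> cinner x y = cinner x z"
  shows "y = z"
proof -
  have "cinner (y - z) (y - z) = 0"
    using assms(4)[OF csubspaceD(5)[OF assms(1-3)]] by (simp add: cinner_diff_right)
  then show ?thesis by (simp add: cinner_self)
qed

lemma adj_on:
  fixes S :: "'a::complex_hilbert set"
  assumes S: "closed_csubspace S" and T: "bounded_op_on S T" and y: "y \<in> S"
  shows adj_on_closed: "adj_on S T y \<in> S"
    and cinner_adj_on: "\<And>x. x \<in> S \<Longrightarrow> cinner (T x) y = cinner x (adj_on S T y)"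
proof -
  obtain C where C: "C > 0" "\<And>x. x \<in> S \<Longrightarrow> norm (T x) \<le> C * norm x"
    using bounded_op_bound[OF T] by blast
  have "\<exists>z\<in>S. \<forall>x\<in>S. cinner (T x) y = cinner x z"
  proof (rule riesz_representation[OF S, where C = "C * norm y"])
    show "cmod (cinner (T x) y) \<le> C * norm y * norm x" if "x \<in> S" for x
      using order_trans[OF cmod_cinner_le mult_right_mono[OF C(2)[OF that], of "norm y"]]
      by (simp add: algebra_simps)
  qed (simp_all add: bounded_opD[OF T] cinner_ring)
  then obtain z where z: "z \<in> S" "\<forall>x\<in>S. cinner (T x) y = cinner x z" by blast
  have "adj_on S T y \<in> S \<and> (\<forall>x\<in>S. cinner (T x) y = cinner x (adj_on S T y))"
    unfolding adj_on_def
  proof (rule theI)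
    show "z \<in> S \<and> (\<forall>x\<in>S. cinner (T x) y = cinner x z)" using z by blast
    show "z' = z" if "z' \<in> S \<and> (\<forall>x\<in>S. cinner (T x) y = cinner x z')" for z'
      by (rule cinner_eqI[OF S]) (use that z in auto)
  qed
  then show "adj_on S T y \<in> S" "\<And>x. x \<in> S \<Longrightarrow> cinner (T x) y = cinner x (adj_on S T y)" by auto
qed

lemma cinner_adj_on':
  assumes "closed_csubspace S" "bounded_op_on S T" "y \<in> S" "x \<in> S"
  shows "cinner (adj_on S T y) x = cinner y (T x)"
  by (metis cinner_adj_on[OF assms] cinner_commute)

lemma adj_on_unique:
  assumes "closed_csubspace S" "bounded_op_on S T" "y \<in> S" "z \<in> S"
    "\<And>x. x \<in> S \<Longrightarrow> cinner (T x) y = cinner x z"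
  shows "adj_on S T y = z"
  by (rule cinner_eqI[OF assms(1)])
    (use assms adj_on_closed[OF assms(1-3)] cinner_adj_on[OF assms(1-3)] in auto)

lemma adj_on_norm_le:
  assumes S: "closed_csubspace S" and T: "bounded_op_on S T" and y: "y \<in> S"
    and C: "\<And>x. x \<in> S \<Longrightarrow> norm (T x) \<le> C * norm x"
  shows "norm (adj_on S T y) \<le> C * norm y"
proof (cases "adj_on S T y = 0")
  case True
  have "norm (T y) \<le> C * norm y" by (rule C[OF y])
  then show ?thesis using True order_trans[OF norm_ge_zero] by auto
next
  case False
  define z where "z = adj_on S T y"
  have z: "z \<in> S" unfolding z_def by (rule adj_on_closed[OF S T y])
  have "(norm z)\<^sup>2 = cmod (cinner (T z) y)"
    using cinner_adj_on[OF S T y z] by (simp add: cinner_self norm_power flip: z_def)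
  also have "\<dots> \<le> norm (T z) * norm y" by (rule cmod_cinner_le)
  also have "\<dots> \<le> (C * norm z) * norm y" by (intro mult_right_mono C z) simp
  finally have "norm z * norm z \<le> norm z * (C * norm y)" by (simp add: power2_eq_square algebra_simps)
  then show ?thesis using False by (simp add: z_def)
qed

lemma adj_on_bounded:
  assumes S: "closed_csubspace S" and T: "bounded_op_on S T"
  shows "bounded_op_on S (adj_on S T)"
proof -
  obtain C where C: "\<And>x. x \<in> S \<Longrightarrow> norm (T x) \<le> C * norm x"
    using bounded_op_bound[OF T] by blast
  note closed = adj_on_closed[OF S T] and ci = cinner_adj_on[OF S T] and SD = csubspaceD[OF S]
  show ?thesis
  proof (rule bounded_op_onI[where C = C])
    show "adj_on S T (x + y) = adj_on S T x + adj_on S T y" if "x \<in> S" "y \<in> S" for x y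
      by (rule adj_on_unique[OF S T]) (use that closed ci in \<open>auto simp: cinner_ring intro: SD\<close>)
    show "adj_on S T (c *\<^sub>C x) = c *\<^sub>C adj_on S T x" if "x \<in> S" for c x
      by (rule adj_on_unique[OF S T]) (use that closed ci in \<open>auto simp: cinner_ring intro: SD\<close>)
  qed (use closed adj_on_norm_le[OF S T _ C] in auto)
qed

lemma adj_on_adj_on:
  assumes S: "closed_csubspace S" and T: "bounded_op_on S T" and y: "y \<in> S"
  shows "adj_on S (adj_on S T) y = T y"
  by (rule adj_on_unique[OF S adj_on_bounded[OF S T] y])
    (use bounded_opD(1)[OF T y] cinner_adj_on'[OF S T _ y] in auto)

lemma adj_on_commute:
  assumes S: "closed_csubspace S" and T: "bounded_op_on S T" and R: "bounded_op_on S R"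
    and comm: "\<And>x. x \<in> S \<Longrightarrow> T (R x) = R (T x)" and y: "y \<in> S"
  shows "adj_on S T (adj_on S R y) = adj_on S R (adj_on S T y)"
proof (rule cinner_eqI[OF S])
  note aT = adj_on_closed[OF S T] and aR = adj_on_closed[OF S R]
  show "adj_on S T (adj_on S R y) \<in> S" "adj_on S R (adj_on S T y) \<in> S" by (intro aT aR y)+
  show "cinner x (adj_on S T (adj_on S R y)) = cinner x (adj_on S R (adj_on S T y))" if "x \<in> S" for x
    using that y comm[OF that] bounded_opD(1)[OF T] bounded_opD(1)[OF R]
    by (simp add: aT aR flip: cinner_adj_on[OF S T] cinner_adj_on[OF S R])
qed

lemma adj_on_funpow:
  assumes S: "closed_csubspace S" and T: "bounded_op_on S T" and x: "x \<in> S" and y: "y \<in> S"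
  shows "cinner ((T ^^ n) x) y = cinner x ((adj_on S T ^^ n) y)"
  using y
proof (induction n arbitrary: y)
  case (Suc n)
  have "cinner ((T ^^ Suc n) x) y = cinner ((T ^^ n) x) (adj_on S T y)"
    using cinner_adj_on[OF S T Suc.prems bounded_opD(1)[OF bounded_op_funpow[OF T] x]] by simp
  also have "\<dots> = cinner x ((adj_on S T ^^ Suc n) y)"
    using Suc.IH[OF adj_on_closed[OF S T Suc.prems]] by (simp add: funpow_swap1)
  finally show ?case .
qed simp

lemma funpow_commute_on:
  assumes "\<And>x. x \<in> S \<Longrightarrow> T (R x) = R (T x)" "R ` S \<subseteq> S" "x \<in> S"
  shows "T ((R ^^ n) x) = (R ^^ n) (T x)"
proof (induction n)
  case (Suc n)
  have "(R ^^ n) x \<in> S" using assms(2,3) by (induction n) auto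
  then show ?case using Suc assms(1) by simp
qed simp

section \<open>The closed tetrablock\<close>

text \<open>
  For fixed \<open>w\<close> the defining expression is affine in \<open>z\<close>; that it has no zero in the closed disc
  is an inequality between its two coefficients.
\<close>

lemma tetrablock_bound:
  assumes "(a, b, p) \<in> tetrablock" "cmod w \<le> 1"
  shows "cmod (a - w * p) \<le> cmod (1 - w * b)"
proof (rule ccontr)
  assume "\<not> ?thesis"
  then have less: "cmod (1 - w * b) < cmod (a - w * p)" by simp
  define z where "z = (1 - w * b) / (a - w * p)"
  have ne: "a - w * p \<noteq> 0" using less by auto
  have "cmod z \<le> 1" using less ne by (simp add: z_def norm_divide)
  moreover have "1 - z * a - w * b + z * w * p = (1 - w * b) - z * (a - w * p)"
    by (simp add: algebra_simps)
  moreover have "z * (a - w * p) = 1 - w * b" using ne by (simp add: z_def)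
  ultimately have "cmod z \<le> 1 \<and> 1 - z * a - w * b + z * w * p = 0" by simp
  moreover have "1 - z * a - w * b + z * w * p \<noteq> 0" if "cmod z \<le> 1"
    using assms that unfolding tetrablock_def by blast
  ultimately show False by blast
qed

lemma tetrablock_bound_coord: "(a, b, p) \<in> tetrablock \<Longrightarrow> cmod b \<le> 1"
proof (rule ccontr)
  assume T: "(a, b, p) \<in> tetrablock" and b: "\<not> cmod b \<le> 1"
  then have "b \<noteq> 0" by auto
  have "cmod (1 / b) \<le> 1" using b by (simp add: norm_divide divide_le_eq)
  moreover have "\<And>z w. cmod z \<le> 1 \<Longrightarrow> cmod w \<le> 1 \<Longrightarrow> 1 - z * a - w * b + z * w * p \<noteq> 0"
    using T unfolding tetrablock_def by blast
  from this[of 0 "1 / b"] have "cmod (1 / b) \<le> 1 \<Longrightarrow> 1 - 0 * a - (1 / b) * b + 0 * (1 / b) * p \<noteq> 0"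
    by simp
  ultimately show False using \<open>b \<noteq> 0\<close> by simp
qed

lemma closure_tetrablock_coord: "(a, b, p) \<in> closure tetrablock \<Longrightarrow> cmod b \<le> 1"
proof -
  have "closed {x::complex \<times> complex \<times> complex. cmod (fst (snd x)) \<le> 1}"
    by (intro closed_Collect_le continuous_intros)
  moreover have "tetrablock \<subseteq> {x. cmod (fst (snd x)) \<le> 1}"
    using tetrablock_bound_coord by auto
  ultimately have "closure tetrablock \<subseteq> {x. cmod (fst (snd x)) \<le> 1}" by (rule closure_minimal[rotated])
  then show "(a, b, p) \<in> closure tetrablock \<Longrightarrow> cmod b \<le> 1" by auto
qed

lemma closure_tetrablock_bound:
  assumes "(a, b, p) \<in> closure tetrablock" "cmod w \<le> 1"
  shows "cmod (a - w * p) \<le> cmod (1 - w * b)"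
proof -
  have "closed {x::complex \<times> complex \<times> complex.
      cmod (fst x - w * snd (snd x)) \<le> cmod (1 - w * fst (snd x))}"
    by (intro closed_Collect_le continuous_intros)
  moreover have "tetrablock \<subseteq> {x. cmod (fst x - w * snd (snd x)) \<le> cmod (1 - w * fst (snd x))}"
    using tetrablock_bound assms(2) by auto
  ultimately have "closure tetrablock \<subseteq> {x. cmod (fst x - w * snd (snd x)) \<le> cmod (1 - w * fst (snd x))}"
    by (rule closure_minimal[rotated])
  then show ?thesis using assms(1) by auto
qed

lemma scaled_into_tetrablock:
  fixes r :: real and a b p :: complex
  assumes x: "\<And>z w. cmod z < 1 \<Longrightarrow> cmod w < 1 \<Longrightarrow> 1 - z * a - w * b + z * w * p \<noteq> 0"
    and r: "0 \<le> r" "r < 1"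
  shows "(r * a, r * b, r\<^sup>2 * p) \<in> tetrablock"
  unfolding tetrablock_def
proof (clarify, goal_cases)
  case (1 z w)
  have "cmod (r * u) < 1" if "cmod u \<le> 1" for u :: complex
    using that r mult_left_mono[OF that r(1)] by (simp add: norm_mult abs_of_nonneg)
  from x[OF this[OF 1(1)] this[OF 1(2)]] 1(3) show ?case
    by (simp add: algebra_simps power2_eq_square)
qed

text \<open>
  The coefficient inequalities survive the closure and give the nonvanishing on the open bidisc.
  Conversely, scaling by \<open>r < 1\<close> turns nonvanishing on the open bidisc into nonvanishing on the
  closed one.
\<close>

lemma closure_tetrablock_iff:
  "(a, b, p) \<in> closure tetrablock \<longleftrightarrow>
    (\<forall>z w. cmod z < 1 \<and> cmod w < 1 \<longrightarrow> 1 - z * a - w * b + z * w * p \<noteq> 0)"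
    (is "_ \<longleftrightarrow> ?R")
proof
  assume x: "(a, b, p) \<in> closure tetrablock"
  show ?R
  proof (clarify)
    fix z w assume z: "cmod z < 1" and w: "cmod w < 1" and "1 - z * a - w * b + z * w * p = 0"
    then have "1 - w * b = z * (a - w * p)" by (simp add: algebra_simps)
    then have eq: "cmod (1 - w * b) = cmod z * cmod (a - w * p)" by (simp add: norm_mult)
    have "cmod (w * b) < 1"
      using closure_tetrablock_coord[OF x] w mult_left_mono[of "cmod b" 1 "cmod w"] by (simp add: norm_mult)
    then have "w * b \<noteq> 1" by auto
    then have "cmod (1 - w * b) > 0" by simp
    moreover have "cmod (1 - w * b) \<le> cmod z * cmod (1 - w * b)"
      unfolding eq[symmetric] using mult_left_mono[OF closure_tetrablock_bound[OF x less_imp_le[OF w]], of "cmod z"]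
      by (simp add: eq)
    ultimately show False using z by simp
  qed
next
  assume R: ?R
  define r :: "nat \<Rightarrow> real" where "r n = 1 - inverse (Suc n)" for n
  have r: "0 \<le> r n" "r n < 1" for n by (auto simp: r_def inverse_le_1_iff)
  have "r \<longlonglongrightarrow> 1 - 0" unfolding r_def by (intro tendsto_intros LIMSEQ_inverse_real_of_nat)
  then have lim: "r \<longlonglongrightarrow> 1" by simp
  have "(\<lambda>n. (r n * a, r n * b, (r n)\<^sup>2 * p)) \<longlonglongrightarrow> (of_real 1 * a, of_real 1 * b, (of_real 1)\<^sup>2 * p)"
    unfolding of_real_power by (intro tendsto_intros lim)
  moreover have "(r n * a, r n * b, (r n)\<^sup>2 * p) \<in> tetrablock" for n
    using scaled_into_tetrablock[OF _ r] R by blast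
  ultimately show "(a, b, p) \<in> closure tetrablock"
    unfolding closure_sequential by (intro exI conjI allI) auto
qed

lemma closure_tetrablock_swap: "(a, b, p) \<in> closure tetrablock \<Longrightarrow> (b, a, p) \<in> closure tetrablock"
  unfolding closure_tetrablock_iff
proof (clarify, goal_cases)
  case (1 z w)
  then have "1 - w * a - z * b + w * z * p \<noteq> 0" by blast
  with 1(4) show ?case by (simp add: algebra_simps)
qed

lemma closure_tetrablock_cnj:
  "(a, b, p) \<in> closure tetrablock \<Longrightarrow> (cnj a, cnj b, cnj p) \<in> closure tetrablock"
  unfolding closure_tetrablock_iff
proof (clarify, goal_cases)
  case (1 z w)
  then have "1 - cnj z * a - cnj w * b + cnj z * cnj w * p \<noteq> 0" by simp
  then have "cnj (1 - cnj z * a - cnj w * b + cnj z * cnj w * p) \<noteq> 0"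
    by (simp only: complex_cnj_zero_iff not_False_eq_True)
  with 1(4) show ?case by simp
qed

lemma closure_tetrablock_scale:
  fixes t :: real and a b p :: complex
  assumes x: "(a, b, p) \<in> closure tetrablock" and t: "0 \<le> t" "t \<le> 1"
  shows "(t * a, t * b, t\<^sup>2 * p) \<in> closure tetrablock"
  unfolding closure_tetrablock_iff
proof (intro allI impI notI, elim conjE, goal_cases)
  case (1 z w)
  have "cmod (t * u) < 1" if "cmod u < 1" for u :: complex
    using that t mult_right_mono[OF t(2), of "cmod u"] by (simp add: norm_mult)
  from this[OF 1(2)] this[OF 1(3)] x
  have "1 - (t * z) * a - (t * w) * b + (t * z) * (t * w) * p \<noteq> 0"
    unfolding closure_tetrablock_iff by blast
  with 1(1) show ?case by (simp add: algebra_simps power2_eq_square)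
qed

lemma unimodular_in_dist_boundary: "cmod p = 1 \<Longrightarrow> (0, 0, p) \<in> tetrablock_dist_boundary"
proof -
  assume p: "cmod p = 1"
  have "1 + z * w * p \<noteq> 0" if "cmod z < 1" "cmod w < 1" for z w
  proof
    assume "1 + z * w * p = 0"
    then have "cmod (z * w * p) = 1" by (metis add_eq_0_iff norm_minus_cancel norm_one)
    moreover have "cmod z * cmod w < 1"
      using mult_strict_mono'[of "cmod z" 1 "cmod w" 1] that by simp
    ultimately show False using p by (simp add: norm_mult)
  qed
  then show ?thesis unfolding tetrablock_dist_boundary_def using p by (auto simp: closure_tetrablock_iff)
qed

lemma zero_in_closure_tetrablock: "(0, 0, 0) \<in> closure tetrablock"
  by (simp add: closure_tetrablock_iff)

section \<open>Polynomials in commuting triples\<close>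

lemma poly3_eval_superset:
  assumes "finite F" "Poly_Mapping.keys f \<subseteq> F"
  shows "poly3_eval f (x, y, z) = (\<Sum>(i, j, k)\<in>F. Poly_Mapping.lookup f (i, j, k) * x ^ i * y ^ j * z ^ k)"
  unfolding poly3_eval_def prod.case
  using assms by (intro sum.mono_neutral_left) (auto simp: in_keys_iff)

lemma poly3_op_superset:
  fixes A B P :: "'a::complex_hilbert \<Rightarrow> 'a"
  assumes "finite F" "Poly_Mapping.keys f \<subseteq> F"
  shows "poly3_op f A B P x =
    (\<Sum>(i, j, k)\<in>F. Poly_Mapping.lookup f (i, j, k) *\<^sub>C (A ^^ i) ((B ^^ j) ((P ^^ k) x)))"
  unfolding poly3_op_def
  using assms by (intro sum.mono_neutral_left) (auto simp: in_keys_iff)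

definition poly3_affine :: "complex \<Rightarrow> complex \<Rightarrow> complex \<Rightarrow> complex \<Rightarrow> poly3" where
  "poly3_affine c c1 c2 c3 = Poly_Mapping.single (0, 0, 0) c + Poly_Mapping.single (1, 0, 0) c1
     + Poly_Mapping.single (0, 1, 0) c2 + Poly_Mapping.single (0, 0, 1) c3"

lemma poly3_affine_keys:
  "Poly_Mapping.keys (poly3_affine c c1 c2 c3) \<subseteq> {(0, 0, 0), (1, 0, 0), (0, 1, 0), (0, 0, 1)}"
  by (auto simp: in_keys_iff poly3_affine_def lookup_add lookup_single when_def split: if_splits)

lemma poly3_eval_affine: "poly3_eval (poly3_affine c c1 c2 c3) (x, y, z) = c + c1 * x + c2 * y + c3 * z"
  by (subst poly3_eval_superset[OF _ poly3_affine_keys])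
    (simp_all add: poly3_affine_def lookup_add lookup_single)

lemma poly3_op_affine:
  fixes A B P :: "'a::complex_hilbert \<Rightarrow> 'a"
  shows "poly3_op (poly3_affine c c1 c2 c3) A B P x = c *\<^sub>C x + c1 *\<^sub>C A x + c2 *\<^sub>C B x + c3 *\<^sub>C P x"
  by (subst poly3_op_superset[OF _ poly3_affine_keys])
    (simp_all add: poly3_affine_def lookup_add lookup_single)

text \<open>The polynomial \<open>x \<mapsto> cnj (f (cnj x))\<close>, which governs the adjoint of \<open>f(A,B,P)\<close>.\<close>

definition poly3_cnj :: "poly3 \<Rightarrow> poly3" where
  "poly3_cnj f = Poly_Mapping.mapp (\<lambda>_. cnj) f"

text \<open>
  The polynomial \<open>x \<mapsto> f(t x\<^sub>1, t x\<^sub>2, t\<^sup>2 x\<^sub>3)\<close>; for \<open>0 \<le> t \<le> 1\<close> this weighted scaling maps the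
  closed tetrablock into itself.
\<close>

definition poly3_scale :: "real \<Rightarrow> poly3 \<Rightarrow> poly3" where
  "poly3_scale t f = Poly_Mapping.mapp (\<lambda>(i, j, k) c. of_real (t ^ (i + j + 2 * k)) * c) f"

lemma lookup_poly3_cnj: "Poly_Mapping.lookup (poly3_cnj f) k = cnj (Poly_Mapping.lookup f k)"
  by (simp add: poly3_cnj_def lookup_mapp when_def in_keys_iff)

lemma lookup_poly3_scale:
  "Poly_Mapping.lookup (poly3_scale t f) (i, j, k)
    = of_real (t ^ (i + j + 2 * k)) * Poly_Mapping.lookup f (i, j, k)"
  by (simp add: poly3_scale_def lookup_mapp when_def in_keys_iff)

lemma keys_poly3_cnj: "Poly_Mapping.keys (poly3_cnj f) = Poly_Mapping.keys f"
  by (auto simp: in_keys_iff lookup_poly3_cnj)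

lemma keys_poly3_scale: "Poly_Mapping.keys (poly3_scale t f) \<subseteq> Poly_Mapping.keys f"
  by (auto simp: in_keys_iff lookup_poly3_scale)

lemma poly3_cnj_cnj: "poly3_cnj (poly3_cnj f) = f"
  by (rule poly_mapping_eqI) (simp add: lookup_poly3_cnj)

lemma poly3_eval_cnj: "poly3_eval (poly3_cnj f) (x, y, z) = cnj (poly3_eval f (cnj x, cnj y, cnj z))"
  by (auto simp: poly3_eval_def keys_poly3_cnj lookup_poly3_cnj cnj_sum split_def intro!: sum.cong)

lemma poly3_eval_scale:
  fixes t :: real and x y z :: complex
  shows "poly3_eval (poly3_scale t f) (x, y, z) = poly3_eval f (t * x, t * y, t\<^sup>2 * z)"
proof -
  have "of_real (t ^ (i + j + 2 * k)) * c * x ^ i * y ^ j * z ^ k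
      = c * (t * x) ^ i * (t * y) ^ j * (of_real (t\<^sup>2) * z) ^ k" for i j k and c :: complex
    by (simp add: power_mult_distrib power_add power_mult power_even_eq power_commutes flip: power_mult)
  then show ?thesis
    unfolding poly3_eval_superset[OF finite_keys keys_poly3_scale]
    by (simp only: poly3_eval_def lookup_poly3_scale split_def prod.collapse fst_conv snd_conv)
qed

lemma continuous_on_poly3_eval: "continuous_on K (poly3_eval f)"
  unfolding poly3_eval_def split_def by (intro continuous_intros)

lemma monomial_bounded_op:
  assumes "bounded_op_on S A" "bounded_op_on S B" "bounded_op_on S P"
  shows "bounded_op_on S (\<lambda>x. (A ^^ i) ((B ^^ j) ((P ^^ k) x)))"
  by (rule bounded_op_comp[OF bounded_op_funpow[OF assms(1)]
        bounded_op_comp[OF bounded_op_funpow[OF assms(2)] bounded_op_funpow[OF assms(3)]]])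

lemma bounded_op_sum_ops:
  assumes "closed_csubspace S" "\<And>i. i \<in> I \<Longrightarrow> bounded_op_on S (T i)"
  shows "bounded_op_on S (\<lambda>x. \<Sum>i\<in>I. T i x)"
  using assms(2)
proof (induction I rule: infinite_finite_induct)
  case (insert i I)
  then show ?case using bounded_op_add[OF assms(1), of "T i" "\<lambda>x. \<Sum>i\<in>I. T i x"] by simp
qed (auto intro!: bounded_op_onI[where C = 0] csubspaceD[OF assms(1)])

lemma poly3_op_bounded:
  assumes S: "closed_csubspace S" and "bounded_op_on S A" "bounded_op_on S B" "bounded_op_on S P"
  shows "bounded_op_on S (poly3_op f A B P)"
proof -
  have "bounded_op_on S (\<lambda>x. \<Sum>q\<in>Poly_Mapping.keys f.
      Poly_Mapping.lookup f q *\<^sub>C (A ^^ fst q) ((B ^^ fst (snd q)) ((P ^^ snd (snd q)) x)))"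
    by (rule bounded_op_sum_ops[OF S], rule bounded_op_scaleC[OF S], rule monomial_bounded_op[OF assms(2-4)])
  then show ?thesis unfolding poly3_op_def[abs_def] by (simp add: split_def)
qed

lemma poly3_op_commute:
  assumes S: "closed_csubspace S" and ops: "bounded_op_on S A" "bounded_op_on S B" "bounded_op_on S P"
    and T: "bounded_op_on S T"
    and comm: "\<And>x. x \<in> S \<Longrightarrow> T (A x) = A (T x)" "\<And>x. x \<in> S \<Longrightarrow> T (B x) = B (T x)"
      "\<And>x. x \<in> S \<Longrightarrow> T (P x) = P (T x)"
    and x: "x \<in> S"
  shows "T (poly3_op f A B P x) = poly3_op f A B P (T x)"
proof -
  have inv: "R ` S \<subseteq> S" if "bounded_op_on S R" for R using bounded_opD(1)[OF that] by blast
  have fc: "T ((R ^^ n) v) = (R ^^ n) (T v)"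
    if "\<And>x. x \<in> S \<Longrightarrow> T (R x) = R (T x)" "bounded_op_on S R" "v \<in> S" for R n v
    using that(1) inv[OF that(2)] that(3) by (rule funpow_commute_on)
  have mono: "T ((A ^^ i) ((B ^^ j) ((P ^^ k) x))) = (A ^^ i) ((B ^^ j) ((P ^^ k) (T x)))" for i j k
  proof -
    have 1: "(P ^^ k) x \<in> S" by (rule bounded_opD(1)[OF bounded_op_funpow[OF ops(3)] x])
    have 2: "(B ^^ j) ((P ^^ k) x) \<in> S" by (rule bounded_opD(1)[OF bounded_op_funpow[OF ops(2)] 1])
    show ?thesis
      using fc[where R = A and n = i, OF comm(1) ops(1) 2] fc[where R = B and n = j, OF comm(2) ops(2) 1]
        fc[where R = P and n = k, OF comm(3) ops(3) x] by simp
  qed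
  have mS: "(A ^^ i) ((B ^^ j) ((P ^^ k) x)) \<in> S" for i j k
    by (rule bounded_opD(1)[OF monomial_bounded_op[OF ops] x])
  have "T (poly3_op f A B P x) = (\<Sum>(i, j, k)\<in>Poly_Mapping.keys f.
        T (Poly_Mapping.lookup f (i, j, k) *\<^sub>C ((A ^^ i) ((B ^^ j) ((P ^^ k) x)))))"
    unfolding poly3_op_def split_def
    by (subst bounded_op_sum[OF T S]) (simp_all only: csubspaceD(3)[OF S mS])
  also have "\<dots> = poly3_op f A B P (T x)"
    unfolding poly3_op_def bounded_opD(3)[OF T mS] mono ..
  finally show ?thesis .
qed

lemma poly3_op_adjoint:
  assumes S: "closed_csubspace S" and T: "commuting_triple_on S A B P" and x: "x \<in> S" and y: "y \<in> S"
  shows "cinner (poly3_op f A B P x) y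
    = cinner x (poly3_op (poly3_cnj f) (adj_on S A) (adj_on S B) (adj_on S P) y)"
proof -
  have ops: "bounded_op_on S A" "bounded_op_on S B" "bounded_op_on S P"
    and comm: "\<And>x. x \<in> S \<Longrightarrow> A (B x) = B (A x)" "\<And>x. x \<in> S \<Longrightarrow> A (P x) = P (A x)"
      "\<And>x. x \<in> S \<Longrightarrow> B (P x) = P (B x)"
    using T unfolding commuting_triple_on_def by auto
  let ?A = "adj_on S A" and ?B = "adj_on S B" and ?P = "adj_on S P"
  note aops = adj_on_bounded[OF S ops(1)] adj_on_bounded[OF S ops(2)] adj_on_bounded[OF S ops(3)]
  have acomm: "?P (?B x) = ?B (?P x)" "?P (?A x) = ?A (?P x)" "?B (?A x) = ?A (?B x)" if "x \<in> S" for x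
    using that comm by (auto intro!: adj_on_commute[OF S] ops)
  have inv: "R ` S \<subseteq> S" if "bounded_op_on S R" for R using bounded_opD(1)[OF that] by blast
  have swap: "(Q ^^ k) ((R ^^ j) y) = (R ^^ j) ((Q ^^ k) y)"
    if "bounded_op_on S Q" "bounded_op_on S R" "\<And>x. x \<in> S \<Longrightarrow> Q (R x) = R (Q x)" "y \<in> S" for Q R k j y
  proof (rule funpow_commute_on[where S = S and T = "Q ^^ k" and R = R])
    show "(Q ^^ k) (R x) = R ((Q ^^ k) x)" if "x \<in> S" for x
      by (rule sym, rule funpow_commute_on[where S = S and T = R and R = Q])
        (use that \<open>\<And>x. x \<in> S \<Longrightarrow> Q (R x) = R (Q x)\<close> inv[OF \<open>bounded_op_on S Q\<close>] in auto)
  qed (use that inv in auto)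
  have "cinner ((A ^^ i) ((B ^^ j) ((P ^^ k) x))) y = cinner x ((?A ^^ i) ((?B ^^ j) ((?P ^^ k) y)))" for i j k
  proof -
    note p = bounded_opD(1)[OF bounded_op_funpow]
    have px: "(P ^^ k) x \<in> S" by (rule p[OF ops(3) x])
    have bx: "(B ^^ j) ((P ^^ k) x) \<in> S" by (rule p[OF ops(2) px])
    have ay: "(?A ^^ i) y \<in> S" by (rule p[OF aops(1) y])
    have bay: "(?B ^^ j) ((?A ^^ i) y) \<in> S" by (rule p[OF aops(2) ay])
    have py: "(?P ^^ k) y \<in> S" by (rule p[OF aops(3) y])
    have "cinner ((A ^^ i) ((B ^^ j) ((P ^^ k) x))) y = cinner x ((?P ^^ k) ((?B ^^ j) ((?A ^^ i) y)))"
      by (simp only: adj_on_funpow[OF S ops(1) bx y] adj_on_funpow[OF S ops(2) px ay]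
          adj_on_funpow[OF S ops(3) x bay])
    also have "(?P ^^ k) ((?B ^^ j) ((?A ^^ i) y)) = (?A ^^ i) ((?B ^^ j) ((?P ^^ k) y))"
      by (simp only: swap[OF aops(3,2) acomm(1) ay] swap[OF aops(3,1) acomm(2) y] swap[OF aops(2,1) acomm(3) py])
    finally show ?thesis .
  qed
  then show ?thesis
    by (simp add: poly3_op_def split_def cinner_sum_left cinner_sum_right cinner_scaleC_left
        cinner_scaleC_right keys_poly3_cnj lookup_poly3_cnj)
qed

lemma commuting_triple_adj:
  assumes S: "closed_csubspace S" and T: "commuting_triple_on S A B P"
  shows "commuting_triple_on S (adj_on S A) (adj_on S B) (adj_on S P)"
proof -
  have ops: "bounded_op_on S A" "bounded_op_on S B" "bounded_op_on S P"
    and comm: "\<And>x. x \<in> S \<Longrightarrow> A (B x) = B (A x)" "\<And>x. x \<in> S \<Longrightarrow> A (P x) = P (A x)"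
      "\<And>x. x \<in> S \<Longrightarrow> B (P x) = P (B x)"
    using T unfolding commuting_triple_on_def by auto
  show ?thesis
    unfolding commuting_triple_on_def
    using adj_on_bounded[OF S ops(1)] adj_on_bounded[OF S ops(2)] adj_on_bounded[OF S ops(3)]
      adj_on_commute[OF S ops(1,2) comm(1)] adj_on_commute[OF S ops(1,3) comm(2)]
      adj_on_commute[OF S ops(2,3) comm(3)] by blast
qed

section \<open>The norm inequality of a spectral set\<close>

text \<open>
  This form of the von Neumann inequality avoids the inverse \<open>g(A,B,P)\<inverse>\<close> and replaces the
  supremum by any pointwise bound.
\<close>

lemma spectral_set_norm_le:
  assumes spec: "spectral_set_on S A B P K" and g: "\<And>z. z \<in> K \<Longrightarrow> poly3_eval g z \<noteq> 0"
    and le: "\<And>z. z \<in> K \<Longrightarrow> cmod (poly3_eval f z) \<le> C * cmod (poly3_eval g z)"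
    and K: "K \<noteq> {}" and y: "y \<in> S"
  shows "norm (poly3_op f A B P y) \<le> C * norm (poly3_op g A B P y)"
proof -
  have bij: "bij_betw (poly3_op g A B P) S S"
    and est: "\<And>x. x \<in> S \<Longrightarrow> norm (poly3_op f A B P (inv_into S (poly3_op g A B P) x))
            \<le> (SUP z\<in>K. cmod (poly3_eval f z / poly3_eval g z)) * norm x"
    using spec g unfolding spectral_set_on_def by auto
  have "(SUP z\<in>K. cmod (poly3_eval f z / poly3_eval g z)) \<le> C"
  proof (rule cSUP_least[OF K])
    show "cmod (poly3_eval f z / poly3_eval g z) \<le> C" if "z \<in> K" for z
      using le[OF that] g[OF that] by (simp add: norm_divide divide_le_eq)
  qed
  then have "(SUP z\<in>K. cmod (poly3_eval f z / poly3_eval g z)) * norm (poly3_op g A B P y)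
      \<le> C * norm (poly3_op g A B P y)"
    by (rule mult_right_mono) simp
  moreover have "inv_into S (poly3_op g A B P) (poly3_op g A B P y) = y"
    using bij y by (simp add: bij_betw_def)
  moreover have "poly3_op g A B P y \<in> S" using bij y by (auto simp: bij_betw_def)
  ultimately show ?thesis using est[of "poly3_op g A B P y"] by fastforce
qed

text \<open>
  The function \<open>x \<mapsto> (x\<^sub>1 - w x\<^sub>3) / (1 - w x\<^sub>2)\<close> is bounded by 1 on the closed tetrablock and
  has its poles off it as long as \<open>\<bar>w\<bar> < 1\<close>; the boundary values of \<open>w\<close> follow by continuity.
\<close>

lemma tetra_contraction_fractional:
  assumes S: "closed_csubspace S" and T: "tetra_contraction_on S A B P" and w: "cmod w \<le> 1" and y: "y \<in> S"
  shows "norm (A y - w *\<^sub>C P y) \<le> norm (y - w *\<^sub>C B y)"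
    and "norm (B y - w *\<^sub>C P y) \<le> norm (y - w *\<^sub>C A y)"
proof -
  have spec: "spectral_set_on S A B P (closure tetrablock)"
    using T unfolding tetra_contraction_on_def by blast
  have ne: "closure tetrablock \<noteq> {}" using zero_in_closure_tetrablock by (metis empty_iff)
  have *: "norm (A y - w *\<^sub>C P y) \<le> norm (y - w *\<^sub>C B y) \<and> norm (B y - w *\<^sub>C P y) \<le> norm (y - w *\<^sub>C A y)"
    if w: "cmod w < 1" for w
  proof
    have nz: "1 - w * b \<noteq> 0" if "cmod b \<le> 1" for b
    proof -
      have "cmod (w * b) < 1" using that w mult_left_mono[of "cmod b" 1 "cmod w"] by (simp add: norm_mult)
      then show ?thesis by auto
    qed
    show "norm (A y - w *\<^sub>C P y) \<le> norm (y - w *\<^sub>C B y)"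
    proof -
      have "poly3_eval (poly3_affine 1 0 (-w) 0) x \<noteq> 0
          \<and> cmod (poly3_eval (poly3_affine 0 1 0 (-w)) x) \<le> 1 * cmod (poly3_eval (poly3_affine 1 0 (-w) 0) x)"
        if "x \<in> closure tetrablock" for x
      proof -
        obtain a b p where x: "x = (a, b, p)" by (rule prod_cases3)
        show ?thesis
          using nz[OF closure_tetrablock_coord] closure_tetrablock_bound[of a b p w] w that
          by (simp add: x poly3_eval_affine)
      qed
      from spectral_set_norm_le[OF spec _ _ ne y, of "poly3_affine 1 0 (-w) 0" "poly3_affine 0 1 0 (-w)" 1] this
      have "norm (poly3_op (poly3_affine 0 1 0 (-w)) A B P y) \<le> 1 * norm (poly3_op (poly3_affine 1 0 (-w) 0) A B P y)"
        by blast
      then show ?thesis by (simp add: poly3_op_affine scaleC_minus_left)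
    qed
    show "norm (B y - w *\<^sub>C P y) \<le> norm (y - w *\<^sub>C A y)"
    proof -
      have "poly3_eval (poly3_affine 1 (-w) 0 0) x \<noteq> 0
          \<and> cmod (poly3_eval (poly3_affine 0 0 1 (-w)) x) \<le> 1 * cmod (poly3_eval (poly3_affine 1 (-w) 0 0) x)"
        if "x \<in> closure tetrablock" for x
      proof -
        obtain a b p where x: "x = (a, b, p)" by (rule prod_cases3)
        then have x': "(b, a, p) \<in> closure tetrablock" using that closure_tetrablock_swap by blast
        show ?thesis
          using nz[OF closure_tetrablock_coord[OF x']] closure_tetrablock_bound[OF x', of w] w
          by (simp add: x poly3_eval_affine)
      qed
      from spectral_set_norm_le[OF spec _ _ ne y, of "poly3_affine 1 (-w) 0 0" "poly3_affine 0 0 1 (-w)" 1] this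
      have "norm (poly3_op (poly3_affine 0 0 1 (-w)) A B P y) \<le> 1 * norm (poly3_op (poly3_affine 1 (-w) 0 0) A B P y)"
        by blast
      then show ?thesis by (simp add: poly3_op_affine scaleC_minus_left)
    qed
  qed
  define r :: "nat \<Rightarrow> real" where "r n = 1 - inverse (Suc n)" for n
  have r: "cmod (of_real (r n) * w) < 1" for n
  proof -
    have "0 \<le> r n" "r n < 1" by (auto simp: r_def inverse_le_1_iff)
    then show ?thesis using w mult_left_mono[OF w, of "r n"] by (simp add: norm_mult)
  qed
  have "r \<longlonglongrightarrow> 1 - 0" unfolding r_def by (intro tendsto_intros LIMSEQ_inverse_real_of_nat)
  then have lim: "r \<longlonglongrightarrow> 1" by simp
  have lim2: "(\<lambda>n. norm (u - (of_real (r n) * w) *\<^sub>C v)) \<longlonglongrightarrow> norm (u - w *\<^sub>C v)" for u v :: 'a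
  proof -
    have "(\<lambda>n. norm (u - r n *\<^sub>R (w *\<^sub>C v))) \<longlonglongrightarrow> norm (u - 1 *\<^sub>R (w *\<^sub>C v))" by (intro tendsto_intros lim)
    then show ?thesis by (simp add: scaleR_scaleC scaleC_scaleC)
  qed
  show "norm (A y - w *\<^sub>C P y) \<le> norm (y - w *\<^sub>C B y)"
    by (rule LIMSEQ_le[OF lim2 lim2]) (use *[OF r] in blast)
  show "norm (B y - w *\<^sub>C P y) \<le> norm (y - w *\<^sub>C A y)"
    by (rule LIMSEQ_le[OF lim2 lim2]) (use *[OF r] in blast)
qed

section \<open>Exactness of the Koszul complex and surjectivity\<close>

text \<open>
  If some linear combination of the three operators is invertible, contraction with its coefficient
  vector followed by the inverse is a homotopy from the identity of the Koszul complex to zero.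
\<close>

lemma koszul_exact_of_bij:
  fixes T1 T2 T3 :: "'a::complex_hilbert \<Rightarrow> 'a"
  assumes S: "closed_csubspace S"
    and ops: "bounded_op_on S T1" "bounded_op_on S T2" "bounded_op_on S T3"
    and comm: "\<And>x. x \<in> S \<Longrightarrow> T1 (T2 x) = T2 (T1 x)" "\<And>x. x \<in> S \<Longrightarrow> T1 (T3 x) = T3 (T1 x)"
      "\<And>x. x \<in> S \<Longrightarrow> T2 (T3 x) = T3 (T2 x)"
    and bij: "bij_betw (\<lambda>x. c1 *\<^sub>C T1 x + c2 *\<^sub>C T2 x + c3 *\<^sub>C T3 x) S S"
  shows "koszul_exact_on S T1 T2 T3"
proof -
  note SD = csubspaceD[OF S]
  note cl = bounded_opD(1)[OF ops(1)] bounded_opD(1)[OF ops(2)] bounded_opD(1)[OF ops(3)]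
  note ad = bounded_opD(2)[OF ops(1)] bounded_opD(2)[OF ops(2)] bounded_opD(2)[OF ops(3)]
  note sc = bounded_opD(3)[OF ops(1)] bounded_opD(3)[OF ops(2)] bounded_opD(3)[OF ops(3)]
  note ze = bounded_op_zero[OF ops(1) S] bounded_op_zero[OF ops(2) S] bounded_op_zero[OF ops(3) S]
  note mi = bounded_op_minus[OF ops(1) S] bounded_op_minus[OF ops(2) S] bounded_op_minus[OF ops(3) S]
  note di = bounded_op_diff[OF ops(1) S] bounded_op_diff[OF ops(2) S] bounded_op_diff[OF ops(3) S]
  define G where "G = (\<lambda>x. c1 *\<^sub>C T1 x + c2 *\<^sub>C T2 x + c3 *\<^sub>C T3 x)"
  note lin = ad sc mi di scaleC_ring
  have G: "bounded_op_on S G" unfolding G_def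
    by (rule bounded_op_add[OF S bounded_op_add[OF S bounded_op_scaleC[OF S ops(1)] bounded_op_scaleC[OF S ops(2)]]
          bounded_op_scaleC[OF S ops(3)]])
  have inj: "x = y" if "x \<in> S" "y \<in> S" "G x = G y" for x y
    using bij that unfolding bij_betw_def inj_on_def G_def by blast
  have Gc: "T1 (G x) = G (T1 x)" "T2 (G x) = G (T2 x)" "T3 (G x) = G (T3 x)" if "x \<in> S" for x
    unfolding G_def using that by (simp_all add: lin cl SD comm)
  define J where "J = inv_into S G"
  have J: "J y \<in> S" "G (J y) = y" if "y \<in> S" for y
  proof -
    have "G ` S = S" using bij by (simp add: bij_betw_def G_def)
    then show "J y \<in> S" "G (J y) = y" unfolding J_def using that
      by (auto intro: inv_into_into f_inv_into_f)
  qed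
  have e0: "{x \<in> S. koszul0 T1 T2 T3 x = 0} = {0}"
  proof -
    have "x = 0" if "x \<in> S" "T1 x = 0" "T2 x = 0" "T3 x = 0" for x
      by (rule inj) (simp_all add: that SD G_def ze)
    then show ?thesis by (auto simp: koszul0_def zero_prod_def SD ze)
  qed
  have e1: "{u \<in> S \<times> S \<times> S. koszul1 T1 T2 T3 u = 0} = koszul0 T1 T2 T3 ` S"
  proof (intro equalityI subsetI)
    fix u assume "u \<in> koszul0 T1 T2 T3 ` S"
    then show "u \<in> {u \<in> S \<times> S \<times> S. koszul1 T1 T2 T3 u = 0}"
      by (auto simp: koszul0_def koszul1_def zero_prod_def cl comm)
  next
    fix u assume "u \<in> {u \<in> S \<times> S \<times> S. koszul1 T1 T2 T3 u = 0}"
    then obtain u1 u2 u3 where u: "u = (u1, u2, u3)" "u1 \<in> S" "u2 \<in> S" "u3 \<in> S"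
      and eq: "T1 u2 = T2 u1" "T1 u3 = T3 u1" "T2 u3 = T3 u2"
      by (auto simp: koszul1_def zero_prod_def)
    define v where "v = c1 *\<^sub>C u1 + c2 *\<^sub>C u2 + c3 *\<^sub>C u3"
    have vS: "v \<in> S" by (simp add: v_def SD u)
    have v: "T1 v = G u1" "T2 v = G u2" "T3 v = G u3"
      unfolding v_def G_def using eq by (simp_all add: lin cl SD u)
    have "T1 (J v) = u1" "T2 (J v) = u2" "T3 (J v) = u3"
      by (rule inj; simp add: cl J vS u v flip: Gc)+
    then have "u = koszul0 T1 T2 T3 (J v)" by (simp add: koszul0_def u)
    then show "u \<in> koszul0 T1 T2 T3 ` S" using J(1)[OF vS] by blast
  qed
  have e2: "{v \<in> S \<times> S \<times> S. koszul2 T1 T2 T3 v = 0} = koszul1 T1 T2 T3 ` (S \<times> S \<times> S)"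
  proof (intro equalityI subsetI)
    fix v assume "v \<in> koszul1 T1 T2 T3 ` (S \<times> S \<times> S)"
    then show "v \<in> {v \<in> S \<times> S \<times> S. koszul2 T1 T2 T3 v = 0}"
      by (auto simp: koszul1_def koszul2_def cl comm SD di)
  next
    fix v assume "v \<in> {v \<in> S \<times> S \<times> S. koszul2 T1 T2 T3 v = 0}"
    then obtain v1 v2 v3 where v: "v = (v1, v2, v3)" "v1 \<in> S" "v2 \<in> S" "v3 \<in> S"
      and eq: "T1 v3 - T2 v2 + T3 v1 = 0"
      by (auto simp: koszul2_def)
    have eq1: "T1 v3 = T2 v2 - T3 v1" using eq by (simp add: algebra_simps eq_neg_iff_add_eq_0)
    \<comment> \<open>the contraction of \<open>v\<close> with the coefficient vector \<open>(c1, c2, c3)\<close>\<close>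
    define w1 where "w1 = - (c2 *\<^sub>C v1 + c3 *\<^sub>C v2)"
    define w2 where "w2 = c1 *\<^sub>C v1 - c3 *\<^sub>C v3"
    define w3 where "w3 = c1 *\<^sub>C v2 + c2 *\<^sub>C v3"
    have wS: "w1 \<in> S" "w2 \<in> S" "w3 \<in> S" by (simp_all add: w1_def w2_def w3_def SD v)
    have w: "T1 w2 - T2 w1 = G v1" "T1 w3 - T3 w1 = G v2" "T2 w3 - T3 w2 = G v3"
      unfolding w1_def w2_def w3_def G_def
      by (simp_all add: lin cl SD v eq1)
    have "T1 (J w2) - T2 (J w1) = v1" "T1 (J w3) - T3 (J w1) = v2" "T2 (J w3) - T3 (J w2) = v3"
      by (rule inj; simp add: bounded_op_diff[OF G S] SD cl J wS v w flip: Gc)+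
    then have "v = koszul1 T1 T2 T3 (J w1, J w2, J w3)" by (simp add: koszul1_def v)
    then show "v \<in> koszul1 T1 T2 T3 ` (S \<times> S \<times> S)" using J(1) wS by blast
  qed
  have e3: "S = koszul2 T1 T2 T3 ` (S \<times> S \<times> S)"
  proof (intro equalityI subsetI)
    fix y assume "y \<in> S"
    then have "y = koszul2 T1 T2 T3 (c3 *\<^sub>C J y, - (c2 *\<^sub>C J y), c1 *\<^sub>C J y)"
      using J[of y] by (simp add: koszul2_def lin cl SD G_def)
    then show "y \<in> koszul2 T1 T2 T3 ` (S \<times> S \<times> S)" using J(1)[OF \<open>y \<in> S\<close>] SD by blast
  qed (auto simp: koszul2_def cl SD)
  show ?thesis unfolding koszul_exact_on_def using e0 e1 e2 e3 by blast
qed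

text \<open>
  The equation \<open>Q x = y\<close> is the fixed point equation \<open>z = y - (Q - R) x\<close> for \<open>z = R x\<close>.
\<close>

lemma surj_perturbation:
  fixes Q R :: "'a::complex_hilbert \<Rightarrow> 'a"
  assumes M: "closed_csubspace M" and R: "bounded_op_on M R" and Q: "bounded_op_on M Q"
    and onto: "R ` M = M" and q: "0 \<le> q" "q < 1"
    and close: "\<And>x. x \<in> M \<Longrightarrow> norm (Q x - R x) \<le> q * norm (R x)"
  shows "Q ` M = M"
proof
  show "Q ` M \<subseteq> M" using bounded_opD(1)[OF Q] by blast
  show "M \<subseteq> Q ` M"
  proof
    fix y assume y: "y \<in> M"
    note MD = csubspaceD[OF M]
    define J where "J = inv_into M R"
    have J: "J z \<in> M" "R (J z) = z" if "z \<in> M" for z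
      unfolding J_def using that onto by (auto intro: inv_into_into f_inv_into_f)
    define \<phi> where "\<phi> z = y - (Q (J z) - R (J z))" for z
    have "\<exists>!z\<in>M. \<phi> z = z"
    proof (rule Banach_fix[OF _ _ q])
      show "complete M" using MD(6) complete_eq_closed by blast
      show "M \<noteq> {}" using y by blast
      show "\<phi> ` M \<subseteq> M"
        by (auto simp: \<phi>_def intro!: MD y bounded_opD(1)[OF Q] bounded_opD(1)[OF R] J(1))
      show "\<And>x z. x \<in> M \<Longrightarrow> z \<in> M \<Longrightarrow> dist (\<phi> x) (\<phi> z) \<le> q * dist x z"
      proof -
        fix x z assume x: "x \<in> M" and z: "z \<in> M"
        have "\<phi> z - \<phi> x = Q (J x - J z) - R (J x - J z)"
          by (simp add: \<phi>_def bounded_op_diff[OF Q M] bounded_op_diff[OF R M] J x z)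
        then have "norm (\<phi> z - \<phi> x) \<le> q * norm (R (J x - J z))"
          using close[of "J x - J z"] J(1) x z MD(5) by simp
        also have "R (J x - J z) = x - z" by (simp add: bounded_op_diff[OF R M] J x z)
        finally show "dist (\<phi> x) (\<phi> z) \<le> q * dist x z" by (simp add: dist_norm norm_minus_commute)
      qed
    qed
    then obtain z where z: "z \<in> M" "\<phi> z = z" by blast
    then have "Q (J z) = y" using J(2)[OF z(1)] by (simp add: \<phi>_def algebra_simps)
    then show "y \<in> Q ` M" using J(1)[OF z(1)] by blast
  qed
qed

text \<open>
  A uniform lower bound keeps surjectivity along steps of a fixed length, which subdivide \<open>[0, 1]\<close>.
\<close>

lemma continuity_method:
  fixes G :: "real \<Rightarrow> 'a::complex_hilbert \<Rightarrow> 'a"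
  assumes M: "closed_csubspace M" and G: "\<And>t. 0 \<le> t \<Longrightarrow> t \<le> 1 \<Longrightarrow> bounded_op_on M (G t)"
    and below: "\<And>t x. 0 \<le> t \<Longrightarrow> t \<le> 1 \<Longrightarrow> x \<in> M \<Longrightarrow> norm x \<le> C * norm (G t x)"
    and lip: "\<And>t s x. 0 \<le> t \<Longrightarrow> t \<le> 1 \<Longrightarrow> 0 \<le> s \<Longrightarrow> s \<le> 1 \<Longrightarrow> x \<in> M \<Longrightarrow>
        norm (G t x - G s x) \<le> L * \<bar>t - s\<bar> * norm x"
    and L: "0 \<le> L" and start: "G 0 ` M = M"
  shows "G 1 ` M = M"
proof -
  define C' where "C' = max C 0"
  have below': "norm x \<le> C' * norm (G t x)" if "0 \<le> t" "t \<le> 1" "x \<in> M" for t x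
    using below[OF that] mult_right_mono[of C C' "norm (G t x)"] by (simp add: C'_def)
  have C': "C' \<ge> 0" by (simp add: C'_def)
  obtain n :: nat where n: "L * C' * 2 < n" using reals_Archimedean2 by blast
  have n0: "n > 0" using n L C' by (metis mult_nonneg_nonneg of_nat_0_less_iff order_le_less_trans zero_le_numeral)
  have "G (k / n) ` M = M" if "k \<le> n" for k
    using that
  proof (induction k)
    case (Suc k)
    have r: "0 \<le> real k / n" "real k / n \<le> 1" "0 \<le> real (Suc k) / n" "real (Suc k) / n \<le> 1"
      using Suc.prems n0 by (auto simp: divide_le_eq)
    show ?case
    proof (rule surj_perturbation[OF M G[OF r(1,2)] G[OF r(3,4)], where q = "1/2"])
      show "G (k / n) ` M = M" using Suc by simp
      fix x assume x: "x \<in> M"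
      have "norm (G (Suc k / n) x - G (k / n) x) \<le> L * \<bar>Suc k / n - k / n\<bar> * norm x"
        by (rule lip[OF r(3,4,1,2) x])
      also have "\<bar>real (Suc k) / n - k / n\<bar> = 1 / n" by (simp add: diff_divide_distrib[symmetric])
      also have "L * (1 / n) * norm x \<le> L * (1 / n) * (C' * norm (G (k / n) x))"
        using L by (intro mult_left_mono below' r x) auto
      also have "\<dots> = (L * C' / n) * norm (G (k / n) x)" by simp
      also have "\<dots> \<le> 1/2 * norm (G (k / n) x)"
        using n n0 by (intro mult_right_mono) (auto simp: field_simps)
      finally show "norm (G (Suc k / n) x - G (k / n) x) \<le> 1/2 * norm (G (k / n) x)" .
    qed simp_all
  qed (use start in simp)
  from this[of n] n0 show ?thesis by simp
qed

section \<open>Adjoints of contractions restricted to invariant subspaces\<close>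

text \<open>
  Write \<open>F' y = G u\<close>. Then \<open>\<parallel>F' y\<parallel>\<^sup>2 = \<langle>F G u, y\<rangle> = \<langle>F u, G' y\<rangle>\<close>, and \<open>\<parallel>F u\<parallel>\<close> is at most
  \<open>s \<parallel>G u\<parallel> = s \<parallel>F' y\<parallel>\<close>.
\<close>

lemma adjoint_dominated:
  fixes F G F' G' :: "'a::complex_hilbert \<Rightarrow> 'a"
  assumes onto: "surj G" and comm: "\<And>x. F (G x) = G (F x)"
    and dom: "\<And>x. norm (F x) \<le> s * norm (G x)"
    and F': "\<And>x y. cinner (F x) y = cinner x (F' y)" and G': "\<And>x y. cinner (G x) y = cinner x (G' y)"
  shows "norm (F' y) \<le> s * norm (G' y)"
proof -
  obtain u where u: "F' y = G u" using onto by blast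
  have "of_real ((norm (F' y))\<^sup>2) = cinner (F u) (G' y)"
    by (metis cinner_self F' G' comm u)
  then have "(norm (F' y))\<^sup>2 = cmod (cinner (F u) (G' y))"
    by (metis abs_of_nonneg norm_of_real zero_le_power2)
  also have "\<dots> \<le> norm (F u) * norm (G' y)" by (rule cmod_cinner_le)
  also have "\<dots> \<le> (s * norm (G u)) * norm (G' y)" by (intro mult_right_mono dom) simp
  finally have le: "norm (F' y) * norm (F' y) \<le> norm (F' y) * (s * norm (G' y))"
    by (simp add: u power2_eq_square algebra_simps)
  show ?thesis
  proof (cases "F' y = 0")
    case True
    obtain x where x: "y = G x" using onto by blast
    have "0 \<le> s * norm y" using dom[of x] order_trans[OF norm_ge_zero] x by blast
    moreover have "G' 0 = 0" using G'[of "G' 0" 0] by (simp add: cinner_self)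
    ultimately show ?thesis using True by (cases "y = 0") (auto simp: zero_le_mult_iff)
  qed (use le in simp)
qed

lemma poly3_scale_lipschitz:
  fixes A B P :: "'a::complex_hilbert \<Rightarrow> 'a"
  assumes ops: "bounded_op_on S A" "bounded_op_on S B" "bounded_op_on S P"
  shows "\<exists>L\<ge>0. \<forall>t s x. 0 \<le> t \<and> t \<le> 1 \<and> 0 \<le> s \<and> s \<le> 1 \<and> x \<in> S \<longrightarrow>
    norm (poly3_op (poly3_scale t f) A B P x - poly3_op (poly3_scale s f) A B P x) \<le> L * \<bar>t - s\<bar> * norm x"
proof -
  define m where "m q = (\<lambda>x. (A ^^ fst q) ((B ^^ fst (snd q)) ((P ^^ snd (snd q)) x)))" for q :: "nat \<times> nat \<times> nat"
  define d where "d q = fst q + fst (snd q) + 2 * snd (snd q)" for q :: "nat \<times> nat \<times> nat"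
  have "\<forall>q. \<exists>D>0. \<forall>x\<in>S. norm (m q x) \<le> D * norm x"
    unfolding m_def using bounded_op_bound[OF monomial_bounded_op[OF ops]] by metis
  then obtain D where D: "\<And>q. D q > 0" "\<And>q x. x \<in> S \<Longrightarrow> norm (m q x) \<le> D q * norm x" by metis
  define c where "c q = Poly_Mapping.lookup f q" for q
  define L where "L = (\<Sum>q\<in>Poly_Mapping.keys f. d q * cmod (c q) * D q)"
  have op: "poly3_op (poly3_scale t f) A B P x = (\<Sum>q\<in>Poly_Mapping.keys f. (of_real (t ^ d q) * c q) *\<^sub>C m q x)" for t x
    by (subst poly3_op_superset[OF finite_keys keys_poly3_scale])
      (simp add: m_def d_def c_def lookup_poly3_scale split_def)
  have "norm (poly3_op (poly3_scale t f) A B P x - poly3_op (poly3_scale s f) A B P x) \<le> L * \<bar>t - s\<bar> * norm x"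
    if t: "0 \<le> t" "t \<le> 1" and s: "0 \<le> s" "s \<le> 1" and x: "x \<in> S" for t s x
  proof -
    have "norm ((of_real (t ^ d q) * c q) *\<^sub>C m q x - (of_real (s ^ d q) * c q) *\<^sub>C m q x)
        \<le> d q * cmod (c q) * D q * (\<bar>t - s\<bar> * norm x)" for q
    proof -
      have "norm ((of_real (t ^ d q) * c q) *\<^sub>C m q x - (of_real (s ^ d q) * c q) *\<^sub>C m q x)
          = \<bar>t ^ d q - s ^ d q\<bar> * cmod (c q) * norm (m q x)"
        by (simp add: norm_scaleC norm_mult flip: scaleC_diff_left left_diff_distrib of_real_diff of_real_power)
      also have "\<dots> \<le> (d q * \<bar>t - s\<bar>) * cmod (c q) * (D q * norm x)"
        using norm_power_diff[of t s "d q"] t s by (intro mult_mono D x) auto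
      finally show ?thesis by (simp add: algebra_simps)
    qed
    then show ?thesis unfolding op sum_subtractf[symmetric] L_def
      by (intro order_trans[OF norm_sum]) (auto simp: sum_distrib_right mult.assoc intro!: sum_mono)
  qed
  moreover have "L \<ge> 0" unfolding L_def using D(1) by (intro sum_nonneg mult_nonneg_nonneg) (auto intro: less_imp_le)
  ultimately show ?thesis by blast
qed

text \<open>
  The adjoint triple of a tetrablock contraction inherits its norm estimates by duality. What needs
  an argument on an invariant subspace \<open>M\<close> is that \<open>g(A\<^sup>*,B\<^sup>*,P\<^sup>*)\<close> maps \<open>M\<close> onto \<open>M\<close>. The tetrablock
  is starlike for the weighted scaling \<open>(t x\<^sub>1, t x\<^sub>2, t\<^sup>2 x\<^sub>3)\<close>, along which \<open>g\<close> stays zero-free and the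
  operators stay uniformly bounded below, and at \<open>t = 0\<close> the operator is a nonzero scalar. So the
  continuity method applies. The spectrum is located by the affine functions
  \<open>1 - z x\<^sub>1 - w x\<^sub>2 + z w x\<^sub>3\<close>, one of which vanishes at any given point off the closed tetrablock.
\<close>

theorem adjoint_restriction_tetra_contraction:
  fixes A B P :: "'a::complex_hilbert \<Rightarrow> 'a"
  assumes T: "tetra_contraction_on UNIV A B P" and M: "closed_csubspace M"
    and inv: "adj A ` M \<subseteq> M" "adj B ` M \<subseteq> M" "adj P ` M \<subseteq> M"
  shows "tetra_contraction_on M (adj A) (adj B) (adj P)"
proof -
  let ?K = "closure tetrablock"
  let ?a = "adj A" and ?b = "adj B" and ?p = "adj P"
  have triple: "commuting_triple_on UNIV A B P" and spec: "spectral_set_on UNIV A B P ?K"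
    using T unfolding tetra_contraction_on_def by auto
  have ops: "bounded_op_on UNIV A" "bounded_op_on UNIV B" "bounded_op_on UNIV P"
    and comm: "\<And>x. A (B x) = B (A x)" "\<And>x. A (P x) = P (A x)" "\<And>x. B (P x) = P (B x)"
    using triple unfolding commuting_triple_on_def by auto
  have compact: "compact ?K" using spec unfolding spectral_set_on_def by blast
  have ne: "?K \<noteq> {}" using zero_in_closure_tetrablock by (metis empty_iff)
  have atriple: "commuting_triple_on UNIV ?a ?b ?p" by (rule commuting_triple_adj[OF csubspace_UNIV triple])
  have aops: "bounded_op_on UNIV ?a" "bounded_op_on UNIV ?b" "bounded_op_on UNIV ?p"
    and acomm: "\<And>x. ?a (?b x) = ?b (?a x)" "\<And>x. ?a (?p x) = ?p (?a x)" "\<And>x. ?b (?p x) = ?p (?b x)"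
    using atriple unfolding commuting_triple_on_def by auto
  have mops: "bounded_op_on M ?a" "bounded_op_on M ?b" "bounded_op_on M ?p"
    using bounded_op_restrict[OF aops(1)] bounded_op_restrict[OF aops(2)] bounded_op_restrict[OF aops(3)] inv
    by blast+
  have Mtriple: "commuting_triple_on M ?a ?b ?p"
    unfolding commuting_triple_on_def using mops acomm by blast
  have polybd: "bounded_op_on M (poly3_op f ?a ?b ?p)" for f by (rule poly3_op_bounded[OF M mops])
  have cnjK: "(cnj x, cnj y, cnj z) \<in> ?K" if "(x, y, z) \<in> ?K" for x y z
    using closure_tetrablock_cnj[OF that] .
  have adjoint: "cinner (poly3_op (poly3_cnj f) A B P x) y = cinner x (poly3_op f ?a ?b ?p y)" for f x y
    using poly3_op_adjoint[OF csubspace_UNIV triple, of x y "poly3_cnj f"] by (simp add: poly3_cnj_cnj)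
  have pcomm: "poly3_op f A B P (poly3_op g A B P x) = poly3_op g A B P (poly3_op f A B P x)" for f g x
  proof (rule poly3_op_commute[OF csubspace_UNIV ops poly3_op_bounded[OF csubspace_UNIV ops]])
    show "poly3_op f A B P (A x) = A (poly3_op f A B P x)" for x
      using poly3_op_commute[OF csubspace_UNIV ops ops(1), of x f] comm by simp
    show "poly3_op f A B P (B x) = B (poly3_op f A B P x)" for x
      using poly3_op_commute[OF csubspace_UNIV ops ops(2), of x f] comm by simp
    show "poly3_op f A B P (P x) = P (poly3_op f A B P x)" for x
      using poly3_op_commute[OF csubspace_UNIV ops ops(3), of x f] comm by simp
  qed simp
  have dominated: "norm (poly3_op f ?a ?b ?p y) \<le> s * norm (poly3_op g ?a ?b ?p y)"
    if g: "\<And>z. z \<in> ?K \<Longrightarrow> poly3_eval g z \<noteq> 0"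
      and le: "\<And>z. z \<in> ?K \<Longrightarrow> cmod (poly3_eval f z) \<le> s * cmod (poly3_eval g z)" for f g s y
  proof (rule adjoint_dominated[OF _ pcomm _ adjoint adjoint])
    have g': "poly3_eval (poly3_cnj g) z \<noteq> 0" if "z \<in> ?K" for z
      using that g[OF cnjK] by (cases z) (simp add: poly3_eval_cnj)
    then have "bij_betw (poly3_op (poly3_cnj g) A B P) UNIV UNIV"
      using spec unfolding spectral_set_on_def by blast
    then show "surj (poly3_op (poly3_cnj g) A B P)" by (simp add: bij_betw_def)
    show "norm (poly3_op (poly3_cnj f) A B P x) \<le> s * norm (poly3_op (poly3_cnj g) A B P x)" for x
    proof (rule spectral_set_norm_le[OF spec g' _ ne UNIV_I])
      show "cmod (poly3_eval (poly3_cnj f) z) \<le> s * cmod (poly3_eval (poly3_cnj g) z)" if "z \<in> ?K" for z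
        using that le[OF cnjK] by (cases z) (simp add: poly3_eval_cnj)
    qed
  qed
  have bij: "bij_betw (poly3_op g ?a ?b ?p) M M" if g: "\<And>z. z \<in> ?K \<Longrightarrow> poly3_eval g z \<noteq> 0" for g
  proof -
    have cont: "continuous_on ?K (\<lambda>z. 1 / poly3_eval g z)"
      using g by (intro continuous_intros continuous_on_poly3_eval) auto
    then have "bounded ((\<lambda>z. 1 / poly3_eval g z) ` ?K)"
      by (intro compact_imp_bounded compact_continuous_image[OF _ compact])
    then obtain C where C: "\<And>z. z \<in> ?K \<Longrightarrow> cmod (1 / poly3_eval g z) \<le> C"
      unfolding bounded_iff by blast
    have one_le: "1 \<le> C * cmod (poly3_eval g z)" if "z \<in> ?K" for z
      using C[OF that] g[OF that] by (simp add: norm_divide divide_le_eq)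
    have scaleK: "(complex_of_real t * x, complex_of_real t * y, complex_of_real (t\<^sup>2) * z) \<in> ?K"
      if "0 \<le> t" "t \<le> 1" "(x, y, z) \<in> ?K" for t x y z
      using closure_tetrablock_scale that by blast
    define G where "G t = poly3_op (poly3_scale t g) ?a ?b ?p" for t
    have below: "norm x \<le> C * norm (G t x)" if t: "0 \<le> t" "t \<le> 1" for t x
    proof -
      have "norm (poly3_op (poly3_affine 1 0 0 0) ?a ?b ?p x) \<le> C * norm (poly3_op (poly3_scale t g) ?a ?b ?p x)"
      proof (rule dominated)
        fix z assume z: "z \<in> ?K"
        show "poly3_eval (poly3_scale t g) z \<noteq> 0"
          using z g[OF scaleK[OF t]] by (cases z) (simp add: poly3_eval_scale)
        show "cmod (poly3_eval (poly3_affine 1 0 0 0) z) \<le> C * cmod (poly3_eval (poly3_scale t g) z)"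
          using z one_le[OF scaleK[OF t]] by (cases z) (simp add: poly3_eval_scale poly3_eval_affine)
      qed
      then show ?thesis by (simp add: poly3_op_affine G_def)
    qed
    obtain L where L: "L \<ge> 0" "\<And>t s x. 0 \<le> t \<Longrightarrow> t \<le> 1 \<Longrightarrow> 0 \<le> s \<Longrightarrow> s \<le> 1 \<Longrightarrow> x \<in> M \<Longrightarrow>
        norm (G t x - G s x) \<le> L * \<bar>t - s\<bar> * norm x"
      using poly3_scale_lipschitz[OF mops, of g] unfolding G_def by blast
    have G0: "G 0 x = poly3_eval g (0, 0, 0) *\<^sub>C x" for x
    proof -
      have "Poly_Mapping.keys (poly3_scale 0 g) \<subseteq> {(0, 0, 0)}"
        by (auto simp: in_keys_iff lookup_poly3_scale split: if_splits)
      then have "G 0 x = Poly_Mapping.lookup (poly3_scale 0 g) (0, 0, 0) *\<^sub>C x"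
        and "poly3_eval (poly3_scale 0 g) (0, 0, 0) = Poly_Mapping.lookup (poly3_scale 0 g) (0, 0, 0)"
        unfolding G_def by (simp_all add: poly3_op_superset[where F = "{(0, 0, 0)}"] poly3_eval_superset[where F = "{(0, 0, 0)}"])
      then show ?thesis by (simp add: poly3_eval_scale)
    qed
    have "G 1 ` M = M"
    proof (rule continuity_method[OF M _ below L(2) L(1)])
      show "bounded_op_on M (G t)" for t unfolding G_def by (rule polybd)
      have nz: "poly3_eval g (0, 0, 0) \<noteq> 0" by (rule g[OF zero_in_closure_tetrablock])
      show "G 0 ` M = M"
      proof (intro equalityI subsetI)
        fix y assume "y \<in> M"
        then have "y = G 0 ((1 / poly3_eval g (0, 0, 0)) *\<^sub>C y)" "(1 / poly3_eval g (0, 0, 0)) *\<^sub>C y \<in> M"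
          using nz by (simp_all add: G0 scaleC_scaleC csubspaceD(3)[OF M])
        then show "y \<in> G 0 ` M" by blast
      qed (auto simp: G0 csubspaceD(3)[OF M])
    qed
    moreover have "poly3_scale 1 g = g" by (rule poly_mapping_eqI) (auto simp: lookup_poly3_scale)
    ultimately have onto: "poly3_op g ?a ?b ?p ` M = M" by (simp add: G_def)
    have "inj_on (poly3_op g ?a ?b ?p) M"
    proof (rule inj_onI)
      fix x y assume x: "x \<in> M" and y: "y \<in> M" and eq: "poly3_op g ?a ?b ?p x = poly3_op g ?a ?b ?p y"
      have "norm (x - y) \<le> C * norm (poly3_op g ?a ?b ?p (x - y))"
        using below[of 1 "x - y"] \<open>poly3_scale 1 g = g\<close> by (simp add: G_def)
      then show "x = y" using eq bounded_op_diff[OF polybd M x y, of g] by simp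
    qed
    with onto show ?thesis by (simp add: bij_betw_def)
  qed
  have spectrum: "taylor_spectrum_on M ?a ?b ?p \<subseteq> ?K"
  proof
    fix x assume x: "x \<in> taylor_spectrum_on M ?a ?b ?p"
    obtain a b p where abp: "x = (a, b, p)" by (rule prod_cases3)
    show "x \<in> ?K"
    proof (rule ccontr)
      assume "x \<notin> ?K"
      then obtain z w where zw: "cmod z < 1" "cmod w < 1" "1 - z * a - w * b + z * w * p = 0"
        unfolding abp closure_tetrablock_iff by blast
      define g where "g = poly3_affine 1 (- z) (- w) (z * w)"
      have "poly3_eval g y \<noteq> 0" if "y \<in> ?K" for y
        using that zw(1,2) by (cases y) (simp add: g_def poly3_eval_affine closure_tetrablock_iff)
      then have "bij_betw (poly3_op g ?a ?b ?p) M M" by (rule bij)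
      moreover have "poly3_op g ?a ?b ?p y = (- z) *\<^sub>C (?a y - a *\<^sub>C y) + (- w) *\<^sub>C (?b y - b *\<^sub>C y)
          + (z * w) *\<^sub>C (?p y - p *\<^sub>C y)" for y
      proof -
        have "(- z) *\<^sub>C (?a y - a *\<^sub>C y) + (- w) *\<^sub>C (?b y - b *\<^sub>C y) + (z * w) *\<^sub>C (?p y - p *\<^sub>C y)
            = poly3_op g ?a ?b ?p y - (1 - z * a - w * b + z * w * p) *\<^sub>C y"
          by (simp add: g_def poly3_op_affine scaleC_ring)
        then show ?thesis using zw(3) by simp
      qed
      ultimately have bij': "bij_betw (\<lambda>y. (- z) *\<^sub>C (?a y - a *\<^sub>C y) + (- w) *\<^sub>C (?b y - b *\<^sub>C y)
          + (z * w) *\<^sub>C (?p y - p *\<^sub>C y)) M M"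
        by (simp cong: bij_betw_cong)
      have "koszul_exact_on M (\<lambda>x. ?a x - a *\<^sub>C x) (\<lambda>x. ?b x - b *\<^sub>C x) (\<lambda>x. ?p x - p *\<^sub>C x)"
      proof (rule koszul_exact_of_bij[OF M _ _ _ _ _ _ bij'])
        have lin: "r (x - y) = r x - r y" "r (c *\<^sub>C x) = c *\<^sub>C r x" if "r \<in> {?a, ?b, ?p}" for r x y c
          using that aops bounded_op_diff[OF _ csubspace_UNIV] bounded_opD(3) by blast+
        show "bounded_op_on M (\<lambda>x. ?a x - a *\<^sub>C x)" "bounded_op_on M (\<lambda>x. ?b x - b *\<^sub>C x)"
          "bounded_op_on M (\<lambda>x. ?p x - p *\<^sub>C x)"
          by (intro bounded_op_subtract[OF M mops(1)] bounded_op_subtract[OF M mops(2)]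
              bounded_op_subtract[OF M mops(3)] bounded_op_scaleC[OF M bounded_op_ident])+
        show "?a (?b x - b *\<^sub>C x) - a *\<^sub>C (?b x - b *\<^sub>C x) = ?b (?a x - a *\<^sub>C x) - b *\<^sub>C (?a x - a *\<^sub>C x)"
          "?a (?p x - p *\<^sub>C x) - a *\<^sub>C (?p x - p *\<^sub>C x) = ?p (?a x - a *\<^sub>C x) - p *\<^sub>C (?a x - a *\<^sub>C x)"
          "?b (?p x - p *\<^sub>C x) - b *\<^sub>C (?p x - p *\<^sub>C x) = ?p (?b x - b *\<^sub>C x) - p *\<^sub>C (?b x - b *\<^sub>C x)" for x
          using acomm by (simp_all add: lin scaleC_ring mult.commute)
      qed
      then show False using x unfolding abp taylor_spectrum_on_def by simp
    qed
  qed
  have "spectral_set_on M ?a ?b ?p ?K"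
    unfolding spectral_set_on_def
  proof (intro conjI compact spectrum allI impI ballI)
    fix f g assume "\<forall>z\<in>?K. poly3_eval g z \<noteq> 0"
    then have g: "\<And>z. z \<in> ?K \<Longrightarrow> poly3_eval g z \<noteq> 0" by blast
    show b: "bij_betw (poly3_op g ?a ?b ?p) M M" by (rule bij[OF g])
    fix x assume x: "x \<in> M"
    define y where "y = inv_into M (poly3_op g ?a ?b ?p) x"
    have y: "poly3_op g ?a ?b ?p y = x"
      unfolding y_def using b x by (simp add: bij_betw_def f_inv_into_f)
    define s where "s = (SUP z\<in>?K. cmod (poly3_eval f z / poly3_eval g z))"
    have "continuous_on ?K (\<lambda>z. cmod (poly3_eval f z / poly3_eval g z))"
      using g by (intro continuous_intros continuous_on_poly3_eval) auto
    then have "bdd_above ((\<lambda>z. cmod (poly3_eval f z / poly3_eval g z)) ` ?K)"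
      by (intro bounded_imp_bdd_above compact_imp_bounded compact_continuous_image[OF _ compact])
    then have up: "cmod (poly3_eval f z / poly3_eval g z) \<le> s" if "z \<in> ?K" for z
      unfolding s_def using that by (rule cSUP_upper[rotated])
    have "norm (poly3_op f ?a ?b ?p y) \<le> s * norm (poly3_op g ?a ?b ?p y)"
    proof (rule dominated[OF g])
      show "cmod (poly3_eval f z) \<le> s * cmod (poly3_eval g z)" if "z \<in> ?K" for z
        using up[OF that] g[OF that] by (simp add: norm_divide divide_le_eq)
    qed
    then show "norm (poly3_op f ?a ?b ?p (inv_into M (poly3_op g ?a ?b ?p) x)) \<le> s * norm x"
      using y by (simp add: y_def)
  qed
  with Mtriple show ?thesis unfolding tetra_contraction_on_def by blast
qed

section \<open>The isometric part of a contraction\<close>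

definition isometric_part :: "('a::complex_hilbert \<Rightarrow> 'a) \<Rightarrow> 'a set" where
  "isometric_part P = {h. \<forall>k. norm ((P ^^ k) h) = norm h}"

lemma contraction_norm_eq_iff:
  assumes S: "closed_csubspace S" and P: "contraction_on S P" and x: "x \<in> S"
  shows "norm (P x) = norm x \<longleftrightarrow> adj_on S P (P x) = x"
proof -
  have bd: "bounded_op_on S P" and le: "\<And>x. x \<in> S \<Longrightarrow> norm (P x) \<le> 1 * norm x"
    using P unfolding contraction_on_def by auto
  have Px: "P x \<in> S" by (rule bounded_opD(1)[OF bd x])
  have ci: "cinner (adj_on S P (P x)) x = of_real ((norm (P x))\<^sup>2)"
    using cinner_adj_on'[OF S bd Px x] by (simp add: cinner_self)
  show ?thesis
  proof
    assume eq: "norm (P x) = norm x"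
    have "norm (adj_on S P (P x)) \<le> norm (P x)" using adj_on_norm_le[OF S bd Px le] by simp
    then have "(norm (adj_on S P (P x)))\<^sup>2 \<le> (norm x)\<^sup>2" using eq by (simp add: power_mono)
    then have "(norm (adj_on S P (P x) - x))\<^sup>2 \<le> 0"
      unfolding norm_sq_diff ci using eq by simp
    then show "adj_on S P (P x) = x" by simp
  next
    assume "adj_on S P (P x) = x"
    then have "(norm (P x))\<^sup>2 = (norm x)\<^sup>2" using ci by (metis cinner_self of_real_eq_iff)
    then show "norm (P x) = norm x" by simp
  qed
qed



text \<open>The condition on norms becomes an operator equation, from which linearity can be read off.\<close>

lemma isometric_part_iff:
  assumes P: "contraction_on UNIV P"
  shows "h \<in> isometric_part P \<longleftrightarrow> (\<forall>k. adj P (P ((P ^^ k) h)) = (P ^^ k) h)"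
proof -
  have "h \<in> isometric_part P \<longleftrightarrow> (\<forall>k. norm (P ((P ^^ k) h)) = norm ((P ^^ k) h))"
  proof
    assume "h \<in> isometric_part P"
    then have "norm ((P ^^ k) h) = norm h" for k by (simp add: isometric_part_def)
    from this[of "Suc _"] this show "\<forall>k. norm (P ((P ^^ k) h)) = norm ((P ^^ k) h)" by simp
  next
    assume step: "\<forall>k. norm (P ((P ^^ k) h)) = norm ((P ^^ k) h)"
    have "norm ((P ^^ k) h) = norm h" for k by (induction k) (simp_all add: step)
    then show "h \<in> isometric_part P" by (simp add: isometric_part_def)
  qed
  then show ?thesis by (simp add: contraction_norm_eq_iff[OF csubspace_UNIV P])
qed

lemma isometric_part_csubspace:
  assumes P: "contraction_on UNIV P"
  shows "closed_csubspace (isometric_part P)"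
proof -
  have bd: "bounded_op_on UNIV P" using P unfolding contraction_on_def by auto
  note U = csubspace_UNIV
  have "bounded_op_on UNIV (\<lambda>x. adj P (P ((P ^^ k) x)) - (P ^^ k) x)" for k
    by (rule bounded_op_subtract[OF U bounded_op_comp[OF adj_on_bounded[OF U bd]
          bounded_op_comp[OF bd bounded_op_funpow[OF bd]]] bounded_op_funpow[OF bd]])
  then have "closed_csubspace (\<Inter>k. {x \<in> UNIV. adj P (P ((P ^^ k) x)) - (P ^^ k) x = 0})"
    by (intro csubspace_INT csubspace_kernel[OF U])
  moreover have "(\<Inter>k. {x \<in> UNIV. adj P (P ((P ^^ k) x)) - (P ^^ k) x = 0}) = isometric_part P"
    using isometric_part_iff[OF P] by auto
  ultimately show ?thesis by (simp only:)
qed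

lemma isometric_part_invariant:
  assumes "contraction_on UNIV P" and "\<And>x. T (P x) = P (T x)" and "\<And>x. T (adj P x) = adj P (T x)"
  shows "T ` isometric_part P \<subseteq> isometric_part P"
proof -
  have pow: "(P ^^ k) (T x) = T ((P ^^ k) x)" for k x
    by (rule sym, rule funpow_commute_on[of UNIV]) (simp_all add: assms(2))
  show ?thesis
    unfolding isometric_part_iff[OF assms(1)] image_subset_iff
    by (auto simp: pow isometric_part_iff[OF assms(1)] simp flip: assms(2,3))
qed

lemma isometric_part_self_invariant: "P ` isometric_part P \<subseteq> isometric_part P"
proof clarify
  fix x assume "x \<in> isometric_part P"
  then have a: "norm ((P ^^ k) x) = norm x" for k by (simp add: isometric_part_def)
  have "norm ((P ^^ k) (P x)) = norm (P x)" for k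
  proof -
    have "(P ^^ k) (P x) = (P ^^ Suc k) x" "P x = (P ^^ 1) x" by (simp_all add: funpow_swap1)
    then show ?thesis using a by metis
  qed
  then show "P x \<in> isometric_part P" by (simp add: isometric_part_def)
qed

text \<open>
  A subspace of the isometric part that \<open>P\<close> maps onto itself also reduces \<open>P\<close> in the whole space,
  since \<open>P\<^sup>*\<close> inverts \<open>P\<close> there.
\<close>

lemma isometric_part_cnu:
  assumes cnu: "cnu_contraction_on UNIV P"
  shows "isometry_on (isometric_part P) P \<and> cnu_contraction_on (isometric_part P) P"
proof -
  have P: "contraction_on UNIV P" using cnu unfolding cnu_contraction_on_def by blast
  then have bd: "bounded_op_on UNIV P" unfolding contraction_on_def by blast
  have bdI: "bounded_op_on (isometric_part P) P"
    by (rule bounded_op_restrict[OF bd _ isometric_part_self_invariant]) simp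
  have norm1: "norm (P x) = norm x" if "x \<in> isometric_part P" for x
  proof -
    have "norm ((P ^^ 1) x) = norm x" using that unfolding isometric_part_def by blast
    then show ?thesis by simp
  qed
  have inv: "adj P (P x) = x" if "x \<in> isometric_part P" for x
    using norm1[OF that] contraction_norm_eq_iff[OF csubspace_UNIV P] by blast
  have "M = {0}"
    if M: "closed_csubspace M" "M \<subseteq> isometric_part P" "P ` M \<subseteq> M" "unitary_on M P" for M
  proof -
    have "adj P ` M \<subseteq> M"
    proof clarify
      fix y assume "y \<in> M"
      then obtain x where "x \<in> M" "y = P x" using M(4) unfolding unitary_on_def by blast
      then show "adj P y \<in> M" using inv M(2) by auto
    qed
    then show ?thesis using cnu M unfolding cnu_contraction_on_def by blast
  qed
  then show ?thesis
    using bdI norm1 unfolding cnu_contraction_on_def isometry_on_def contraction_on_def by auto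
qed

section \<open>Completely non-unitary isometries\<close>

text \<open>
  The projections \<open>P\<^sup>n P\<^sup>*\<^sup>n\<close> decrease, and the range of their strong limit is a subspace that
  reduces \<open>P\<close> to a unitary. So the limit is zero.
\<close>

theorem cnu_isometry_adjoint_powers:
  fixes P :: "'a::complex_hilbert \<Rightarrow> 'a"
  assumes S: "closed_csubspace S" and iso: "isometry_on S P" and cnu: "cnu_contraction_on S P"
    and x: "x \<in> S"
  shows "(\<lambda>n. norm ((adj_on S P ^^ n) x)) \<longlonglongrightarrow> 0"
proof -
  have bd: "bounded_op_on S P" and nP: "\<And>x. x \<in> S \<Longrightarrow> norm (P x) = norm x"
    using iso unfolding isometry_on_def by auto
  define R where "R = adj_on S P"
  have R: "bounded_op_on S R" unfolding R_def by (rule adj_on_bounded[OF S bd])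
  have con: "contraction_on S P" using bd nP unfolding contraction_on_def by auto
  have RP: "R (P x) = x" if "x \<in> S" for x
    using contraction_norm_eq_iff[OF S con that] nP[OF that] by (simp add: R_def)
  have RnS: "(R ^^ n) x \<in> S" if "x \<in> S" for n x by (rule bounded_opD(1)[OF bounded_op_funpow[OF R] that])
  have PnS: "(P ^^ n) x \<in> S" if "x \<in> S" for n x by (rule bounded_opD(1)[OF bounded_op_funpow[OF bd] that])
  have RnPn: "(R ^^ n) ((P ^^ n) x) = x" if "x \<in> S" for n x
  proof (induction n)
    case (Suc n)
    have "(R ^^ Suc n) ((P ^^ Suc n) x) = (R ^^ n) (R (P ((P ^^ n) x)))" by (simp add: funpow_swap1)
    then show ?case using Suc RP[OF PnS[OF that]] by simp
  qed simp
  have RnPm: "(R ^^ n) ((P ^^ (n + m)) x) = (P ^^ m) x" if "x \<in> S" for n m x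
    using RnPn[OF PnS[OF that]] by (simp add: funpow_add)
  have nPn: "norm ((P ^^ n) x) = norm x" if "x \<in> S" for n x
    by (induction n) (simp_all add: nP PnS that)
  have nR: "norm (R x) \<le> norm x" if "x \<in> S" for x
    using adj_on_norm_le[OF S bd that, of 1] nP by (simp add: R_def)
  define a where "a n = norm ((R ^^ n) x)" for n
  have "decseq a" unfolding a_def by (rule decseq_SucI) (simp add: nR RnS x)
  define Q where "Q n y = (P ^^ n) ((R ^^ n) y)" for n y
  have QS: "Q n y \<in> S" if "y \<in> S" for n y unfolding Q_def by (intro PnS RnS that)
  have Qdist: "(norm (Q n x - Q (n + m) x))\<^sup>2 = (a n)\<^sup>2 - (a (n + m))\<^sup>2" for n m
  proof -
    have "cinner (Q n x) (Q (n + m) x) = cinner ((R ^^ n) x) ((R ^^ n) (Q (n + m) x))"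
      using adj_on_funpow[OF S bd RnS[OF x] QS[OF x]] by (simp add: Q_def R_def)
    also have "\<dots> = cinner ((R ^^ n) x) ((P ^^ m) ((R ^^ (n + m)) x))"
      by (simp only: Q_def RnPm[OF RnS[OF x]])
    also have "\<dots> = cnj (cinner ((P ^^ m) ((R ^^ (n + m)) x)) ((R ^^ n) x))" by (rule cinner_commute)
    also have "\<dots> = cnj (cinner ((R ^^ (n + m)) x) ((R ^^ m) ((R ^^ n) x)))"
      using adj_on_funpow[OF S bd RnS[OF x] RnS[OF x]] by (simp add: R_def)
    also have "\<dots> = of_real ((a (n + m))\<^sup>2)"
    proof -
      have "(R ^^ m) ((R ^^ n) x) = (R ^^ (n + m)) x" by (simp only: funpow_add comp_apply add.commute[of n m])
      then show ?thesis by (simp add: a_def cinner_self)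
    qed
    finally have "Re (cinner (Q n x) (Q (n + m) x)) = (a (n + m))\<^sup>2" by simp
    moreover have "norm (Q n x) = a n" for n by (simp add: Q_def a_def nPn RnS x)
    ultimately show ?thesis by (simp add: norm_sq_diff)
  qed
  have "Cauchy (\<lambda>n. (a n)\<^sup>2)"
  proof -
    have "decseq (\<lambda>n. (a n)\<^sup>2)"
      using \<open>decseq a\<close> unfolding decseq_def by (auto intro!: power_mono simp: a_def)
    then have "convergent (\<lambda>n. (a n)\<^sup>2)"
      by (intro Bseq_monoseq_convergent decseq_imp_monoseq decseq_bounded[where B = 0]) auto
    then show ?thesis by (rule convergent_Cauchy)
  qed
  have "Cauchy (\<lambda>n. Q n x)"
  proof (rule CauchyI')
    fix e :: real assume e: "e > 0"
    then obtain M where M: "\<And>m n. m \<ge> M \<Longrightarrow> n \<ge> M \<Longrightarrow> dist ((a m)\<^sup>2) ((a n)\<^sup>2) < e\<^sup>2"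
      using \<open>Cauchy (\<lambda>n. (a n)\<^sup>2)\<close> unfolding Cauchy_def by (metis zero_less_power)
    have "dist (Q m x) (Q n x) < e" if "m \<ge> M" "m < n" for m n
    proof -
      obtain k where k: "n = m + k" using \<open>m < n\<close> less_imp_add_positive by blast
      have "(norm (Q m x - Q n x))\<^sup>2 < e\<^sup>2"
        using M[of m n] \<open>m \<ge> M\<close> Qdist[of m k] by (simp add: k dist_real_def)
      then show ?thesis using e by (simp add: dist_norm power2_less_imp_less)
    qed
    then show "\<exists>M. \<forall>m\<ge>M. \<forall>n>m. dist (Q m x) (Q n x) < e" by blast
  qed
  then obtain y where y: "(\<lambda>n. Q n x) \<longlonglongrightarrow> y" using Cauchy_convergent_iff convergent_def by blast
  have yS: "y \<in> S" by (rule csubspace_limit[OF S QS[OF x] y])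
  have Qbd: "bounded_op_on S (Q n)" for n
    unfolding Q_def[abs_def] by (rule bounded_op_comp[OF bounded_op_funpow[OF bd] bounded_op_funpow[OF R]])
  \<comment> \<open>the intersection of the ranges of the projections \<open>Q n\<close>\<close>
  define N where "N = {y \<in> S. \<forall>n. Q n y = y}"
  have "y \<in> N"
  proof -
    have "Q n y = y" for n
    proof (rule LIMSEQ_unique)
      show "(\<lambda>m. Q n (Q (m + n) x)) \<longlonglongrightarrow> Q n y"
        by (rule bounded_op_tendsto[OF Qbd S QS[OF x] yS LIMSEQ_ignore_initial_segment[OF y]])
      have "Q n (Q (m + n) x) = Q (m + n) x" for m
      proof -
        have "Q n (Q (n + m) x) = (P ^^ n) ((P ^^ m) ((R ^^ (n + m)) x))"
          unfolding Q_def by (simp only: RnPm[OF RnS[OF x]])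
        also have "\<dots> = Q (n + m) x" by (simp only: Q_def funpow_add comp_apply)
        finally show ?thesis by (simp only: add.commute)
      qed
      then show "(\<lambda>m. Q n (Q (m + n) x)) \<longlonglongrightarrow> y"
        using LIMSEQ_ignore_initial_segment[OF y, of n] by simp
    qed
    then show ?thesis using yS by (simp add: N_def)
  qed
  have "N = {0}"
  proof -
    have "N = (\<Inter>n. {y \<in> S. Q n y - y = 0})" by (auto simp: N_def)
    then have Ncs: "closed_csubspace N"
      using csubspace_INT[OF csubspace_kernel[OF S bounded_op_subtract[OF S Qbd bounded_op_ident]]] by (simp only:)
    have NS: "N \<subseteq> S" by (auto simp: N_def)
    have PN: "P ` N \<subseteq> N"
    proof clarify
      fix u assume u: "u \<in> N"
      have "Q n (P u) = P u" for n
      proof (cases n)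
        case (Suc k)
        have "Q (Suc k) (P u) = P (Q k (R (P u)))" by (simp add: Q_def funpow_swap1)
        then show ?thesis using u RP by (simp add: N_def Suc)
      qed (simp add: Q_def)
      then show "P u \<in> N" using u bounded_opD(1)[OF bd] by (simp add: N_def)
    qed
    have RN: "R u \<in> N" if u: "u \<in> N" for u
    proof -
      have RuS: "R u \<in> S" using u bounded_opD(1)[OF R] by (simp add: N_def)
      have "Q n (R u) = R u" for n
      proof -
        have "Q (Suc n) u = u" using u by (simp add: N_def)
        then have "u = P (Q n (R u))" by (simp add: Q_def funpow_swap1)
        then show ?thesis using RP[OF QS[OF RuS]] by metis
      qed
      then show ?thesis using RuS by (simp add: N_def)
    qed
    have "P ` N = N"
    proof (rule equalityI[OF PN], rule subsetI)
      fix u assume u: "u \<in> N"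
      then have "Q 1 u = u" by (simp add: N_def)
      then have "u = P (R u)" by (simp add: Q_def)
      then show "u \<in> P ` N" using RN[OF u] by blast
    qed
    moreover have "isometry_on N P"
      unfolding isometry_on_def using bounded_op_restrict[OF bd NS PN] nP NS by blast
    ultimately show ?thesis
      using cnu Ncs NS PN RN unfolding cnu_contraction_on_def unitary_on_def R_def by blast
  qed
  then have "y = 0" using \<open>y \<in> N\<close> by simp
  then have "(\<lambda>n. norm (Q n x)) \<longlonglongrightarrow> 0" using tendsto_norm[OF y] by simp
  moreover have "norm (Q n x) = norm ((adj_on S P ^^ n) x)" for n
    using nPn[OF RnS[OF x]] by (simp add: Q_def R_def)
  ultimately show ?thesis by simp
qed

text \<open>
  On an invariant subspace where \<open>P\<close> is isometric, the fractional inequalities for all unimodular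
  \<open>w\<close> force
  \<open>B = A\<^sup>*P\<close> and \<open>\<parallel>A h\<parallel> = \<parallel>B h\<parallel>\<close>. Since \<open>A\<^sup>*\<close> and \<open>B\<^sup>*\<close> commute with \<open>P\<close>, this gives
  \<open>B = P B R\<close> for the adjoint \<open>R\<close> of the isometry, and so \<open>\<parallel>B x\<parallel> = \<parallel>B R\<^sup>n x\<parallel>\<close>, which tends to zero.
\<close>

theorem doubly_commuting_vanish:
  fixes A B P :: "'a::complex_hilbert \<Rightarrow> 'a"
  assumes T: "tetra_contraction_on UNIV A B P"
    and dc: "\<And>x. adj A (P x) = P (adj A x)" "\<And>x. adj B (P x) = P (adj B x)"
    and S: "closed_csubspace S" and iso: "isometry_on S P" and cnu: "cnu_contraction_on S P"
    and inv: "B ` S \<subseteq> S" "adj A ` S \<subseteq> S" "adj B ` S \<subseteq> S"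
    and x: "x \<in> S"
  shows "A x = 0 \<and> B x = 0"
proof -
  have ops: "bounded_op_on UNIV A" "bounded_op_on UNIV B" "bounded_op_on UNIV P"
    using T unfolding tetra_contraction_on_def commuting_triple_on_def by auto
  note aA = adj_on_bounded[OF csubspace_UNIV ops(1)]
  have bd: "bounded_op_on S P" and nP: "\<And>x. x \<in> S \<Longrightarrow> norm (P x) = norm x"
    using iso unfolding isometry_on_def by auto
  note U = csubspace_UNIV
  have key: "norm (A h) = norm (B h) \<and> cinner (P h) (A h) = cinner (B h) h" if h: "h \<in> S" for h
  proof -
    have i1: "(norm (A h))\<^sup>2 - 2 * Re (cnj w * cinner (A h) (P h)) \<le> (norm (B h))\<^sup>2 - 2 * Re (cnj w * cinner h (B h))"
      and i2: "(norm (B h))\<^sup>2 - 2 * Re (cnj w * cinner (B h) (P h)) \<le> (norm (A h))\<^sup>2 - 2 * Re (cnj w * cinner h (A h))"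
      if w: "cmod w = 1" for w
    proof -
      have "(norm (A h - w *\<^sub>C P h))\<^sup>2 \<le> (norm (h - w *\<^sub>C B h))\<^sup>2" "(norm (B h - w *\<^sub>C P h))\<^sup>2 \<le> (norm (h - w *\<^sub>C A h))\<^sup>2"
        using tetra_contraction_fractional[OF U T, of w h] w by (auto intro: power_mono)
      then show "(norm (A h))\<^sup>2 - 2 * Re (cnj w * cinner (A h) (P h)) \<le> (norm (B h))\<^sup>2 - 2 * Re (cnj w * cinner h (B h))"
        "(norm (B h))\<^sup>2 - 2 * Re (cnj w * cinner (B h) (P h)) \<le> (norm (A h))\<^sup>2 - 2 * Re (cnj w * cinner h (A h))"
        by (simp_all add: norm_sq_diff norm_scaleC w nP[OF h] cinner_scaleC_right)
    qed
    have "(norm (A h))\<^sup>2 \<le> (norm (B h))\<^sup>2"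
    proof -
      have "(norm (A h))\<^sup>2 - 2 * Re (cinner (A h) (P h)) \<le> (norm (B h))\<^sup>2 - 2 * Re (cinner h (B h))"
        "(norm (A h))\<^sup>2 + 2 * Re (cinner (A h) (P h)) \<le> (norm (B h))\<^sup>2 + 2 * Re (cinner h (B h))"
        using i1[of 1] i1[of "-1"] by auto
      then show ?thesis by linarith
    qed
    moreover have "(norm (B h))\<^sup>2 \<le> (norm (A h))\<^sup>2"
    proof -
      have "(norm (B h))\<^sup>2 - 2 * Re (cinner (B h) (P h)) \<le> (norm (A h))\<^sup>2 - 2 * Re (cinner h (A h))"
        "(norm (B h))\<^sup>2 + 2 * Re (cinner (B h) (P h)) \<le> (norm (A h))\<^sup>2 + 2 * Re (cinner h (A h))"
        using i2[of 1] i2[of "-1"] by auto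
      then show ?thesis by linarith
    qed
    ultimately have eq: "norm (A h) = norm (B h)"
      by (meson antisym norm_ge_zero power2_le_imp_le)
    have "Re (cinner (A h) (P h)) = Re (cinner h (B h))"
      using i1[of 1] i1[of "-1"] by (simp add: eq)
    moreover have "Im (cinner (A h) (P h)) = Im (cinner h (B h))"
      using i1[of \<i>] i1[of "-\<i>"] by (simp add: eq)
    ultimately have "cinner (A h) (P h) = cinner h (B h)" by (simp add: complex_eq_iff)
    then have "cinner (P h) (A h) = cinner (B h) h" by (metis cinner_commute)
    with eq show ?thesis by blast
  qed
  have BPA: "B h = P (adj A h)" if h: "h \<in> S" for h
  proof -
    define D where "D h = adj A (P h) - B h" for h
    have DS: "D h \<in> S" if "h \<in> S" for h
      unfolding D_def using that inv bounded_opD(1)[OF bd that] csubspaceD(5)[OF S] by blast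
    have "cinner (D h) (D h) = 0"
    proof (rule cinner_polarization_zero[where S = S and T = D, OF _ _ _ h DS[OF h]])
      show "x + y \<in> S \<and> D (x + y) = D x + D y" if "x \<in> S" "y \<in> S" for x y
        using csubspaceD(2)[OF S that] bounded_opD(2)[OF ops(3)] bounded_opD(2)[OF ops(2)] bounded_opD(2)[OF aA]
        by (simp add: D_def)
      show "c *\<^sub>C x \<in> S \<and> D (c *\<^sub>C x) = c *\<^sub>C D x" if "x \<in> S" for c x
        using csubspaceD(3)[OF S that] bounded_opD(3)[OF ops(3)] bounded_opD(3)[OF ops(2)] bounded_opD(3)[OF aA]
        by (simp add: D_def scaleC_diff_right)
      show "cinner (D x) x = 0" if "x \<in> S" for x
        using key[OF that] cinner_adj_on'[OF U ops(1), of "P x" x]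
        by (simp add: D_def cinner_diff_left)
    qed
    then have "D h = 0" by (simp add: cinner_self)
    then show ?thesis using dc(1) by (simp add: D_def)
  qed
  define R where "R = adj_on S P"
  have R: "bounded_op_on S R" unfolding R_def by (rule adj_on_bounded[OF S bd])
  have con: "contraction_on S P" using bd nP unfolding contraction_on_def by auto
  have RP: "R (P x) = x" if "x \<in> S" for x
    using contraction_norm_eq_iff[OF S con that] nP[OF that] by (simp add: R_def)
  have RnS: "(R ^^ n) x \<in> S" for n by (rule bounded_opD(1)[OF bounded_op_funpow[OF R] x])
  \<comment> \<open>since \<open>S\<close> reduces \<open>B\<close>, commutation of \<open>B\<^sup>*\<close> with \<open>P\<close> passes to the adjoints on \<open>S\<close>\<close>
  have RB: "R (B h) = B (R h)" if h: "h \<in> S" for h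
  proof (rule cinner_eqI[OF S])
    have Bh: "B h \<in> S" and Rh: "R h \<in> S" using h inv bounded_opD(1)[OF R] by auto
    show "R (B h) \<in> S" "B (R h) \<in> S" using Bh Rh bounded_opD(1)[OF R] inv by auto
    show "cinner y (R (B h)) = cinner y (B (R h))" if y: "y \<in> S" for y
    proof -
      have b: "adj B y \<in> S" using y inv by blast
      have "cinner y (R (B h)) = cinner (P y) (B h)" using cinner_adj_on[OF S bd Bh y] by (simp add: R_def)
      also have "\<dots> = cinner (P (adj B y)) h"
        using cinner_adj_on'[OF U ops(2), of "P y" h] by (simp add: dc)
      also have "\<dots> = cinner (adj B y) (R h)" using cinner_adj_on[OF S bd h b] by (simp add: R_def)
      also have "\<dots> = cinner y (B (R h))" using cinner_adj_on'[OF U ops(2), of y "R h"] by simp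
      finally show ?thesis .
    qed
  qed
  have step: "norm (B h) = norm (B (R h))" if h: "h \<in> S" for h
  proof -
    have aS: "adj A h \<in> S" using h inv by blast
    have "B (R h) = adj A h" using RB[OF h] BPA[OF h] RP[OF aS] by simp
    then show ?thesis using BPA[OF h] nP[OF aS] by simp
  qed
  have iter: "norm (B x) = norm (B ((R ^^ n) x))" for n
    by (induction n) (simp_all add: step[OF RnS])
  obtain C where C: "C > 0" "\<And>y. norm (B y) \<le> C * norm y" using bounded_op_bound[OF ops(2)] by auto
  have "norm (B x) \<le> C * 0"
  proof (rule LIMSEQ_le_const)
    show "(\<lambda>n. C * norm ((R ^^ n) x)) \<longlonglongrightarrow> C * 0"
      unfolding R_def by (intro tendsto_intros cnu_isometry_adjoint_powers[OF S iso cnu x])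
    show "\<exists>N. \<forall>n\<ge>N. norm (B x) \<le> C * norm ((R ^^ n) x)" using iter C(2) by metis
  qed
  then have "B x = 0" by simp
  then show ?thesis using key[OF x] by simp
qed

section \<open>The bilateral shift as a unitary extension\<close>

text \<open>Coordinates of \<^typ>\<open>'a ell2\<close> are relabelled by the integers through \<^const>\<open>int_decode\<close>.\<close>

definition shift_ell2 :: "int \<Rightarrow> 'a::complex_hilbert ell2 \<Rightarrow> 'a ell2" where
  "shift_ell2 d f = Abs_ell2 (\<lambda>n. coord f (int_encode (int_decode n - d)))"

lemma bij_shift_index: "bij (\<lambda>n. int_encode (int_decode n - d))"
  by (rule o_bij[where g = "\<lambda>n. int_encode (int_decode n + d)"]) (auto simp: fun_eq_iff)

lemma norm_sq_has_sum: "((\<lambda>n. (norm (coord f n))\<^sup>2) has_sum (norm f)\<^sup>2) UNIV"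
  for f :: "'a::complex_hilbert ell2"
proof -
  have "(\<lambda>n. (norm (coord f n))\<^sup>2) sums (norm f)\<^sup>2"
    unfolding norm_sq_ell2 using square_summable_coord[of f]
    by (simp add: square_summable_def summable_sums)
  then show ?thesis by (rule sums_nonneg_imp_has_sum) simp
qed

lemma shift_has_sum:
  fixes f :: "'a::complex_hilbert ell2"
  shows "((\<lambda>n. (norm (coord f (int_encode (int_decode n - d))))\<^sup>2) has_sum (norm f)\<^sup>2) UNIV"
  using has_sum_reindex_bij_betw[OF bij_shift_index, of "\<lambda>n. (norm (coord f n))\<^sup>2" d "(norm f)\<^sup>2"]
    norm_sq_has_sum[of f] by simp

lemma coord_shift: "coord (shift_ell2 d f) n = coord f (int_encode (int_decode n - d))"
proof -
  have "square_summable (\<lambda>n. coord f (int_encode (int_decode n - d)))"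
    unfolding square_summable_def
    using has_sum_imp_sums[OF shift_has_sum, of f d] sums_summable by blast
  then show ?thesis by (simp add: shift_ell2_def coord_Abs)
qed

lemma norm_shift: "norm (shift_ell2 d f) = norm f"
proof -
  have "((\<lambda>n. (norm (coord (shift_ell2 d f) n))\<^sup>2) has_sum (norm f)\<^sup>2) UNIV"
    unfolding coord_shift by (rule shift_has_sum)
  then have "(norm (shift_ell2 d f))\<^sup>2 = (norm f)\<^sup>2"
    using norm_sq_has_sum has_sum_unique by blast
  then show ?thesis by simp
qed

lemma shift_shift: "shift_ell2 c (shift_ell2 d f) = shift_ell2 (c + d) f"
  by (rule ell2_eqI) (simp add: coord_shift algebra_simps)

lemma shift_zero: "shift_ell2 0 f = f"
  by (rule ell2_eqI) (simp add: coord_shift)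

definition ell2_over :: "'a::complex_hilbert set \<Rightarrow> 'a ell2 set" where
  "ell2_over W = {f. \<forall>n. coord f n \<in> W}"

lemma ell2_over_csubspace:
  assumes W: "closed_csubspace W"
  shows "closed_csubspace (ell2_over W)"
  unfolding closed_csubspace_def
proof (intro conjI ballI allI)
  show "0 \<in> ell2_over W" "\<And>x y. x \<in> ell2_over W \<Longrightarrow> y \<in> ell2_over W \<Longrightarrow> x + y \<in> ell2_over W"
    "\<And>c x. x \<in> ell2_over W \<Longrightarrow> c *\<^sub>C x \<in> ell2_over W"
    using csubspaceD[OF W] by (simp_all add: ell2_over_def coord_zero coord_add coord_scaleC)
  show "closed (ell2_over W)"
    unfolding closed_sequential_limits
  proof (intro allI impI, elim conjE)
    fix f l assume f: "\<forall>n. f n \<in> ell2_over W" and l: "f \<longlonglongrightarrow> l"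
    have "coord l m \<in> W" for m
    proof (rule csubspace_limit[OF W])
      show "coord (f n) m \<in> W" for n using f by (simp add: ell2_over_def)
      show "(\<lambda>n. coord (f n) m) \<longlonglongrightarrow> coord l m"
      proof (rule LIM_zero_cancel, rule Lim_null_comparison)
        show "\<forall>\<^sub>F n in sequentially. norm (coord (f n) m - coord l m) \<le> norm (f n - l)"
          using norm_coord_le[of "f _ - l" m] by (simp add: coord_minus)
        show "(\<lambda>n. norm (f n - l)) \<longlonglongrightarrow> 0"
          using l by (simp add: LIM_zero_iff tendsto_norm_zero)
      qed
    qed
    then show "l \<in> ell2_over W" by (simp add: ell2_over_def)
  qed
qed

lemma shift_ell2_over: "f \<in> ell2_over W \<Longrightarrow> shift_ell2 d f \<in> ell2_over W"
  by (simp add: ell2_over_def coord_shift)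

lemma shift_bounded_op: "closed_csubspace W \<Longrightarrow> bounded_op_on (ell2_over W) (shift_ell2 d)"
proof (rule bounded_op_onI[where C = 1])
  show "shift_ell2 d (x + y) = shift_ell2 d x + shift_ell2 d y" for x y :: "'a ell2"
    by (rule ell2_eqI) (simp add: coord_shift coord_add)
  show "shift_ell2 d (c *\<^sub>C x) = c *\<^sub>C shift_ell2 d x" for c and x :: "'a ell2"
    by (rule ell2_eqI) (simp add: coord_shift coord_scaleC)
qed (simp_all add: shift_ell2_over norm_shift)

text \<open>
  For \<open>\<bar>p\<bar> < 1\<close> the operator \<open>U - p\<close> is a small perturbation of \<open>U\<close>, for \<open>\<bar>p\<bar> > 1\<close> it is one of
  the scalar \<open>- p\<close>.
\<close>

lemma unitary_minus_scalar_bij: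
  assumes S: "closed_csubspace S" and U: "unitary_on S U" and p: "cmod p \<noteq> 1"
  shows "bij_betw (\<lambda>x. U x - p *\<^sub>C x) S S"
proof -
  have bd: "bounded_op_on S U" and nU: "\<And>x. x \<in> S \<Longrightarrow> norm (U x) = norm x" and onto: "U ` S = S"
    using U unfolding unitary_on_def isometry_on_def by auto
  have bdp: "bounded_op_on S (\<lambda>x. c *\<^sub>C x)" for c by (rule bounded_op_scaleC[OF S bounded_op_ident])
  have bd': "bounded_op_on S (\<lambda>x. U x - p *\<^sub>C x)" by (rule bounded_op_subtract[OF S bd bdp])
  have "(\<lambda>x. U x - p *\<^sub>C x) ` S = S"
  proof (cases "cmod p < 1")
    case True
    show ?thesis
      by (rule surj_perturbation[OF S bd bd' onto, of "cmod p"]) (use True nU in \<open>auto simp: norm_scaleC\<close>)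
  next
    case False
    then have p1: "cmod p > 1" using p by simp
    then have pnz: "p \<noteq> 0" by auto
    show ?thesis
    proof (rule surj_perturbation[OF S bdp[of "- p"] bd', of "1 / cmod p"])
      show "(*\<^sub>C) (- p) ` S = S"
      proof (intro equalityI subsetI)
        fix y assume y: "y \<in> S"
        have "y = (- p) *\<^sub>C ((- 1 / p) *\<^sub>C y)" using pnz by (simp add: scaleC_scaleC)
        then show "y \<in> (*\<^sub>C) (- p) ` S" using csubspaceD(3)[OF S y] by blast
      qed (auto intro: csubspaceD(3)[OF S])
      show "norm (U x - p *\<^sub>C x - (- p) *\<^sub>C x) \<le> 1 / cmod p * norm ((- p) *\<^sub>C x)" if "x \<in> S" for x
        using nU[OF that] pnz by (simp add: norm_scaleC scaleC_minus_left)
    qed (use p1 in \<open>auto simp: divide_less_eq\<close>)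
  qed
  moreover have "inj_on (\<lambda>x. U x - p *\<^sub>C x) S"
  proof (rule inj_onI)
    fix x y assume x: "x \<in> S" and y: "y \<in> S" and eq: "U x - p *\<^sub>C x = U y - p *\<^sub>C y"
    then have "U (x - y) = p *\<^sub>C (x - y)"
      by (simp add: bounded_op_diff[OF bd S x y] scaleC_diff_right algebra_simps)
    then have "norm (x - y) = cmod p * norm (x - y)"
      using nU[OF csubspaceD(5)[OF S x y]] by (simp add: norm_scaleC)
    then show "x = y" using p by simp
  qed
  ultimately show ?thesis by (simp add: bij_betw_def)
qed

lemma tetra_unitary_of_unitary:
  fixes U :: "'a::complex_hilbert \<Rightarrow> 'a"
  assumes S: "closed_csubspace S" and U: "unitary_on S U"
  shows "tetra_unitary_on S (\<lambda>_. 0) (\<lambda>_. 0) U"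
proof -
  have bd: "bounded_op_on S U" and nU: "\<And>x. x \<in> S \<Longrightarrow> norm (U x) = norm x" and onto: "U ` S = S"
    using U unfolding unitary_on_def isometry_on_def by auto
  note SD = csubspaceD[OF S]
  have bd0: "bounded_op_on S (\<lambda>_. 0::'a)" by (rule bounded_op_onI[where C = 0]) (auto simp: SD)
  have adj0: "adj_on S (\<lambda>_. 0) x = (0::'a)" if "x \<in> S" for x
    by (rule adj_on_unique[OF S bd0 that]) (auto simp: SD)
  have U0: "U 0 = 0" by (rule bounded_op_zero[OF bd S])
  have con: "contraction_on S U" using bd nU unfolding contraction_on_def by auto
  have adjU: "adj_on S U (U x) = x" if "x \<in> S" for x
    using contraction_norm_eq_iff[OF S con that] nU[OF that] by blast
  have adjU': "U (adj_on S U x) = x" if x: "x \<in> S" for x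
  proof -
    obtain y where "y \<in> S" "x = U y" using onto x by blast
    then show ?thesis using adjU by simp
  qed
  have bdm: "bounded_op_on S (\<lambda>x. U x - p *\<^sub>C x)" "bounded_op_on S (\<lambda>x. 0 - p *\<^sub>C x)" for p
    by (rule bounded_op_subtract[OF S bd bounded_op_scaleC[OF S bounded_op_ident]],
        rule bounded_op_subtract[OF S bd0 bounded_op_scaleC[OF S bounded_op_ident]])
  have exact: "koszul_exact_on S (\<lambda>x. 0 - a *\<^sub>C x) (\<lambda>x. 0 - b *\<^sub>C x) (\<lambda>x. U x - p *\<^sub>C x)"
    if bij: "bij_betw (\<lambda>x. c1 *\<^sub>C (0 - a *\<^sub>C x) + c2 *\<^sub>C (0 - b *\<^sub>C x) + c3 *\<^sub>C (U x - p *\<^sub>C x)) S S"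
    for a b p c1 c2 c3
    by (rule koszul_exact_of_bij[OF S bdm(2) bdm(2) bdm(1) _ _ _ bij])
      (simp_all add: bounded_op_diff[OF bd S] bounded_op_minus[OF bd S] bounded_opD(3)[OF bd] SD scaleC_ring mult.commute)
  have "taylor_spectrum_on S (\<lambda>_. 0) (\<lambda>_. 0) U \<subseteq> tetrablock_dist_boundary"
  proof
    fix v assume v: "v \<in> taylor_spectrum_on S (\<lambda>_. 0) (\<lambda>_. 0) U"
    obtain a b p where abp: "v = (a, b, p)" by (rule prod_cases3)
    have nex: "\<not> koszul_exact_on S (\<lambda>x. 0 - a *\<^sub>C x) (\<lambda>x. 0 - b *\<^sub>C x) (\<lambda>x. U x - p *\<^sub>C x)"
      using v unfolding abp taylor_spectrum_on_def by blast
    have ident: "bij_betw (\<lambda>x. x) S S" by (simp add: bij_betw_def)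
    have "a = 0"
    proof (rule ccontr)
      assume "a \<noteq> 0"
      then show False
        using nex exact[of "- 1 / a" a 0 b 0 p] ident by (simp add: scaleC_ring)
    qed
    moreover have "b = 0"
    proof (rule ccontr)
      assume "b \<noteq> 0"
      then show False
        using nex exact[of 0 a "- 1 / b" b 0 p] ident by (simp add: scaleC_ring)
    qed
    moreover have "cmod p = 1"
    proof (rule ccontr)
      assume "cmod p \<noteq> 1"
      from unitary_minus_scalar_bij[OF S U this] show False
        using nex exact[of 0 a 0 b 1 p] by simp
    qed
    ultimately show "v \<in> tetrablock_dist_boundary" using unimodular_in_dist_boundary abp by simp
  qed
  then show ?thesis
    unfolding tetra_unitary_on_def commuting_triple_on_def normal_on_def
    using bd bd0 adj0 adjU adjU' U0 SD(1) by auto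
qed

text \<open>
  The wandering subspace \<open>W = ker P\<^sup>*\<close> of a completely non-unitary isometry supplies the
  coordinates \<open>(1 - P P\<^sup>*) P\<^sup>*\<^sup>n x\<close> of \<open>x\<close>, with \<open>n \<ge> 0\<close>; by the telescoping sum their square norms
  add up to that of \<open>x\<close> because \<open>P\<^sup>*\<^sup>n x\<close> tends to zero.
\<close>

theorem cnu_isometry_tetra_isometry:
  fixes A B P :: "'a::complex_hilbert \<Rightarrow> 'a"
  assumes S: "closed_csubspace S" and iso: "isometry_on S P" and cnu: "cnu_contraction_on S P"
    and zero: "\<And>x. x \<in> S \<Longrightarrow> A x = 0" "\<And>x. x \<in> S \<Longrightarrow> B x = 0"
  shows "tetra_isometry_on S A B P"
proof -
  note SD = csubspaceD[OF S]
  have bd: "bounded_op_on S P" and nP: "\<And>x. x \<in> S \<Longrightarrow> norm (P x) = norm x"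
    using iso unfolding isometry_on_def by auto
  define R where "R = adj_on S P"
  have R: "bounded_op_on S R" unfolding R_def by (rule adj_on_bounded[OF S bd])
  have con: "contraction_on S P" using bd nP unfolding contraction_on_def by auto
  have RP: "R (P x) = x" if "x \<in> S" for x
    using contraction_norm_eq_iff[OF S con that] nP[OF that] by (simp add: R_def)
  note PS = bounded_opD(1)[OF bd] and RS = bounded_opD(1)[OF R]
  have RnS: "(R ^^ n) x \<in> S" if "x \<in> S" for n x by (rule bounded_opD(1)[OF bounded_op_funpow[OF R] that])
  define W where "W = {w \<in> S. R w = 0}"
  have W: "closed_csubspace W" unfolding W_def by (rule csubspace_kernel[OF S R])
  define D where "D x = x - P (R x)" for x
  have D: "bounded_op_on S D"
    unfolding D_def[abs_def] by (rule bounded_op_subtract[OF S bounded_op_ident bounded_op_comp[OF bd R]])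
  have DW: "D x \<in> W" if "x \<in> S" for x
    using that by (simp add: W_def D_def SD PS RS bounded_op_diff[OF R S] RP)
  have DP: "D (P x) = 0" if "x \<in> S" for x using RP[OF that] by (simp add: D_def)
  have Dnorm: "(norm (D x))\<^sup>2 = (norm x)\<^sup>2 - (norm (R x))\<^sup>2" if x: "x \<in> S" for x
  proof -
    have "cinner x (P (R x)) = of_real ((norm (R x))\<^sup>2)"
      using cinner_adj_on'[OF S bd x RS[OF x]] by (simp add: R_def cinner_self)
    then show ?thesis using nP[OF RS[OF x]] by (simp add: D_def norm_sq_diff)
  qed
  have Dsums: "(\<lambda>n. (norm (D ((R ^^ n) x)))\<^sup>2) sums (norm x)\<^sup>2" if x: "x \<in> S" for x
  proof -
    have "(\<lambda>n. (norm ((R ^^ n) x))\<^sup>2) \<longlonglongrightarrow> 0\<^sup>2"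
      unfolding R_def by (intro tendsto_intros cnu_isometry_adjoint_powers[OF S iso cnu x])
    from telescope_sums'[OF this] show ?thesis by (simp add: Dnorm RnS x)
  qed
  \<comment> \<open>the coordinates with negative integer index are zero\<close>
  define v where "v x n = (if int_decode n \<ge> 0 then D ((R ^^ nat (int_decode n)) x) else 0)" for x n
  have vsum: "((\<lambda>n. (norm (v x n))\<^sup>2) has_sum (norm x)\<^sup>2) UNIV" if x: "x \<in> S" for x
  proof -
    have "((\<lambda>n. (norm (D ((R ^^ n) x)))\<^sup>2) has_sum (norm x)\<^sup>2) UNIV"
      by (rule sums_nonneg_imp_has_sum[OF Dsums[OF x]]) simp
    moreover have "(\<lambda>n. (norm (D ((R ^^ n) x)))\<^sup>2) = (\<lambda>n. (norm (v x n))\<^sup>2) \<circ> (\<lambda>n. int_encode (int n))"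
      by (simp add: v_def fun_eq_iff)
    moreover have "inj (\<lambda>n. int_encode (int n))" by (rule injI) (simp add: int_encode_eq)
    ultimately have 1: "((\<lambda>n. (norm (v x n))\<^sup>2) has_sum (norm x)\<^sup>2) (range (\<lambda>n. int_encode (int n)))"
      by (simp only: has_sum_reindex)
    have "v x n = 0" if "n \<notin> range (\<lambda>n. int_encode (int n))" for n
    proof -
      have "\<not> int_decode n \<ge> 0"
      proof
        assume "int_decode n \<ge> 0"
        then have "n = int_encode (int (nat (int_decode n)))" by simp
        then show False using that by blast
      qed
      then show ?thesis by (simp add: v_def)
    qed
    then have "((\<lambda>n. (norm (v x n))\<^sup>2) has_sum (norm x)\<^sup>2) (range (\<lambda>n. int_encode (int n)))
        \<longleftrightarrow> ((\<lambda>n. (norm (v x n))\<^sup>2) has_sum (norm x)\<^sup>2) UNIV"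
      by (intro has_sum_cong_neutral) auto
    with 1 show ?thesis by blast
  qed
  define V where "V x = Abs_ell2 (v x)" for x
  have coordV: "coord (V x) n = v x n" if "x \<in> S" for x n
  proof -
    have "square_summable (v x)"
      unfolding square_summable_def using has_sum_imp_sums[OF vsum[OF that]] sums_summable by blast
    then show ?thesis by (simp add: V_def coord_Abs)
  qed
  let ?K = "ell2_over W" and ?U = "shift_ell2 1 :: 'a ell2 \<Rightarrow> 'a ell2"
  have K: "closed_csubspace ?K" by (rule ell2_over_csubspace[OF W])
  have "unitary_on ?K ?U"
    unfolding unitary_on_def isometry_on_def
  proof (intro conjI ballI shift_bounded_op[OF W] norm_shift equalityI subsetI)
    fix f assume "f \<in> ?K"
    then have "shift_ell2 (-1) f \<in> ?K" "f = ?U (shift_ell2 (-1) f)"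
      by (simp_all add: shift_ell2_over shift_shift shift_zero)
    then show "f \<in> ?U ` ?K" by blast
  qed (auto simp: shift_ell2_over)
  then have unitary: "tetra_unitary_on ?K (\<lambda>_. 0) (\<lambda>_. 0) ?U" by (rule tetra_unitary_of_unitary[OF K])
  have VK: "V ` S \<subseteq> ?K"
    by (auto simp: ell2_over_def coordV v_def DW RnS csubspaceD(1)[OF W])
  have Vadd: "V (x + y) = V x + V y" if "x \<in> S" "y \<in> S" for x y
    using that by (intro ell2_eqI)
      (simp add: coordV coord_add v_def SD RnS bounded_opD(2)[OF bounded_op_funpow[OF R]] bounded_opD(2)[OF D])
  have Vscale: "V (c *\<^sub>C x) = c *\<^sub>C V x" if "x \<in> S" for c x
    using that by (intro ell2_eqI)
      (simp add: coordV coord_scaleC v_def SD RnS bounded_opD(3)[OF bounded_op_funpow[OF R]] bounded_opD(3)[OF D])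
  have Vnorm: "norm (V x) = norm x" if x: "x \<in> S" for x
  proof -
    have "((\<lambda>n. (norm (v x n))\<^sup>2) has_sum (norm (V x))\<^sup>2) UNIV"
      using norm_sq_has_sum[of "V x"] by (simp add: coordV[OF x])
    then have "(norm (V x))\<^sup>2 = (norm x)\<^sup>2" using vsum[OF x] has_sum_unique by blast
    then show ?thesis by simp
  qed
  have VP: "V (P x) = ?U (V x)" if x: "x \<in> S" for x
  proof (rule ell2_eqI)
    fix n
    define m where "m = int_decode n"
    have U: "coord (?U (V x)) n = (if m \<ge> 1 then D ((R ^^ nat (m - 1)) x) else 0)"
      by (simp add: coord_shift coordV x v_def m_def)
    have L: "coord (V (P x)) n = (if m \<ge> 0 then D ((R ^^ nat m) (P x)) else 0)"
      by (simp add: coordV[OF PS[OF x]] v_def m_def)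
    consider "m \<ge> 1" | "m = 0" | "m < 0" by linarith
    then show "coord (V (P x)) n = coord (?U (V x)) n"
    proof cases
      case 1
      then have "nat m = Suc (nat (m - 1))" by simp
      then have "(R ^^ nat m) (P x) = (R ^^ nat (m - 1)) x" by (simp add: funpow_swap1 RP x)
      then show ?thesis using 1 U L by simp
    qed (use U L DP[OF x] in auto)
  qed
  have "V (A x) = 0" "V (B x) = 0" if "x \<in> S" for x
    using Vnorm[OF SD(1)] zero[OF that] by simp_all
  then have "\<forall>x\<in>S. V (A x) = (\<lambda>_. 0) (V x) \<and> V (B x) = (\<lambda>_. 0) (V x) \<and> V (P x) = ?U (V x)"
    using VP by simp
  moreover have "A ` S \<subseteq> S" "B ` S \<subseteq> S" "P ` S \<subseteq> S" using zero SD(1) PS by auto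
  ultimately show ?thesis
    unfolding tetra_isometry_on_def
    apply (intro conjI)
       apply assumption+
    apply (rule exI[of _ ?K], rule exI[of _ "\<lambda>_. 0"], rule exI[of _ "\<lambda>_. 0"], rule exI[of _ ?U], rule exI[of _ V])
    using K unitary VK Vadd Vscale Vnorm by simp
qed

section \<open>Exponential series of bounded operators\<close>

definition exp_series :: "(nat \<Rightarrow> 'a::complex_hilbert) \<Rightarrow> complex \<Rightarrow> 'a" where
  "exp_series a z = suminf (\<lambda>n. (z ^ n /\<^sub>R fact n) *\<^sub>C a n)"

definition exp_bounded :: "(nat \<Rightarrow> 'a::complex_hilbert) \<Rightarrow> bool" where
  "exp_bounded a \<longleftrightarrow> (\<exists>C c. \<forall>n. norm (a n) \<le> C * c ^ n)"

lemma exp_bounded_majorant: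
  assumes "exp_bounded a"
  obtains M where "summable M" "\<And>z n. cmod z \<le> r \<Longrightarrow> norm ((z ^ n /\<^sub>R fact n) *\<^sub>C a n) \<le> M n"
proof -
  obtain C c where a: "\<And>n. norm (a n) \<le> C * c ^ n" using assms unfolding exp_bounded_def by blast
  define M where "M n = C * (inverse (fact n) * (r * c) ^ n)" for n
  show ?thesis
  proof (rule that[of M])
    show "summable M" unfolding M_def by (intro summable_mult summable_exp)
    show "norm ((z ^ n /\<^sub>R fact n) *\<^sub>C a n) \<le> M n" if "cmod z \<le> r" for z n
    proof -
      have "norm ((z ^ n /\<^sub>R fact n) *\<^sub>C a n) = inverse (fact n) * ((cmod z) ^ n * norm (a n))"
        by (simp add: norm_scaleC norm_power)
      also have "\<dots> \<le> inverse (fact n) * (r ^ n * (C * c ^ n))"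
        using that order_trans[OF norm_ge_zero that]
        by (intro mult_left_mono mult_mono power_mono a zero_le_power) auto
      finally show ?thesis by (simp add: M_def power_mult_distrib algebra_simps)
    qed
  qed
qed

lemma exp_series_abs_summable:
  assumes "exp_bounded a"
  shows "summable (\<lambda>n. norm ((z ^ n /\<^sub>R fact n) *\<^sub>C a n))"
proof -
  obtain M where M: "summable M" "\<And>w n. cmod w \<le> cmod z \<Longrightarrow> norm ((w ^ n /\<^sub>R fact n) *\<^sub>C a n) \<le> M n"
    using exp_bounded_majorant[OF assms] by blast
  show ?thesis by (rule summable_comparison_test'[OF M(1)]) (use M(2) in auto)
qed

lemma exp_series_sums:
  assumes "exp_bounded a"
  shows "(\<lambda>n. (z ^ n /\<^sub>R fact n) *\<^sub>C a n) sums exp_series a z"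
  unfolding exp_series_def
  by (rule summable_sums[OF summable_norm_cancel[OF exp_series_abs_summable[OF assms]]])

lemma exp_series_partial:
  assumes "exp_bounded a"
  shows "(\<lambda>n. \<Sum>k<n. (z ^ k /\<^sub>R fact k) *\<^sub>C a k) \<longlonglongrightarrow> exp_series a z"
  using exp_series_sums[OF assms] unfolding sums_def .

lemma exp_series_uniform_limit:
  assumes a: "exp_bounded a" and \<phi>: "\<And>z. z \<in> A \<Longrightarrow> cmod (\<phi> z) \<le> r"
  shows "uniform_limit A (\<lambda>n z. \<Sum>k<n. (\<phi> z ^ k /\<^sub>R fact k) *\<^sub>C a k) (\<lambda>z. exp_series a (\<phi> z)) sequentially"
proof -
  obtain M where M: "summable M" "\<And>w n. cmod w \<le> r \<Longrightarrow> norm ((w ^ n /\<^sub>R fact n) *\<^sub>C a n) \<le> M n"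
    using exp_bounded_majorant[OF a] by blast
  show ?thesis unfolding exp_series_def
    by (rule Weierstrass_m_test[OF _ M(1)]) (use M(2) \<phi> in auto)
qed

lemma exp_series_bounded_image:
  assumes a: "exp_bounded a" and \<phi>: "\<And>z. z \<in> A \<Longrightarrow> cmod (\<phi> z) \<le> r"
  shows "bounded ((\<lambda>z. exp_series a (\<phi> z)) ` A)"
proof -
  obtain M where M: "summable M" "\<And>w n. cmod w \<le> r \<Longrightarrow> norm ((w ^ n /\<^sub>R fact n) *\<^sub>C a n) \<le> M n"
    using exp_bounded_majorant[OF a] by blast
  have "norm (exp_series a (\<phi> z)) \<le> suminf M" if "z \<in> A" for z
    unfolding exp_series_def by (rule norm_suminf_le[OF M(2) M(1)]) (rule \<phi>[OF that])
  then show ?thesis unfolding bounded_iff by blast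
qed

lemma exp_bounded_powers:
  assumes T: "bounded_op_on S T" and X: "bounded_op_on S X" and x: "x \<in> S"
  shows "exp_bounded (\<lambda>n. T ((X ^^ n) x))"
proof -
  obtain c where c: "c > 0" "\<And>x. x \<in> S \<Longrightarrow> norm (X x) \<le> c * norm x" using bounded_op_bound[OF X] by blast
  obtain C where C: "C > 0" "\<And>x. x \<in> S \<Longrightarrow> norm (T x) \<le> C * norm x" using bounded_op_bound[OF T] by blast
  have XS: "(X ^^ n) x \<in> S" for n by (rule bounded_opD(1)[OF bounded_op_funpow[OF X] x])
  have pow_le: "norm ((X ^^ n) x) \<le> c ^ n * norm x" for n by (rule funpow_norm_le[OF X c x])
  have "norm (T ((X ^^ n) x)) \<le> (C * norm x) * c ^ n" for n
  proof -
    have "norm (T ((X ^^ n) x)) \<le> C * norm ((X ^^ n) x)" by (rule C(2)[OF XS])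
    also have "\<dots> \<le> C * (c ^ n * norm x)"
      using C(1) pow_le by (intro mult_left_mono) auto
    finally show ?thesis by (simp add: algebra_simps)
  qed
  then show ?thesis unfolding exp_bounded_def by blast
qed

definition exp_op :: "('a::complex_hilbert \<Rightarrow> 'a) \<Rightarrow> complex \<Rightarrow> 'a \<Rightarrow> 'a" where
  "exp_op X z x = exp_series (\<lambda>n. (X ^^ n) x) z"

lemma exp_op_bounded_powers:
  assumes "bounded_op_on S X" "x \<in> S"
  shows "exp_bounded (\<lambda>n. (X ^^ n) x)"
  by (rule exp_bounded_powers[OF bounded_op_ident assms])

lemma exp_op_partial:
  assumes X: "bounded_op_on S X" and x: "x \<in> S"
  shows "(\<lambda>n. \<Sum>k<n. (z ^ k /\<^sub>R fact k) *\<^sub>C (X ^^ k) x) \<longlonglongrightarrow> exp_op X z x"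
  unfolding exp_op_def by (rule exp_series_partial[OF exp_op_bounded_powers[OF X x]])

lemma exp_op_partial_closed:
  assumes S: "closed_csubspace S" and X: "bounded_op_on S X" and x: "x \<in> S"
  shows "(\<Sum>k<n. (z ^ k /\<^sub>R fact k) *\<^sub>C (X ^^ k) x) \<in> S"
  by (rule csubspace_sum[OF S csubspaceD(3)[OF S bounded_opD(1)[OF bounded_op_funpow[OF X] x]]])

lemma exp_op_closed:
  assumes S: "closed_csubspace S" and X: "bounded_op_on S X" and x: "x \<in> S"
  shows "exp_op X z x \<in> S"
  by (rule csubspace_limit[OF S exp_op_partial_closed[OF S X x] exp_op_partial[OF X x]])

lemma apply_exp_op:
  assumes S: "closed_csubspace S" and X: "bounded_op_on S X" and T: "bounded_op_on S T" and x: "x \<in> S"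
  shows "T (exp_op X z x) = exp_series (\<lambda>n. T ((X ^^ n) x)) z"
proof (rule LIMSEQ_unique)
  have XS: "(X ^^ k) x \<in> S" for k by (rule bounded_opD(1)[OF bounded_op_funpow[OF X] x])
  have eq: "T (\<Sum>k<n. (z ^ k /\<^sub>R fact k) *\<^sub>C (X ^^ k) x) = (\<Sum>k<n. (z ^ k /\<^sub>R fact k) *\<^sub>C T ((X ^^ k) x))" for n
    by (subst bounded_op_sum[OF T S]) (simp_all add: csubspaceD(3)[OF S XS] bounded_opD(3)[OF T XS])
  have "(\<lambda>n. T (\<Sum>k<n. (z ^ k /\<^sub>R fact k) *\<^sub>C (X ^^ k) x)) \<longlonglongrightarrow> T (exp_op X z x)"
    by (rule bounded_op_tendsto[OF T S exp_op_partial_closed[OF S X x] exp_op_closed[OF S X x] exp_op_partial[OF X x]])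
  then show "(\<lambda>n. \<Sum>k<n. (z ^ k /\<^sub>R fact k) *\<^sub>C T ((X ^^ k) x)) \<longlonglongrightarrow> T (exp_op X z x)"
    unfolding eq .
  show "(\<lambda>n. \<Sum>k<n. (z ^ k /\<^sub>R fact k) *\<^sub>C T ((X ^^ k) x)) \<longlonglongrightarrow> exp_series (\<lambda>n. T ((X ^^ n) x)) z"
    by (rule exp_series_partial[OF exp_bounded_powers[OF T X x]])
qed

lemma exp_op_commute:
  assumes S: "closed_csubspace S" and X: "bounded_op_on S X" and T: "bounded_op_on S T"
    and comm: "\<And>x. x \<in> S \<Longrightarrow> T (X x) = X (T x)" and x: "x \<in> S"
  shows "T (exp_op X z x) = exp_op X z (T x)"
proof -
  have "T ((X ^^ n) x) = (X ^^ n) (T x)" for n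
    by (rule funpow_commute_on[where S = S and T = T and R = X]) (use comm x bounded_opD(1)[OF X] in auto)
  then show ?thesis by (simp only: apply_exp_op[OF S X T x]) (simp add: exp_op_def)
qed

lemma exp_op_bounded:
  assumes S: "closed_csubspace S" and X: "bounded_op_on S X"
  shows "bounded_op_on S (exp_op X z)"
proof -
  obtain c where c: "c > 0" "\<And>x. x \<in> S \<Longrightarrow> norm (X x) \<le> c * norm x" using bounded_op_bound[OF X] by blast
  note pw = bounded_opD[OF bounded_op_funpow[OF X]]
  have pn: "norm ((X ^^ n) x) \<le> c ^ n * norm x" if "x \<in> S" for n x by (rule funpow_norm_le[OF X c that])
  show ?thesis
  proof (rule bounded_op_onI[where C = "suminf (\<lambda>n. inverse (fact n) * (cmod z * c) ^ n)"])
    fix x assume x: "x \<in> S"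
    show "exp_op X z x \<in> S" by (rule exp_op_closed[OF S X x])
    show "exp_op X z (d *\<^sub>C x) = d *\<^sub>C exp_op X z x" for d
      using exp_op_commute[OF S X bounded_op_scaleC[OF S bounded_op_ident, of d] _ x] bounded_opD(3)[OF X] by simp
    have "norm ((z ^ n /\<^sub>R fact n) *\<^sub>C (X ^^ n) x) \<le> (inverse (fact n) * (cmod z * c) ^ n) * norm x" for n
    proof -
      have "norm ((z ^ n /\<^sub>R fact n) *\<^sub>C (X ^^ n) x) = (inverse (fact n) * cmod z ^ n) * norm ((X ^^ n) x)"
        by (simp add: norm_scaleC norm_power)
      also have "\<dots> \<le> (inverse (fact n) * cmod z ^ n) * (c ^ n * norm x)"
        by (intro mult_left_mono pn x) auto
      finally show ?thesis by (simp add: power_mult_distrib mult.assoc)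
    qed
    then have "norm (exp_op X z x) \<le> suminf (\<lambda>n. (inverse (fact n) * (cmod z * c) ^ n) * norm x)"
      unfolding exp_op_def exp_series_def by (rule norm_suminf_le) (intro summable_mult2 summable_exp)
    then show "norm (exp_op X z x) \<le> suminf (\<lambda>n. inverse (fact n) * (cmod z * c) ^ n) * norm x"
      by (simp add: suminf_mult2[OF summable_exp])
    show "exp_op X z (x + y) = exp_op X z x + exp_op X z y" if y: "y \<in> S" for y
    proof -
      have "(\<lambda>n. (z ^ n /\<^sub>R fact n) *\<^sub>C (X ^^ n) x + (z ^ n /\<^sub>R fact n) *\<^sub>C (X ^^ n) y)
          sums (exp_op X z x + exp_op X z y)"
        unfolding exp_op_def
        by (intro sums_add exp_series_sums exp_op_bounded_powers[OF X x] exp_op_bounded_powers[OF X y])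
      then show ?thesis
        unfolding exp_op_def exp_series_def pw(2)[OF x y] scaleC_add_right
        by (rule sums_unique[symmetric])
    qed
  qed
qed

lemma cinner_exp_op:
  assumes S: "closed_csubspace S" and X: "bounded_op_on S X" and x: "x \<in> S" and y: "y \<in> S"
  shows "cinner (exp_op X z x) y = cinner x (exp_op (adj_on S X) (cnj z) y)"
proof (rule LIMSEQ_unique)
  note aX = adj_on_bounded[OF S X]
  show "(\<lambda>n. cinner (\<Sum>k<n. (z ^ k /\<^sub>R fact k) *\<^sub>C (X ^^ k) x) y) \<longlonglongrightarrow> cinner (exp_op X z x) y"
    by (intro tendsto_cinner exp_op_partial[OF X x] tendsto_const)
  have "cinner (\<Sum>k<n. (z ^ k /\<^sub>R fact k) *\<^sub>C (X ^^ k) x) y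
      = cinner x (\<Sum>k<n. (cnj z ^ k /\<^sub>R fact k) *\<^sub>C (adj_on S X ^^ k) y)" for n
    by (simp add: cinner_sum_left cinner_sum_right cinner_scaleC_left cinner_scaleC_right adj_on_funpow[OF S X x y])
  then show "(\<lambda>n. cinner (\<Sum>k<n. (z ^ k /\<^sub>R fact k) *\<^sub>C (X ^^ k) x) y) \<longlonglongrightarrow> cinner x (exp_op (adj_on S X) (cnj z) y)"
    by (simp add: tendsto_cinner[OF tendsto_const exp_op_partial[OF aX y]])
qed

lemma scaleC_sum_left: "(\<Sum>i\<in>I. c i) *\<^sub>C x = (\<Sum>i\<in>I. c i *\<^sub>C (x :: 'a::complex_inner))"
  by (induction I rule: infinite_finite_induct) (simp_all add: scaleC_add_left)

text \<open>The double series is summed first by rows, then by antidiagonals.\<close>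

lemma exp_op_inverse:
  assumes S: "closed_csubspace S" and X: "bounded_op_on S X" and x: "x \<in> S"
  shows "exp_op X z (exp_op X (- z) x) = x"
proof -
  obtain c where c: "c > 0" "\<And>x. x \<in> S \<Longrightarrow> norm (X x) \<le> c * norm x" using bounded_op_bound[OF X] by blast
  note pw = bounded_opD[OF bounded_op_funpow[OF X]]
  have pn: "norm ((X ^^ n) x) \<le> c ^ n * norm x" for n by (rule funpow_norm_le[OF X c x])
  define s where "s w n = w ^ n /\<^sub>R fact n" for w :: complex and n :: nat
  define f where "f = (\<lambda>(j, k). (s z j * s (- z) k) *\<^sub>C (X ^^ (j + k)) x)"
  define g where "g j = inverse (fact j) * (cmod z * c) ^ j" for j :: nat
  have gpos: "g j \<ge> 0" for j using c(1) by (simp add: g_def)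
  have gsum: "(g has_sum suminf g) UNIV"
    unfolding g_def[abs_def] using c(1)
    by (intro sums_nonneg_imp_has_sum summable_sums summable_exp) auto
  have major: "(\<lambda>(j, k). g j * g k * norm x) summable_on Sigma UNIV (\<lambda>_. UNIV)"
  proof (rule summable_on_SigmaI)
    show "((\<lambda>k. case (j, k) of (j, k) \<Rightarrow> g j * g k * norm x) has_sum (g j * suminf g * norm x)) UNIV" for j
      using has_sum_cmult_left[OF has_sum_cmult_right[OF gsum, of "g j"], of "norm x"] by simp
    show "(\<lambda>j. g j * suminf g * norm x) summable_on UNIV"
      using gsum by (intro summable_on_cmult_left has_sum_imp_summable)
  qed (use gpos in auto)
  have "f abs_summable_on Sigma UNIV (\<lambda>_. UNIV)"
  proof (rule Infinite_Sum.abs_summable_on_comparison_test'[OF major])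
    fix p :: "nat \<times> nat"
    obtain j k where p: "p = (j, k)" by (cases p)
    have "norm (f p) = (inverse (fact j) * cmod z ^ j * (inverse (fact k) * cmod z ^ k)) * norm ((X ^^ (j + k)) x)"
      by (simp add: p f_def s_def norm_scaleC norm_mult norm_power)
    also have "\<dots> \<le> (inverse (fact j) * cmod z ^ j * (inverse (fact k) * cmod z ^ k)) * (c ^ (j + k) * norm x)"
      by (intro mult_left_mono pn) auto
    also have "\<dots> = g j * g k * norm x"
      by (simp add: g_def power_mult_distrib power_add algebra_simps)
    finally show "norm (f p) \<le> (case p of (j, k) \<Rightarrow> g j * g k * norm x)" by (simp add: p)
  qed
  then have fsum: "(f has_sum infsum f (Sigma UNIV (\<lambda>_. UNIV))) (Sigma UNIV (\<lambda>_. UNIV))"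
    by (rule has_sum_infsum[OF abs_summable_summable])
  define L where "L = infsum f (Sigma UNIV (\<lambda>_. UNIV))"
  define e where "e = exp_op X (- z) x"
  have eS: "e \<in> S" unfolding e_def by (rule exp_op_closed[OF S X x])
  have row: "((\<lambda>k. f (j, k)) has_sum s z j *\<^sub>C (X ^^ j) e) UNIV" for j
  proof (rule norm_summable_imp_has_sum)
    have bd: "bounded_op_on S (\<lambda>y. s z j *\<^sub>C (X ^^ j) y)"
      by (rule bounded_op_scaleC[OF S bounded_op_funpow[OF X]])
    note eb = exp_bounded_powers[OF bd X x]
    have fj: "f (j, k) = ((- z) ^ k /\<^sub>R fact k) *\<^sub>C (s z j *\<^sub>C (X ^^ j) ((X ^^ k) x))" for k
      by (simp add: f_def s_def scaleC_scaleC funpow_add mult.commute)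
    show "summable (\<lambda>k. norm (f (j, k)))" unfolding fj by (rule exp_series_abs_summable[OF eb])
    show "(\<lambda>k. f (j, k)) sums (s z j *\<^sub>C (X ^^ j) e)"
      unfolding fj e_def using exp_series_sums[OF eb] by (simp add: apply_exp_op[OF S X bd x])
  qed
  have "((\<lambda>j. s z j *\<^sub>C (X ^^ j) e) has_sum L) UNIV"
    using has_sum_SigmaD[OF fsum row] unfolding L_def .
  then have "(\<lambda>j. s z j *\<^sub>C (X ^^ j) e) sums L" by (rule has_sum_imp_sums)
  moreover have "(\<lambda>j. s z j *\<^sub>C (X ^^ j) e) sums exp_op X z e"
    unfolding s_def exp_op_def by (rule exp_series_sums[OF exp_op_bounded_powers[OF X eS]])
  ultimately have L1: "L = exp_op X z e" by (rule sums_unique2)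
  define h where "h = (\<lambda>(n::nat, k::nat). (n - k, k))"
  have "bij_betw h (Sigma UNIV (\<lambda>n. {..n})) (Sigma UNIV (\<lambda>_. UNIV))"
    by (rule bij_betw_byWitness[where f' = "\<lambda>(j, k). (j + k, k)"]) (auto simp: h_def)
  then have "((\<lambda>p. f (h p)) has_sum L) (Sigma UNIV (\<lambda>n. {..n}))"
    using fsum unfolding L_def by (simp only: has_sum_reindex_bij_betw)
  moreover have "((\<lambda>k. f (h (n, k))) has_sum (if n = 0 then x else 0)) {..n}" for n
  proof -
    have "(\<Sum>k\<le>n. f (h (n, k))) = (\<Sum>k\<le>n. (s (- z) k * s z (n - k)) *\<^sub>C (X ^^ n) x)"
      by (intro sum.cong) (auto simp: f_def h_def mult.commute)
    also have "\<dots> = (\<Sum>k\<le>n. s (- z) k * s z (n - k)) *\<^sub>C (X ^^ n) x"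
      by (rule scaleC_sum_left[symmetric])
    also have "(\<Sum>k\<le>n. s (- z) k * s z (n - k)) = s (- z + z) n"
      unfolding s_def by (rule exp_series_add_commuting[symmetric]) simp
    also have "s (- z + z) n *\<^sub>C (X ^^ n) x = (if n = 0 then x else 0)"
      by (auto simp: s_def power_0_left)
    finally show ?thesis using has_sum_finite[of "{..n}" "\<lambda>k. f (h (n, k))"] by simp
  qed
  ultimately have "((\<lambda>n::nat. if n = 0 then x else 0) has_sum L) UNIV"
    by (rule has_sum_SigmaD)
  then have "(\<lambda>n::nat. if n = 0 then x else 0) sums L" by (rule has_sum_imp_sums)
  then have "L = x" using sums_single[of 0 "\<lambda>_. x"] sums_unique2 by fastforce
  with L1 show ?thesis by (simp add: e_def)
qed

section \<open>The Fuglede theorem\<close>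

lemma normal_onD:
  assumes "closed_csubspace S" "normal_on S N"
  shows "bounded_op_on S N" "bounded_op_on S (adj_on S N)"
    "\<And>x. x \<in> S \<Longrightarrow> N (adj_on S N x) = adj_on S N (N x)"
  using assms adj_on_bounded unfolding normal_on_def by auto

lemma exp_op_normal_commute:
  assumes S: "closed_csubspace S" and N: "normal_on S N" and y: "y \<in> S"
  shows "exp_op N w (exp_op (adj_on S N) v y) = exp_op (adj_on S N) v (exp_op N w y)"
proof (rule exp_op_commute[OF S normal_onD(2)[OF S N] exp_op_bounded[OF S normal_onD(1)[OF S N]] _ y])
  show "exp_op N w (adj_on S N x) = adj_on S N (exp_op N w x)" if "x \<in> S" for x
    by (rule exp_op_commute[OF S normal_onD(1)[OF S N] normal_onD(2)[OF S N] normal_onD(3)[OF S N, symmetric] that, symmetric])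
qed

text \<open>
  As \<open>N\<close> is normal, \<open>e\<^bsup>- z N\<^sup>*\<^esup> e\<^bsup>(cnj z) N\<^esup>\<close> is the exponential of the skew-adjoint operator
  \<open>(cnj z) N - z N\<^sup>*\<close>.
\<close>

lemma exp_skew_isometry:
  assumes S: "closed_csubspace S" and N: "normal_on S N" and x: "x \<in> S"
  shows "norm (exp_op (adj_on S N) (- z) (exp_op N (cnj z) x)) = norm x"
proof -
  let ?M = "adj_on S N"
  note bN = normal_onD(1)[OF S N] and bM = normal_onD(2)[OF S N]
  have bE: "bounded_op_on S (exp_op N w)" and bE': "bounded_op_on S (exp_op ?M w)" for w
    by (rule exp_op_bounded[OF S bN], rule exp_op_bounded[OF S bM])
  note cE = bounded_opD(1)[OF bE] and cE' = bounded_opD(1)[OF bE']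
  note MN = exp_op_normal_commute[OF S N]
  define a where "a = exp_op N (cnj z) x"
  have aS: "a \<in> S" unfolding a_def by (rule cE[OF x])
  have MM: "adj_on S ?M y = N y" if "y \<in> S" for y by (rule adj_on_adj_on[OF S bN that])
  have pow: "(adj_on S ?M ^^ n) y = (N ^^ n) y" if "y \<in> S" for n y
    by (induction n) (simp_all add: MM bounded_opD(1)[OF bounded_op_funpow[OF bN] that])
  have ee: "exp_op (adj_on S ?M) w y = exp_op N w y" if "y \<in> S" for w y
    by (simp add: exp_op_def pow[OF that])
  have "cinner (exp_op ?M (- z) a) (exp_op ?M (- z) a) = cinner a (exp_op N (- cnj z) (exp_op ?M (- z) a))"
    using cinner_exp_op[OF S bM aS cE'[OF aS]] ee[OF cE'[OF aS]] by simp
  also have "\<dots> = cinner a (exp_op ?M (- z) (exp_op N (- cnj z) a))" by (simp add: MN[OF aS])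
  also have "exp_op N (- cnj z) a = x"
    unfolding a_def using exp_op_inverse[OF S bN x, of "- cnj z"] by simp
  also have "cinner a (exp_op ?M (- z) x) = cinner x (exp_op ?M z (exp_op ?M (- z) x))"
    unfolding a_def using cinner_exp_op[OF S bN x cE'[OF x]] by simp
  also have "exp_op ?M z (exp_op ?M (- z) x) = x" by (rule exp_op_inverse[OF S bM x])
  finally have "(norm (exp_op ?M (- z) a))\<^sup>2 = (norm x)\<^sup>2" by (simp add: cinner_self flip: of_real_power)
  then show ?thesis by (simp add: a_def)
qed

text \<open>
  The entire function \<open>z \<mapsto> \<langle>T e\<^bsup>- z N\<^sup>*\<^esup> x, e\<^bsup>(cnj z) N\<^esup> y\<rangle>\<close> is bounded, since \<open>T\<close> commutes with the
  exponentials of \<open>N\<close> and both exponentials may be replaced by unitary ones. So it is constant,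
  and its derivative at zero is \<open>\<langle>(N\<^sup>* T - T N\<^sup>*) x, y\<rangle>\<close> up to sign.
\<close>

theorem fuglede:
  assumes S: "closed_csubspace S" and N: "normal_on S N" and T: "bounded_op_on S T"
    and comm: "\<And>x. x \<in> S \<Longrightarrow> T (N x) = N (T x)" and x: "x \<in> S"
  shows "T (adj_on S N x) = adj_on S N (T x)"
proof (rule cinner_eqI[OF S])
  let ?M = "adj_on S N"
  note bN = normal_onD(1)[OF S N] and bM = normal_onD(2)[OF S N]
  note cT = bounded_opD(1)[OF T] and cM = bounded_opD(1)[OF bM]
  show "T (?M x) \<in> S" "?M (T x) \<in> S" using cT cM x by auto
  fix y assume y: "y \<in> S"
  have bE: "bounded_op_on S (exp_op N w)" and bE': "bounded_op_on S (exp_op ?M w)" for w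
    by (rule exp_op_bounded[OF S bN], rule exp_op_bounded[OF S bM])
  note cE = bounded_opD(1)[OF bE] and cE' = bounded_opD(1)[OF bE']
  note MN = exp_op_normal_commute[OF S N]
  obtain C where C: "C > 0" "\<And>x. x \<in> S \<Longrightarrow> norm (T x) \<le> C * norm x" using bounded_op_bound[OF T] by blast
  define a where "a n = T ((?M ^^ n) x)" for n
  define b where "b n = (N ^^ n) y" for n
  have ea: "exp_bounded a" unfolding a_def[abs_def] by (rule exp_bounded_powers[OF T bM x])
  have eb: "exp_bounded b" unfolding b_def[abs_def] by (rule exp_op_bounded_powers[OF bN y])
  define f where "f z = cinner (exp_series a (- z)) (exp_series b (cnj z))" for z
  have f_bound: "cmod (f z) \<le> C * norm x * norm y" for z
  proof -
    define w where "w = exp_op ?M (- z) (exp_op N (cnj z) x)"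
    define w' where "w' = exp_op ?M (- z) (exp_op N (cnj z) y)"
    have wS: "w \<in> S" unfolding w_def by (intro cE' cE x)
    have "exp_op N (- cnj z) w = exp_op ?M (- z) (exp_op N (- cnj z) (exp_op N (cnj z) x))"
      unfolding w_def by (rule MN[OF cE[OF x]])
    also have "exp_op N (- cnj z) (exp_op N (cnj z) x) = x"
      using exp_op_inverse[OF S bN x, of "- cnj z"] by simp
    finally have w: "exp_op ?M (- z) x = exp_op N (- cnj z) w" by simp
    have "exp_series a (- z) = T (exp_op ?M (- z) x)"
      unfolding a_def[abs_def] by (rule apply_exp_op[OF S bM T x, symmetric])
    also have "\<dots> = exp_op N (- cnj z) (T w)"
      unfolding w by (rule exp_op_commute[OF S bN T comm wS])
    finally have "f z = cinner (exp_op N (- cnj z) (T w)) (exp_op N (cnj z) y)"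
      by (simp add: f_def b_def[abs_def] exp_op_def)
    also have "\<dots> = cinner (T w) w'"
      using cinner_exp_op[OF S bN cT[OF wS] cE[OF y], of "- cnj z"] by (simp add: w'_def)
    finally have "cmod (f z) \<le> norm (T w) * norm w'" by (simp add: cmod_cinner_le)
    also have "\<dots> \<le> (C * norm w) * norm w'" by (intro mult_right_mono C(2)[OF wS]) auto
    also have "\<dots> = C * norm x * norm y"
      unfolding w_def w'_def exp_skew_isometry[OF S N x] exp_skew_isometry[OF S N y] ..
    finally show ?thesis .
  qed
  \<comment> \<open>the polynomials \<open>F n\<close> converge to \<open>f\<close> locally uniformly, hence with their derivatives\<close>
  define c where "c k j = ((- 1) ^ k /\<^sub>R fact k) * (1 /\<^sub>R fact j) * cinner (a k) (b j)" for k j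
  define F where "F n z = (\<Sum>k<n. \<Sum>j<n. c k j * z ^ (k + j))" for n z
  define F' where "F' n z = (\<Sum>k<n. \<Sum>j<n. c k j * (of_nat (k + j) * z ^ (k + j - 1)))" for n z
  have F_eq: "F n z = cinner (\<Sum>k<n. ((- z) ^ k /\<^sub>R fact k) *\<^sub>C a k) (\<Sum>j<n. (cnj z ^ j /\<^sub>R fact j) *\<^sub>C b j)" for n z
  proof -
    have "cinner (((- z) ^ k /\<^sub>R fact k) *\<^sub>C a k) ((cnj z ^ j /\<^sub>R fact j) *\<^sub>C b j) = c k j * z ^ (k + j)" for k j
      using power_mult_distrib[of "-1" z k]
      by (simp add: cinner_scaleC_left cinner_scaleC_right c_def power_add algebra_simps)
    then show ?thesis
      unfolding F_def cinner_sum_left by (simp only: cinner_sum_right)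
  qed
  have deriv: "(F n has_field_derivative F' n z) (at z)" for n z
    unfolding F_def[abs_def] F'_def
    by (intro DERIV_sum DERIV_cmult) (auto intro!: derivative_eq_intros)
  have ulim: "uniform_limit (cball z 1) F f sequentially" for z
  proof -
    have bnd: "cmod (- w) \<le> cmod z + 1" "cmod (cnj w) \<le> cmod z + 1" if "w \<in> cball z 1" for w
      using that norm_triangle_ineq2[of w z] by (auto simp: dist_norm norm_minus_commute)
    show ?thesis
      unfolding F_eq[abs_def] f_def[abs_def]
      by (rule bounded_bilinear.bounded_uniform_limit[OF bounded_bilinear_cinner
            exp_series_uniform_limit[OF ea bnd(1)] exp_series_uniform_limit[OF eb bnd(2)]
            exp_series_bounded_image[OF eb bnd(2)] exp_series_bounded_image[OF ea bnd(1)]])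
  qed
  obtain g' where g': "\<And>z. (f has_field_derivative g' z) (at z)" "\<And>z. (\<lambda>n. F' n z) \<longlonglongrightarrow> g' z"
    using has_complex_derivative_uniform_sequence[OF open_UNIV, of F F' f] deriv ulim
    by (metis UNIV_I subset_UNIV zero_less_one)
  have "f holomorphic_on UNIV"
    unfolding holomorphic_on_def using g'(1) field_differentiable_def has_field_derivative_at_within by blast
  moreover have "bounded (range f)" using f_bound unfolding bounded_iff by blast
  ultimately have "f constant_on UNIV" by (rule Liouville_theorem)
  then obtain k where k: "\<And>z. f z = k" unfolding constant_on_def by blast
  have "f = (\<lambda>_. k)" using k by (simp add: fun_eq_iff)
  then have "(f has_field_derivative 0) (at 0)" by simp
  then have g0: "g' 0 = 0" using g'(1) DERIV_unique by blast
  have "F' (Suc (Suc n)) 0 = c 1 0 + c 0 1" for n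
  proof -
    let ?n = "Suc (Suc n)"
    have "F' ?n 0 = (\<Sum>(k, j)\<in>{..<?n} \<times> {..<?n}. c k j * (of_nat (k + j) * 0 ^ (k + j - 1)))"
      unfolding F'_def by (rule sum.cartesian_product)
    also have "\<dots> = (\<Sum>(k, j)\<in>{(1, 0), (0, 1)}. c k j * (of_nat (k + j) * 0 ^ (k + j - 1)))"
    proof (rule sum.mono_neutral_right)
      show "\<forall>i\<in>{..<?n} \<times> {..<?n} - {(1, 0), (0, 1)}. (case i of (k, j) \<Rightarrow> c k j * (of_nat (k + j) * 0 ^ (k + j - 1))) = 0"
      proof
        fix i assume i: "i \<in> {..<?n} \<times> {..<?n} - {(1, 0), (0, 1)}"
        obtain k j where kj: "i = (k, j)" by (cases i)
        have "k + j \<noteq> 1" using i kj by auto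
        then have "k + j = 0 \<or> k + j - 1 > 0" by linarith
        then show "(case i of (k, j) \<Rightarrow> c k j * (of_nat (k + j) * 0 ^ (k + j - 1))) = 0"
          unfolding kj by (auto simp: power_0_left)
      qed
    qed auto
    also have "\<dots> = c 1 0 + c 0 1" by simp
    finally show ?thesis .
  qed
  then have "(\<lambda>n. F' (n + 2) 0) \<longlonglongrightarrow> c 1 0 + c 0 1" by simp
  moreover have "(\<lambda>n. F' (n + 2) 0) \<longlonglongrightarrow> 0"
    using LIMSEQ_ignore_initial_segment[OF g'(2)[of 0], of 2] g0 by simp
  ultimately have "c 1 0 + c 0 1 = 0" by (rule LIMSEQ_unique)
  then have "cinner (T (?M x)) y = cinner (T x) (N y)" by (simp add: c_def a_def b_def)
  also have "\<dots> = cinner (?M (T x)) y" by (rule cinner_adj_on'[OF S bN cT[OF x] y, symmetric])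
  finally show "cinner y (T (?M x)) = cinner y (?M (T x))" by (metis cinner_commute)
qed

section \<open>Joint approximate eigenvectors\<close>

definition approx_null :: "'a::complex_hilbert set \<Rightarrow> ('a \<Rightarrow> 'a) set \<Rightarrow> bool" where
  "approx_null S F \<longleftrightarrow> (\<forall>e>0. \<exists>y\<in>S. norm y = 1 \<and> (\<forall>R\<in>F. norm (R y) \<le> e))"

text \<open>
  The number \<open>t\<close> is the largest limit of \<open>\<langle>T y, y\<rangle>\<close> along unit vectors on which \<open>F\<close> becomes small.
  By its choice the form \<open>d(y, w) = (t + \<theta>) \<langle>y, w\<rangle> + K (\<Sum>R\<in>F. \<langle>R y, R w\<rangle>) - \<langle>T y, w\<rangle>\<close> is positive
  for large \<open>K\<close>. Take a unit vector \<open>y\<close> that almost attains \<open>t\<close>. Since \<open>T\<close> commutes with \<open>F\<close>, the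
  operators in \<open>F\<close> are also small on \<open>w = T y - t y\<close>, so \<open>d(y, w)\<close> is close to \<open>-\<parallel>w\<parallel>\<^sup>2\<close>. Positivity
  at \<open>y + l w\<close> for a fixed small \<open>l > 0\<close> then forces \<open>w\<close> to be small.
\<close>

theorem approx_null_extend:
  fixes T :: "'a::complex_hilbert \<Rightarrow> 'a" and s :: real
  assumes S: "closed_csubspace S" and F: "finite F" and bF: "\<And>R. R \<in> F \<Longrightarrow> bounded_op_on S R"
    and bT: "bounded_op_on S T"
    and sym: "\<And>x y. x \<in> S \<Longrightarrow> y \<in> S \<Longrightarrow> inner (T x) y = inner x (T y)"
    and comm: "\<And>R x. R \<in> F \<Longrightarrow> x \<in> S \<Longrightarrow> R (T x) = T (R x)"
    and start: "\<And>e. e > 0 \<Longrightarrow> \<exists>y\<in>S. norm y = 1 \<and> (\<forall>R\<in>F. norm (R y) \<le> e) \<and> s - e \<le> inner (T y) y"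
  shows "\<exists>t\<ge>s. approx_null S (insert (\<lambda>x. T x - complex_of_real t *\<^sub>C x) F)"
proof -
  note SD = csubspaceD[OF S]
  obtain C where C: "C > 0" "\<And>x. x \<in> S \<Longrightarrow> norm (T x) \<le> C * norm x" using bounded_op_bound[OF bT] by blast
  have TS: "T x \<in> S" if "x \<in> S" for x by (rule bounded_opD(1)[OF bT that])
  have RS: "R x \<in> S" if "R \<in> F" "x \<in> S" for R x by (rule bounded_opD(1)[OF bF[OF that(1)] that(2)])
  have rscale: "Q (r *\<^sub>R x) = r *\<^sub>R Q x" if "bounded_op_on S Q" "x \<in> S" for Q r x
    using bounded_opD(3)[OF that] by (simp add: scaleR_scaleC)
  define A where "A u \<longleftrightarrow> (\<forall>e>0. \<exists>y\<in>S. norm y = 1 \<and> (\<forall>R\<in>F. norm (R y) \<le> e) \<and> u - e \<le> inner (T y) y)" for u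
  have As: "A s" using start by (simp add: A_def)
  have inner_le: "inner (T y) y \<le> C" if "y \<in> S" "norm y = 1" for y
    using norm_cauchy_schwarz[of "T y" y] C(2)[OF that(1)] that(2) by simp
  have A_le: "u \<le> C" if "A u" for u
  proof (rule field_le_epsilon)
    fix e :: real assume "e > 0"
    then obtain y where "y \<in> S" "norm y = 1" "u - e \<le> inner (T y) y" using \<open>A u\<close> unfolding A_def by blast
    then show "u \<le> C + e" using inner_le[of y] by simp
  qed
  define t where "t = Sup {u. A u}"
  have bdd: "bdd_above {u. A u}" by (rule bdd_aboveI[of _ C]) (use A_le in auto)
  have st: "s \<le> t" unfolding t_def by (rule cSup_upper[OF _ bdd]) (simp add: As)
  have At: "A t"
    unfolding A_def
  proof (intro allI impI)
    fix e :: real assume e: "e > 0"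
    have "t - e / 2 < Sup {u. A u}" using e by (simp add: t_def)
    then obtain u where u: "A u" "t - e / 2 < u" using less_cSup_iff[OF _ bdd] As by blast
    then obtain y where "y \<in> S" "norm y = 1" "\<forall>R\<in>F. norm (R y) \<le> e / 2" "u - e / 2 \<le> inner (T y) y"
      using e unfolding A_def by (meson half_gt_zero)
    then show "\<exists>y\<in>S. norm y = 1 \<and> (\<forall>R\<in>F. norm (R y) \<le> e) \<and> t - e \<le> inner (T y) y"
      using u(2) e by (intro bexI[of _ y]) force+
  qed
  define b where "b = C + \<bar>t\<bar>"
  have b: "b > 0" using C(1) by (simp add: b_def)
  have "approx_null S (insert (\<lambda>x. T x - complex_of_real t *\<^sub>C x) F)"
    unfolding approx_null_def
  proof (intro allI impI)
    fix e :: real assume e: "e > 0"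
    \<comment> \<open>\<open>D\<close> bounds \<open>d w w\<close> independently of \<open>K\<close>; this allows \<open>l\<close> to be fixed before \<open>\<theta>\<close> and \<open>K\<close>\<close>
    define D where "D = (b + 2) * b\<^sup>2"
    have D: "D > 0" using b by (simp add: D_def)
    define l where "l = e\<^sup>2 / (2 * D)"
    have l: "l > 0" using e D by (simp add: l_def)
    define q where "q = 3 / (2 * l) + 2 * b"
    have q: "q > 0" using l b by (simp add: q_def add_pos_pos)
    define \<theta> where "\<theta> = min 1 (e\<^sup>2 / (2 * q))"
    have \<theta>: "\<theta> > 0" "\<theta> \<le> 1" using e q by (auto simp: \<theta>_def)
    have \<theta>q: "\<theta> * q \<le> e\<^sup>2 / 2"
    proof -
      have "\<theta> \<le> e\<^sup>2 / (2 * q)" by (simp add: \<theta>_def)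
      then show ?thesis using q by (simp add: field_simps)
    qed
    have "\<not> A (t + \<theta>)"
    proof
      assume "A (t + \<theta>)"
      then have "t + \<theta> \<le> Sup {u. A u}" by (intro cSup_upper[OF _ bdd]) simp
      then have "t + \<theta> \<le> t" by (simp add: t_def)
      then show False using \<theta> by simp
    qed
    then obtain e0 where e0: "e0 > 0"
      "\<And>y. y \<in> S \<Longrightarrow> norm y = 1 \<Longrightarrow> (\<And>R. R \<in> F \<Longrightarrow> norm (R y) \<le> e0) \<Longrightarrow> inner (T y) y < t + \<theta> - e0"
      unfolding A_def by (meson not_le)
    define K where "K = b / e0\<^sup>2"
    have K: "K > 0" using b e0 by (simp add: K_def)
    define d where "d y w = (t + \<theta>) * inner y w + K * (\<Sum>R\<in>F. inner (R y) (R w)) - inner (T y) w" for y w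
    have d_unit: "d y y \<ge> 0" if y: "y \<in> S" "norm y = 1" for y
    proof (cases "\<forall>R\<in>F. norm (R y) \<le> e0")
      case True
      then have "inner (T y) y < t + \<theta> - e0" using e0(2) y by blast
      moreover have "0 \<le> K * (\<Sum>R\<in>F. inner (R y) (R y))" using K by (intro mult_nonneg_nonneg sum_nonneg) auto
      ultimately show ?thesis using e0(1) y(2) by (simp add: d_def dot_square_norm)
    next
      case False
      then obtain R where R: "R \<in> F" "norm (R y) > e0" by force
      have "e0\<^sup>2 \<le> inner (R y) (R y)" using R(2) e0(1) by (simp add: dot_square_norm power_mono)
      also have "\<dots> \<le> (\<Sum>R\<in>F. inner (R y) (R y))"
        by (rule member_le_sum[OF R(1) _ F]) auto
      finally have "K * e0\<^sup>2 \<le> K * (\<Sum>R\<in>F. inner (R y) (R y))" using K by simp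
      moreover have "K * e0\<^sup>2 = b" using e0(1) by (simp add: K_def)
      moreover have "inner (T y) y \<le> C" by (rule inner_le[OF y])
      ultimately show ?thesis using \<theta>(1) y(2) by (simp add: d_def b_def dot_square_norm)
    qed
    have d_pos: "d y y \<ge> 0" if y: "y \<in> S" for y
    proof (cases "y = 0")
      case True
      have "0 \<le> K * (\<Sum>R\<in>F. inner (R y) (R y))" using K by (intro mult_nonneg_nonneg sum_nonneg) auto
      then show ?thesis using True bounded_op_zero[OF bT S] by (simp add: d_def)
    next
      case False
      define v where "v = (1 / norm y) *\<^sub>R y"
      have v: "v \<in> S" "norm v = 1" "y = norm y *\<^sub>R v" using False y by (simp_all add: v_def SD)
      have "d (r *\<^sub>R v) (r *\<^sub>R v) = r\<^sup>2 * d v v" for r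
        by (simp add: d_def rscale[OF bT v(1)] rscale[OF bF v(1)] power2_eq_square sum_distrib_left algebra_simps)
      from this[of "norm y"] v(3) have "d y y = (norm y)\<^sup>2 * d v v" by simp
      then show ?thesis using d_unit[OF v(1,2)] by simp
    qed
    \<comment> \<open>\<open>\<epsilon>\<close> makes the contribution \<open>K m \<epsilon>\<^sup>2\<close> of \<open>F\<close> to the form at most \<open>\<theta>\<close>\<close>
    define m where "m = real (card F)"
    define \<epsilon> where "\<epsilon> = min (min e \<theta>) (min 1 (\<theta> / (K * (m + 1))))"
    have m: "m \<ge> 0" by (simp add: m_def)
    have \<epsilon>: "\<epsilon> > 0" "\<epsilon> \<le> e" "\<epsilon> \<le> \<theta>" "\<epsilon> \<le> 1" "\<epsilon> \<le> \<theta> / (K * (m + 1))"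
      using e \<theta> K m by (auto simp: \<epsilon>_def)
    have Km: "K * (m * \<epsilon>\<^sup>2) \<le> \<theta>"
    proof -
      have "\<epsilon>\<^sup>2 \<le> \<epsilon>" using \<epsilon> by (simp add: power2_eq_square mult_left_le)
      then have "m * \<epsilon>\<^sup>2 \<le> (m + 1) * \<epsilon>" using m \<epsilon>(1) by (intro mult_mono) auto
      then have "K * (m * \<epsilon>\<^sup>2) \<le> K * ((m + 1) * \<epsilon>)" using K by simp
      also have "\<dots> = \<epsilon> * (K * (m + 1))" by simp
      also have "\<dots> \<le> \<theta>" using \<epsilon>(5) K m by (simp only: pos_le_divide_eq[of "K * (m + 1)"] mult_pos_pos)
      finally show ?thesis .
    qed
    obtain y where y: "y \<in> S" "norm y = 1" "\<And>R. R \<in> F \<Longrightarrow> norm (R y) \<le> \<epsilon>" "t - \<epsilon> \<le> inner (T y) y"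
      using At \<epsilon>(1) unfolding A_def by blast
    define w where "w = T y - t *\<^sub>R y"
    have wS: "w \<in> S" unfolding w_def by (intro SD TS y)
    have wb: "norm w \<le> b"
      using norm_triangle_ineq4[of "T y" "t *\<^sub>R y"] C(2)[OF y(1)] y(2) by (simp add: w_def b_def)
    have Rw: "norm (R w) \<le> b * \<epsilon>" if R: "R \<in> F" for R
    proof -
      have "R w = T (R y) - t *\<^sub>R R y"
        unfolding w_def using bounded_op_diff[OF bF[OF R] S TS[OF y(1)] SD(7)[OF y(1)]] rscale[OF bF[OF R] y(1)] comm[OF R y(1)]
        by simp
      then have "norm (R w) \<le> norm (T (R y)) + \<bar>t\<bar> * norm (R y)" using norm_triangle_ineq4[of "T (R y)" "t *\<^sub>R R y"] by simp
      also have "\<dots> \<le> C * norm (R y) + \<bar>t\<bar> * norm (R y)" using C(2)[OF RS[OF R y(1)]] by simp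
      also have "\<dots> = b * norm (R y)" by (simp add: b_def algebra_simps)
      also have "\<dots> \<le> b * \<epsilon>" using y(3)[OF R] b by simp
      finally show ?thesis .
    qed
    have dyy: "d y y \<le> 3 * \<theta>"
    proof -
      have "(\<Sum>R\<in>F. inner (R y) (R y)) \<le> (\<Sum>R\<in>F. \<epsilon>\<^sup>2)"
        using y(3) by (intro sum_mono) (simp add: dot_square_norm power_mono)
      then have "K * (\<Sum>R\<in>F. inner (R y) (R y)) \<le> K * (m * \<epsilon>\<^sup>2)" using K by (simp add: m_def)
      then show ?thesis using Km \<epsilon>(3) y(2,4) by (simp add: d_def dot_square_norm)
    qed
    have dww: "d w w \<le> D"
    proof -
      have w2: "(norm w)\<^sup>2 \<le> b\<^sup>2" using wb by (simp add: power_mono)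
      have "(\<Sum>R\<in>F. inner (R w) (R w)) \<le> (\<Sum>R\<in>F. (b * \<epsilon>)\<^sup>2)"
        using Rw by (intro sum_mono) (simp add: dot_square_norm power_mono)
      also have "\<dots> = b\<^sup>2 * (m * \<epsilon>\<^sup>2)" by (simp add: m_def power_mult_distrib)
      finally have "K * (\<Sum>R\<in>F. inner (R w) (R w)) \<le> b\<^sup>2 * (K * (m * \<epsilon>\<^sup>2))" using K by simp
      also have "\<dots> \<le> b\<^sup>2 * 1" using Km \<theta>(2) by (intro mult_left_mono) auto
      finally have 1: "K * (\<Sum>R\<in>F. inner (R w) (R w)) \<le> b\<^sup>2" by simp
      have "(t + \<theta>) * (norm w)\<^sup>2 \<le> (\<bar>t\<bar> + 1) * (norm w)\<^sup>2" using \<theta>(2) by (intro mult_right_mono) auto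
      moreover have "- inner (T w) w \<le> C * (norm w)\<^sup>2"
        using Cauchy_Schwarz_ineq2[of "T w" w] mult_right_mono[OF C(2)[OF wS], of "norm w"]
        by (simp add: power2_eq_square mult.assoc)
      ultimately have "(t + \<theta>) * (norm w)\<^sup>2 - inner (T w) w \<le> (b + 1) * (norm w)\<^sup>2"
        by (simp add: b_def algebra_simps)
      also have "\<dots> \<le> (b + 1) * b\<^sup>2" using w2 b by (intro mult_left_mono) auto
      finally show ?thesis using 1 by (simp add: d_def D_def dot_square_norm algebra_simps)
    qed
    have dyw: "d y w \<le> 2 * b * \<theta> - (norm w)\<^sup>2"
    proof -
      have "(\<Sum>R\<in>F. inner (R y) (R w)) \<le> (\<Sum>R\<in>F. \<epsilon> * (b * \<epsilon>))"
      proof (rule sum_mono)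
        fix R assume R: "R \<in> F"
        have "inner (R y) (R w) \<le> norm (R y) * norm (R w)" by (rule norm_cauchy_schwarz)
        also have "\<dots> \<le> \<epsilon> * (b * \<epsilon>)" using y(3)[OF R] Rw[OF R] \<epsilon>(1) by (intro mult_mono) auto
        finally show "inner (R y) (R w) \<le> \<epsilon> * (b * \<epsilon>)" .
      qed
      also have "\<dots> = b * (m * \<epsilon>\<^sup>2)" by (simp add: m_def power2_eq_square)
      finally have "K * (\<Sum>R\<in>F. inner (R y) (R w)) \<le> b * (K * (m * \<epsilon>\<^sup>2))" using K by simp
      also have "\<dots> \<le> b * \<theta>" using Km b by simp
      finally have 1: "K * (\<Sum>R\<in>F. inner (R y) (R w)) \<le> b * \<theta>" .
      have 2: "\<theta> * inner y w \<le> \<theta> * b"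
        using norm_cauchy_schwarz[of y w] y(2) wb \<theta>(1) by (intro mult_left_mono) auto
      have "d y w = \<theta> * inner y w + K * (\<Sum>R\<in>F. inner (R y) (R w)) - inner w w"
        by (simp add: d_def w_def inner_diff_left algebra_simps)
      then show ?thesis using 1 2 by (simp add: dot_square_norm mult.commute)
    qed
    have "0 \<le> d (y + l *\<^sub>R w) (y + l *\<^sub>R w)" by (rule d_pos) (intro SD y wS)
    also have "\<dots> = d y y + 2 * l * d y w + l\<^sup>2 * d w w"
    proof -
      have lS: "l *\<^sub>R w \<in> S" by (intro SD wS)
      have lin: "Q (y + l *\<^sub>R w) = Q y + l *\<^sub>R Q w" if "bounded_op_on S Q" for Q
        using bounded_opD(2)[OF that y(1) lS] rscale[OF that wS] by simp
      have "(\<Sum>R\<in>F. inner (R (y + l *\<^sub>R w)) (R (y + l *\<^sub>R w)))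
          = (\<Sum>R\<in>F. inner (R y) (R y)) + 2 * l * (\<Sum>R\<in>F. inner (R y) (R w)) + l\<^sup>2 * (\<Sum>R\<in>F. inner (R w) (R w))"
        unfolding sum_distrib_left sum.distrib[symmetric]
        by (rule sum.cong) (auto simp: lin[OF bF] inner_add_left inner_add_right inner_commute power2_eq_square algebra_simps)
      moreover have "inner (T w) y = inner (T y) w" using sym[OF wS y(1)] by (simp add: inner_commute)
      ultimately show ?thesis
        unfolding d_def lin[OF bT]
        by (simp add: inner_add_left inner_add_right inner_commute[of w y] power2_eq_square algebra_simps)
    qed
    finally have "0 \<le> d y y + 2 * l * d y w + l\<^sup>2 * d w w" .
    also have "\<dots> \<le> 3 * \<theta> + 2 * l * (2 * b * \<theta> - (norm w)\<^sup>2) + l\<^sup>2 * D"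
      using dyy dyw dww l by (intro add_mono mult_left_mono) auto
    finally have "2 * l * (norm w)\<^sup>2 \<le> 3 * \<theta> + 2 * l * (2 * b * \<theta>) + l\<^sup>2 * D" by (simp add: algebra_simps)
    also have "\<dots> = 2 * l * (\<theta> * q + l * D / 2)" using l by (simp add: q_def field_simps power2_eq_square)
    finally have "(norm w)\<^sup>2 \<le> \<theta> * q + l * D / 2" using l by simp
    also have "\<dots> \<le> e\<^sup>2 / 2 + e\<^sup>2 / 2"
    proof -
      have "l * D / 2 = e\<^sup>2 / 4" using D by (simp add: l_def)
      then show ?thesis using \<theta>q zero_le_power2[of e] by linarith
    qed
    finally have "(norm w)\<^sup>2 \<le> e\<^sup>2" by simp
    then have "norm w \<le> e" by (rule power2_le_imp_le) (use e in simp)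
    then show "\<exists>y\<in>S. norm y = 1 \<and> (\<forall>R\<in>insert (\<lambda>x. T x - complex_of_real t *\<^sub>C x) F. norm (R y) \<le> e)"
    proof (intro bexI[of _ y] conjI ballI y(1,2))
      fix R assume "R \<in> insert (\<lambda>x. T x - complex_of_real t *\<^sub>C x) F"
      then show "norm (R y) \<le> e"
      proof
        assume "R = (\<lambda>x. T x - complex_of_real t *\<^sub>C x)"
        then show ?thesis using \<open>norm w \<le> e\<close> by (simp add: w_def scaleR_scaleC)
      next
        assume "R \<in> F"
        then show ?thesis by (rule order_trans[OF y(3) \<epsilon>(2)])
      qed
    qed
  qed
  with st show ?thesis by blast
qed

lemma commute_minus_scalar:
  assumes "closed_csubspace S" "bounded_op_on S X" "bounded_op_on S N" "x \<in> S" "X (N x) = N (X x)"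
  shows "X (N x) - c *\<^sub>C N x = N (X x - c *\<^sub>C x)"
  using bounded_op_diff[OF assms(3,1) bounded_opD(1)[OF assms(2,4)] csubspaceD(3)[OF assms(1,4), of c]]
    bounded_opD(3)[OF assms(3,4)] assms(5) by simp

text \<open>
  The real and the imaginary part of a normal operator are treated one after the other. The adjoint
  is put into the list as well, so that approximate eigenvectors of \<open>N\<close> also serve for \<open>N\<^sup>*\<close>.
\<close>

lemma approx_null_extend_normal:
  fixes N :: "'a::complex_hilbert \<Rightarrow> 'a"
  assumes S: "closed_csubspace S" and F: "finite F" and bF: "\<And>R. R \<in> F \<Longrightarrow> bounded_op_on S R"
    and N: "normal_on S N"
    and comm: "\<And>R x. R \<in> F \<Longrightarrow> x \<in> S \<Longrightarrow> R (N x) = N (R x)"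
      "\<And>R x. R \<in> F \<Longrightarrow> x \<in> S \<Longrightarrow> R (adj_on S N x) = adj_on S N (R x)"
    and null: "approx_null S F"
  shows "\<exists>c. approx_null S ({\<lambda>x. N x - c *\<^sub>C x, \<lambda>x. adj_on S N x - cnj c *\<^sub>C x} \<union> F)"
proof -
  let ?M = "adj_on S N"
  note SD = csubspaceD[OF S]
  note bN = normal_onD(1)[OF S N] and bM = normal_onD(2)[OF S N] and NM = normal_onD(3)[OF S N]
  note cN = bounded_opD(1)[OF bN] and cM = bounded_opD(1)[OF bM]
  have ext: "\<exists>t. approx_null S (insert (\<lambda>x. T x - complex_of_real t *\<^sub>C x) G)"
    if G: "finite G" "\<And>R. R \<in> G \<Longrightarrow> bounded_op_on S R" "approx_null S G" and T: "bounded_op_on S T"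
      "\<And>x y. x \<in> S \<Longrightarrow> y \<in> S \<Longrightarrow> inner (T x) y = inner x (T y)"
      "\<And>R x. R \<in> G \<Longrightarrow> x \<in> S \<Longrightarrow> R (T x) = T (R x)" for T G
  proof -
    obtain C where C: "C > 0" "\<And>x. x \<in> S \<Longrightarrow> norm (T x) \<le> C * norm x" using bounded_op_bound[OF T(1)] by blast
    have "\<exists>y\<in>S. norm y = 1 \<and> (\<forall>R\<in>G. norm (R y) \<le> e) \<and> (- C) - e \<le> inner (T y) y" if e: "e > 0" for e
    proof -
      obtain y where y: "y \<in> S" "norm y = 1" "\<forall>R\<in>G. norm (R y) \<le> e"
        using G(3) e unfolding approx_null_def by blast
      have "\<bar>inner (T y) y\<bar> \<le> C" using Cauchy_Schwarz_ineq2[of "T y" y] C(2)[OF y(1)] y(2) by simp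
      then show ?thesis using y e by (intro bexI[of _ y]) auto
    qed
    from approx_null_extend[OF S G(1,2) T this] show ?thesis by blast
  qed
  define X where "X x = (1/2) *\<^sub>C (N x + ?M x)" for x
  define Y where "Y x = (- \<i> / 2) *\<^sub>C (N x - ?M x)" for x
  have bX: "bounded_op_on S X" unfolding X_def[abs_def] by (rule bounded_op_scaleC[OF S bounded_op_add[OF S bN bM]])
  have bY: "bounded_op_on S Y" unfolding Y_def[abs_def] by (rule bounded_op_scaleC[OF S bounded_op_subtract[OF S bN bM]])
  have adjs: "cinner (N x) y = cinner x (?M y)" "cinner (?M x) y = cinner x (N y)" if "x \<in> S" "y \<in> S" for x y
    using cinner_adj_on[OF S bN that(2,1)] cinner_adj_on'[OF S bN that] by auto
  have symX: "inner (X x) y = inner x (X y)" and symY: "inner (Y x) y = inner x (Y y)" if "x \<in> S" "y \<in> S" for x y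
    unfolding inner_Re_cinner X_def Y_def using that by (simp_all add: cinner_ring adjs algebra_simps)
  have Rlin: "R (N x + ?M x) = R (N x) + R (?M x)" "R (N x - ?M x) = R (N x) - R (?M x)"
    "R (c *\<^sub>C (N x + ?M x)) = c *\<^sub>C R (N x + ?M x)" "R (c *\<^sub>C (N x - ?M x)) = c *\<^sub>C R (N x - ?M x)"
    if "bounded_op_on S R" "x \<in> S" for R x c
    using that cN cM SD by (simp_all add: bounded_opD(2,3)[OF that(1)] bounded_op_diff[OF that(1) S])
  have commX: "R (X x) = X (R x)" and commY: "R (Y x) = Y (R x)"
    if "bounded_op_on S R" "x \<in> S" "R (N x) = N (R x)" "R (?M x) = ?M (R x)" for R x
    unfolding X_def Y_def using that by (simp_all add: Rlin)
  obtain s where s: "approx_null S (insert (\<lambda>x. X x - complex_of_real s *\<^sub>C x) F)"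
    using ext[OF F bF null bX symX] commX[OF bF] comm by blast
  let ?F = "insert (\<lambda>x. X x - complex_of_real s *\<^sub>C x) F"
  have bX': "bounded_op_on S (\<lambda>x. X x - complex_of_real s *\<^sub>C x)"
    by (rule bounded_op_subtract[OF S bX bounded_op_scaleC[OF S bounded_op_ident]])
  have XN: "X (N x) = N (X x)" "X (?M x) = ?M (X x)" if "x \<in> S" for x
    using commX[OF bN that _ NM[OF that]] commX[OF bM that NM[OF that, symmetric]] by auto
  have XY: "X (Y x) = Y (X x)" if "x \<in> S" for x
    by (rule commY[OF bX that XN[OF that]])
  have "\<exists>u. approx_null S (insert (\<lambda>x. Y x - complex_of_real u *\<^sub>C x) ?F)"
  proof (rule ext[OF _ _ s bY symY])
    show "finite ?F" using F by simp
    show "bounded_op_on S R" if "R \<in> ?F" for R using that bX' bF by blast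
    show "R (Y x) = Y (R x)" if "R \<in> ?F" "x \<in> S" for R x
      using that(1)
    proof
      assume R: "R = (\<lambda>x. X x - complex_of_real s *\<^sub>C x)"
      show ?thesis unfolding R by (rule commute_minus_scalar[OF S bX bY that(2) XY[OF that(2)]])
    next
      assume R: "R \<in> F"
      show ?thesis by (rule commY[OF bF[OF R] that(2) comm[OF R that(2)]])
    qed
  qed
  then obtain u where u: "approx_null S (insert (\<lambda>x. Y x - complex_of_real u *\<^sub>C x) ?F)" by blast
  define c where "c = complex_of_real s + \<i> * complex_of_real u"
  have half: "(1/2) *\<^sub>C z + (1/2) *\<^sub>C z = (z::'a)" for z by (simp flip: scaleC_add_left)
  have dec: "N x - c *\<^sub>C x = (X x - complex_of_real s *\<^sub>C x) + \<i> *\<^sub>C (Y x - complex_of_real u *\<^sub>C x)"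
    "?M x - cnj c *\<^sub>C x = (X x - complex_of_real s *\<^sub>C x) - \<i> *\<^sub>C (Y x - complex_of_real u *\<^sub>C x)" for x
  proof -
    have "X x + \<i> *\<^sub>C Y x = N x" "X x - \<i> *\<^sub>C Y x = ?M x"
      using half[of "N x"] half[of "?M x"] by (simp_all add: X_def Y_def scaleC_ring algebra_simps)
    then show "N x - c *\<^sub>C x = (X x - complex_of_real s *\<^sub>C x) + \<i> *\<^sub>C (Y x - complex_of_real u *\<^sub>C x)"
      "?M x - cnj c *\<^sub>C x = (X x - complex_of_real s *\<^sub>C x) - \<i> *\<^sub>C (Y x - complex_of_real u *\<^sub>C x)"
      by (auto simp: c_def scaleC_ring algebra_simps)
  qed
  have "approx_null S ({\<lambda>x. N x - c *\<^sub>C x, \<lambda>x. ?M x - cnj c *\<^sub>C x} \<union> F)"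
    unfolding approx_null_def
  proof (intro allI impI)
    fix e :: real assume e: "e > 0"
    obtain y where y: "y \<in> S" "norm y = 1"
      "\<forall>R\<in>insert (\<lambda>x. Y x - complex_of_real u *\<^sub>C x) ?F. norm (R y) \<le> e / 2"
      using u e unfolding approx_null_def by (meson half_gt_zero)
    have 1: "norm (X y - complex_of_real s *\<^sub>C y) \<le> e / 2" "norm (\<i> *\<^sub>C (Y y - complex_of_real u *\<^sub>C y)) \<le> e / 2"
      using y(3) by (auto simp: norm_scaleC)
    have "norm (N y - c *\<^sub>C y) \<le> e" "norm (?M y - cnj c *\<^sub>C y) \<le> e"
      unfolding dec using norm_triangle_ineq[of "X y - complex_of_real s *\<^sub>C y" "\<i> *\<^sub>C (Y y - complex_of_real u *\<^sub>C y)"]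
        norm_triangle_ineq4[of "X y - complex_of_real s *\<^sub>C y" "\<i> *\<^sub>C (Y y - complex_of_real u *\<^sub>C y)"] 1
      by linarith+
    moreover have "norm (R y) \<le> e" if "R \<in> F" for R using y(3) that e by fastforce
    ultimately show "\<exists>y\<in>S. norm y = 1 \<and> (\<forall>R\<in>{\<lambda>x. N x - c *\<^sub>C x, \<lambda>x. ?M x - cnj c *\<^sub>C x} \<union> F. norm (R y) \<le> e)"
      using y by (intro bexI[of _ y]) auto
  qed
  then show ?thesis by blast
qed

section \<open>The last component of a tetrablock unitary\<close>

text \<open>
  A gliding hump: if the norms of the \<open>z n\<close> were unbounded, corrections of size \<open>3\<^sup>-\<^sup>k\<close> would
  add up to a vector whose inner products with some of them are at least \<open>(4/3)\<^sup>k / 2\<close>.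
\<close>

lemma uniform_boundedness:
  fixes z :: "nat \<Rightarrow> 'a::complex_hilbert"
  assumes S: "closed_csubspace S" and z: "\<And>n. z n \<in> S"
    and bd: "\<And>x. x \<in> S \<Longrightarrow> \<exists>C. \<forall>n. cmod (cinner x (z n)) \<le> C"
  shows "\<exists>C. \<forall>n. norm (z n) \<le> C"
proof (rule ccontr)
  assume "\<not> ?thesis"
  then have "\<forall>k::nat. \<exists>n. 4 ^ k < norm (z n)" by (meson not_le)
  then obtain i where i: "\<And>k. 4 ^ k < norm (z (i k))" by metis
  define v where "v k = z (i k)" for k
  have v: "v k \<in> S" "norm (v k) > 4 ^ k" "v k \<noteq> 0" for k
    using z i[of k] zero_less_power[of "4::real" k] by (auto simp: v_def)
  note SD = csubspaceD[OF S]
  have step: "\<exists>x'. x' \<in> S \<and> norm (x' - x) \<le> (1/3) ^ k \<and> (1/3) ^ k * norm (v k) \<le> cmod (cinner x' (v k))"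
    if x: "x \<in> S" for x k
  proof -
    define w where "w = ((1/3) ^ k / norm (v k)) *\<^sub>R v k"
    have w: "w \<in> S" "norm w = (1/3) ^ k" "cinner w (v k) = of_real ((1/3) ^ k * norm (v k))"
      using v[of k] by (simp_all add: w_def SD scaleR_scaleC cinner_scaleC_left cinner_self norm_scaleC
          norm_divide norm_power power2_eq_square)
    let ?c = "cinner x (v k)" and ?s = "complex_of_real ((1/3) ^ k * norm (v k))"
    have "cmod (2 * ?s) \<le> cmod (?c + ?s) + cmod (?c - ?s)"
    proof -
      have "2 * ?s = (?c + ?s) - (?c - ?s)" by simp
      then show ?thesis by (simp only: norm_triangle_ineq4)
    qed
    then have "2 * cmod ?s \<le> cmod (?c + ?s) + cmod (?c - ?s)"
      by (simp only: norm_mult[of 2] norm_numeral)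
    moreover have "cmod ?s = (1/3) ^ k * norm (v k)" by (simp add: norm_mult norm_power)
    ultimately have "(1/3) ^ k * norm (v k) \<le> cmod (?c + ?s) \<or> (1/3) ^ k * norm (v k) \<le> cmod (?c - ?s)" by linarith
    then show ?thesis
    proof
      assume "(1/3) ^ k * norm (v k) \<le> cmod (?c + ?s)"
      then show ?thesis using w x by (intro exI[of _ "x + w"]) (simp add: SD cinner_add_left)
    next
      assume "(1/3) ^ k * norm (v k) \<le> cmod (?c - ?s)"
      then show ?thesis using w x by (intro exI[of _ "x - w"]) (simp add: SD cinner_diff_left)
    qed
  qed
  define g where "g x k = (SOME x'. x' \<in> S \<and> norm (x' - x) \<le> (1/3) ^ k
      \<and> (1/3) ^ k * norm (v k) \<le> cmod (cinner x' (v k)))" for x k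
  have g: "g x k \<in> S" "norm (g x k - x) \<le> (1/3) ^ k"
    "(1/3) ^ k * norm (v k) \<le> cmod (cinner (g x k) (v k))" if "x \<in> S" for x k
    using someI_ex[OF step[OF that, of k]] by (simp_all add: g_def)
  define x where "x = rec_nat 0 (\<lambda>k y. g y k)"
  have x: "x (Suc k) = g (x k) k" for k by (simp add: x_def)
  have xS: "x k \<in> S" for k by (induction k) (auto simp: x g(1), simp add: x_def SD)
  have tail: "norm (x (Suc k + j) - x (Suc k)) \<le> ((1/3) ^ k - (1/3) ^ (k + j)) / 2" for k j
  proof (induction j)
    case (Suc j)
    have "norm (x (Suc k + Suc j) - x (Suc k)) \<le> norm (x (Suc k + Suc j) - x (Suc k + j)) + norm (x (Suc k + j) - x (Suc k))"
      using norm_triangle_ineq[of "x (Suc k + Suc j) - x (Suc k + j)" "x (Suc k + j) - x (Suc k)"] by simp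
    also have "norm (x (Suc k + Suc j) - x (Suc k + j)) \<le> (1/3) ^ (Suc k + j)"
      using g(2)[OF xS, of "Suc k + j" "Suc k + j"] x[of "Suc k + j"] by simp
    finally have "norm (x (Suc k + Suc j) - x (Suc k)) \<le> (1/3) ^ (Suc k + j) + norm (x (Suc k + j) - x (Suc k))"
      by simp
    moreover have "(1/3::real) ^ (Suc k + j) = (1/3) ^ (k + j) / 3" "(1/3::real) ^ (k + Suc j) = (1/3) ^ (k + j) / 3"
      by simp_all
    moreover have arith: "n2 \<le> (r - q / 3) / 2" if "n2 \<le> q / 3 + n1" "n1 \<le> (r - q) / 2" for n1 n2 q r :: real
      using that by (simp add: field_simps)
    ultimately have "norm (x (Suc k + Suc j) - x (Suc k)) \<le> (1/3) ^ (k + j) / 3 + norm (x (Suc k + j) - x (Suc k))"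
      and eq: "(1/3::real) ^ (k + Suc j) = (1/3) ^ (k + j) / 3" by auto
    from arith[OF this(1) Suc] show ?case unfolding eq .
  qed simp
  have tail': "norm (x m - x (Suc k)) \<le> (1/3) ^ k / 2" if "m \<ge> Suc k" for m k
  proof -
    obtain j where "m = Suc k + j" using le_Suc_ex[OF \<open>m \<ge> Suc k\<close>] by blast
    moreover have "((1/3::real) ^ k - (1/3) ^ (k + j)) / 2 \<le> (1/3) ^ k / 2" by simp
    ultimately show ?thesis using order_trans[OF tail[of k j]] by blast
  qed
  have "Cauchy x"
  proof (rule CauchyI')
    fix e :: real assume e: "e > 0"
    have "\<exists>k. (1/3) ^ k < e" by (rule real_arch_pow_inv[OF e]) simp
    then obtain k :: nat where k: "(1/3) ^ k < e" by blast
    have "dist (x m) (x n) < e" if "m \<ge> Suc k" "n > m" for m n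
      using norm_triangle_ineq4[of "x m - x (Suc k)" "x n - x (Suc k)"] tail'[of k m] tail'[of k n] that k
      by (simp add: dist_norm)
    then show "\<exists>M. \<forall>m\<ge>M. \<forall>n>m. dist (x m) (x n) < e" by blast
  qed
  then obtain y where y: "x \<longlonglongrightarrow> y" using Cauchy_convergent_iff convergent_def by blast
  have yS: "y \<in> S" by (rule csubspace_limit[OF S xS y])
  have ylow: "(4/3) ^ k / 2 \<le> cmod (cinner y (v k))" for k
  proof -
    have "norm (y - x (Suc k)) \<le> (1/3) ^ k / 2"
    proof (rule LIMSEQ_le_const2)
      show "(\<lambda>m. norm (x m - x (Suc k))) \<longlonglongrightarrow> norm (y - x (Suc k))" by (intro tendsto_intros y)
      show "\<exists>N. \<forall>m\<ge>N. norm (x m - x (Suc k)) \<le> (1/3) ^ k / 2" using tail' by blast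
    qed
    then have "cmod (cinner (y - x (Suc k)) (v k)) \<le> (1/3) ^ k / 2 * norm (v k)"
      by (intro order_trans[OF cmod_cinner_le] mult_right_mono) auto
    moreover have "(1/3) ^ k * norm (v k) \<le> cmod (cinner (x (Suc k)) (v k))" unfolding x by (rule g(3)[OF xS])
    moreover have "cmod (cinner (x (Suc k)) (v k)) \<le> cmod (cinner y (v k)) + cmod (cinner (y - x (Suc k)) (v k))"
      using norm_triangle_ineq4[of "cinner y (v k)" "cinner (y - x (Suc k)) (v k)"] by (simp add: cinner_diff_left)
    ultimately have "(1/3) ^ k * norm (v k) / 2 \<le> cmod (cinner y (v k))" by simp
    moreover have "(4/3::real) ^ k \<le> (1/3) ^ k * norm (v k)"
    proof -
      have "(4/3::real) ^ k = (1/3) ^ k * 4 ^ k" by (subst power_mult_distrib[symmetric]) simp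
      also have "\<dots> \<le> (1/3) ^ k * norm (v k)" using v(2)[of k] by (intro mult_left_mono) auto
      finally show ?thesis .
    qed
    ultimately show ?thesis by simp
  qed
  obtain C where C: "\<And>n. cmod (cinner y (z n)) \<le> C" using bd[OF yS] by blast
  have "\<exists>k. 2 * C < (4/3) ^ k" by (rule real_arch_pow) simp
  then obtain k :: nat where "2 * C < (4/3) ^ k" by blast
  then show False using ylow[of k] C[of "i k"] by (simp add: v_def)
qed

text \<open>
  Outside the Taylor spectrum the triple \<open>(A - a, B - b, P - p)\<close> generates the whole space at the
  last stage of the exact Koszul complex. On unit vectors \<open>y n\<close> on which the three adjoints are at
  most \<open>1 / (n + 1)\<close>, this makes the multiples \<open>(n + 1) y n\<close> weakly bounded, although they are
  not bounded.
\<close>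

lemma approx_eigenvalue_in_taylor_spectrum:
  fixes A B P :: "'a::complex_hilbert \<Rightarrow> 'a"
  assumes S: "closed_csubspace S"
    and bA: "bounded_op_on S A" and bB: "bounded_op_on S B" and bP: "bounded_op_on S P"
    and near: "\<And>e. e > 0 \<Longrightarrow> \<exists>y\<in>S. norm y = 1 \<and> norm (adj_on S A y - cnj a *\<^sub>C y) \<le> e
      \<and> norm (adj_on S B y - cnj b *\<^sub>C y) \<le> e \<and> norm (adj_on S P y - cnj p *\<^sub>C y) \<le> e"
  shows "(a, b, p) \<in> taylor_spectrum_on S A B P"
proof (rule ccontr)
  note SD = csubspaceD[OF S]
  assume "(a, b, p) \<notin> taylor_spectrum_on S A B P"
  then have "koszul_exact_on S (\<lambda>x. A x - a *\<^sub>C x) (\<lambda>x. B x - b *\<^sub>C x) (\<lambda>x. P x - p *\<^sub>C x)"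
    unfolding taylor_spectrum_on_def by simp
  then have onto: "S = koszul2 (\<lambda>x. A x - a *\<^sub>C x) (\<lambda>x. B x - b *\<^sub>C x) (\<lambda>x. P x - p *\<^sub>C x) ` (S \<times> S \<times> S)"
    unfolding koszul_exact_on_def by blast
  have "\<exists>y. \<forall>n::nat. y n \<in> S \<and> norm (y n) = 1 \<and> norm (adj_on S P (y n) - cnj p *\<^sub>C y n) \<le> 1 / Suc n
      \<and> norm (adj_on S A (y n) - cnj a *\<^sub>C y n) \<le> 1 / Suc n \<and> norm (adj_on S B (y n) - cnj b *\<^sub>C y n) \<le> 1 / Suc n"
  proof (rule choice, rule allI)
    fix n :: nat
    have "1 / real (Suc n) > 0" by simp
    from near[OF this] show "\<exists>y. y \<in> S \<and> norm y = 1 \<and> norm (adj_on S P y - cnj p *\<^sub>C y) \<le> 1 / Suc n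
      \<and> norm (adj_on S A y - cnj a *\<^sub>C y) \<le> 1 / Suc n \<and> norm (adj_on S B y - cnj b *\<^sub>C y) \<le> 1 / Suc n" by blast
  qed
  then obtain y where y: "\<And>n::nat. y n \<in> S" "\<And>n. norm (y n) = 1" "\<And>n. norm (adj_on S P (y n) - cnj p *\<^sub>C y n) \<le> 1 / Suc n"
    "\<And>n. norm (adj_on S A (y n) - cnj a *\<^sub>C y n) \<le> 1 / Suc n" "\<And>n. norm (adj_on S B (y n) - cnj b *\<^sub>C y n) \<le> 1 / Suc n"
    by blast
  define z where "z n = complex_of_real (Suc n) *\<^sub>C y n" for n
  have zS: "z n \<in> S" for n unfolding z_def by (rule SD(3)[OF y(1)])
  have weak: "cmod (cinner (X v - c *\<^sub>C v) (z n)) \<le> norm v"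
    if X: "bounded_op_on S X" and small: "norm (adj_on S X (y n) - cnj c *\<^sub>C y n) \<le> 1 / Suc n" and v: "v \<in> S"
    for X c v n
  proof -
    have "cinner (X v - c *\<^sub>C v) (z n) = Suc n * cinner v (adj_on S X (y n) - cnj c *\<^sub>C y n)"
      using cinner_adj_on[OF S X y(1) v]
      by (simp add: z_def cinner_scaleC_right cinner_scaleC_left cinner_diff_left cinner_diff_right algebra_simps)
    then have "cmod (cinner (X v - c *\<^sub>C v) (z n)) = Suc n * cmod (cinner v (adj_on S X (y n) - cnj c *\<^sub>C y n))"
      by (simp add: norm_mult del: of_nat_Suc)
    also have "\<dots> \<le> Suc n * (norm v * (1 / Suc n))"
      by (intro mult_left_mono order_trans[OF cmod_cinner_le] mult_left_mono small) auto
    finally show ?thesis by simp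
  qed
  have "\<exists>C. \<forall>n. norm (z n) \<le> C"
  proof (rule uniform_boundedness[OF S zS])
    fix k assume "k \<in> S"
    then have "k \<in> koszul2 (\<lambda>x. A x - a *\<^sub>C x) (\<lambda>x. B x - b *\<^sub>C x) (\<lambda>x. P x - p *\<^sub>C x) ` (S \<times> S \<times> S)"
      by (subst onto[symmetric])
    then obtain v1 v2 v3 where v: "v1 \<in> S" "v2 \<in> S" "v3 \<in> S"
      and k: "k = (A v3 - a *\<^sub>C v3) - (B v2 - b *\<^sub>C v2) + (P v1 - p *\<^sub>C v1)"
      by (auto simp: koszul2_def)
    have "cmod (cinner k (z n)) \<le> norm v3 + norm v2 + norm v1" for n
    proof -
      have "cmod (cinner k (z n)) \<le> cmod (cinner (A v3 - a *\<^sub>C v3) (z n)) + cmod (cinner (B v2 - b *\<^sub>C v2) (z n))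
          + cmod (cinner (P v1 - p *\<^sub>C v1) (z n))"
        unfolding k cinner_add_left cinner_diff_left[of "A v3 - a *\<^sub>C v3"]
        by (intro order_trans[OF norm_triangle_ineq] add_right_mono norm_triangle_ineq4)
      also have "\<dots> \<le> norm v3 + norm v2 + norm v1"
        by (intro add_mono weak bA bB bP y v)
      finally show ?thesis .
    qed
    then show "\<exists>C. \<forall>n. cmod (cinner k (z n)) \<le> C" by blast
  qed
  then obtain C where "\<And>n. norm (z n) \<le> C" by blast
  then have "real (Suc n) \<le> C" for n using y(2) by (simp add: z_def norm_scaleC del: of_nat_Suc)
  moreover obtain n :: nat where "C < n" using reals_Archimedean2 by blast
  ultimately show False by (smt (verit) of_nat_Suc)
qed

text \<open>
  If \<open>\<parallel>P x\<parallel> \<noteq> \<parallel>x\<parallel>\<close> for some \<open>x\<close>, then the quadratic form of \<open>P\<^sup>*P\<close> takes a value on a unit vector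
  that is off 1. The Fuglede theorem makes the real and imaginary parts of \<open>A\<close>, \<open>B\<close>, \<open>P\<close> commute with
  each other and with \<open>P\<^sup>*P\<close>, so joint approximate eigenvectors exist whose eigenvalue \<open>\<bar>p\<bar>\<^sup>2\<close> for
  \<open>P\<^sup>*P\<close> lies beyond that value, away from 1. This puts a point with \<open>\<bar>p\<bar> \<noteq> 1\<close> into the Taylor
  spectrum.
\<close>

theorem tetra_unitary_isometric:
  fixes A B P :: "'a::complex_hilbert \<Rightarrow> 'a"
  assumes S: "closed_csubspace S" and U: "tetra_unitary_on S A B P" and x: "x \<in> S"
  shows "norm (P x) = norm x"
proof (rule ccontr)
  assume neq: "norm (P x) \<noteq> norm x"
  note SD = csubspaceD[OF S]
  have nA: "normal_on S A" and nB: "normal_on S B" and nP: "normal_on S P"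
    and triple: "commuting_triple_on S A B P"
    and spec: "taylor_spectrum_on S A B P \<subseteq> tetrablock_dist_boundary"
    using U unfolding tetra_unitary_on_def by auto
  let ?A = "adj_on S A" and ?B = "adj_on S B" and ?P = "adj_on S P"
  note A = normal_onD[OF S nA] and B = normal_onD[OF S nB] and P = normal_onD[OF S nP]
  have c: "\<And>x. x \<in> S \<Longrightarrow> A (B x) = B (A x)" "\<And>x. x \<in> S \<Longrightarrow> A (P x) = P (A x)" "\<And>x. x \<in> S \<Longrightarrow> B (P x) = P (B x)"
    using triple unfolding commuting_triple_on_def by auto
  have f1: "A (?P x) = ?P (A x)" "B (?P x) = ?P (B x)" "P (?A x) = ?A (P x)" "P (?B x) = ?B (P x)"
    "A (?B x) = ?B (A x)" "B (?A x) = ?A (B x)" if "x \<in> S" for x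
    using fuglede[OF S nP A(1) c(2) that] fuglede[OF S nP B(1) c(3) that]
      fuglede[OF S nA P(1) c(2)[symmetric] that] fuglede[OF S nB P(1) c(3)[symmetric] that]
      fuglede[OF S nB A(1) c(1) that] fuglede[OF S nA B(1) c(1)[symmetric] that] by auto
  have f2: "?P (?A x) = ?A (?P x)" "?P (?B x) = ?B (?P x)" "?A (?B x) = ?B (?A x)" if "x \<in> S" for x
    using adj_on_commute[OF S A(1) P(1) c(2) that] adj_on_commute[OF S B(1) P(1) c(3) that]
      adj_on_commute[OF S A(1) B(1) c(1) that] by auto
  note cl = bounded_opD(1)[OF A(1)] bounded_opD(1)[OF A(2)] bounded_opD(1)[OF B(1)] bounded_opD(1)[OF B(2)]
    bounded_opD(1)[OF P(1)] bounded_opD(1)[OF P(2)]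
  \<comment> \<open>the sign decides whether the spectrum of \<open>P\<^sup>*P\<close> is searched above or below 1\<close>
  define \<sigma> :: real where "\<sigma> = (if norm x < norm (P x) then 1 else - 1)"
  have \<sigma>: "\<sigma> * \<sigma> = 1" by (simp add: \<sigma>_def)
  define T where "T y = complex_of_real \<sigma> *\<^sub>C ?P (P y)" for y
  have bT: "bounded_op_on S T"
    unfolding T_def[abs_def] by (rule bounded_op_scaleC[OF S bounded_op_comp[OF P(2,1)]])
  have innerT: "inner (T u) w = \<sigma> * inner (P u) (P w)" if "u \<in> S" "w \<in> S" for u w
    using cinner_adj_on'[OF S P(1) cl(5)[OF that(1)] that(2)]
    by (simp add: T_def inner_Re_cinner cinner_scaleC_left)
  have symT: "inner (T u) w = inner u (T w)" if "u \<in> S" "w \<in> S" for u w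
    using innerT[OF that] innerT[OF that(2,1)] by (simp add: inner_commute)
  have xne: "x \<noteq> 0" using neq bounded_op_zero[OF P(1) S] by auto
  define u where "u = complex_of_real (1 / norm x) *\<^sub>C x"
  have u: "u \<in> S" "norm u = 1" using xne x by (simp_all add: u_def SD norm_scaleC norm_divide)
  have Pu: "norm (P u) = norm (P x) / norm x"
    unfolding u_def bounded_opD(3)[OF P(1) x] by (simp add: norm_scaleC norm_divide)
  define s where "s = \<sigma> * (norm (P u))\<^sup>2"
  have s: "s > \<sigma>"
  proof (cases "norm x < norm (P x)")
    case True
    then have "norm (P u) > 1" using xne by (simp add: Pu)
    then show ?thesis using True by (simp add: s_def \<sigma>_def one_less_power)
  next
    case False
    then have "norm (P u) < 1" using xne neq by (simp add: Pu)
    then have "(norm (P u))\<^sup>2 < 1" by (simp add: power_less_one_iff)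
    then show ?thesis using False by (simp add: s_def \<sigma>_def)
  qed
  have "\<exists>t\<ge>s. approx_null S (insert (\<lambda>y. T y - complex_of_real t *\<^sub>C y) {})"
  proof (rule approx_null_extend[OF S _ _ bT symT])
    fix e :: real assume "e > 0"
    then show "\<exists>y\<in>S. norm y = 1 \<and> (\<forall>R\<in>{}. norm (R y) \<le> e) \<and> s - e \<le> inner (T y) y"
      using u innerT[OF u(1,1)] by (intro bexI[of _ u]) (auto simp: s_def dot_square_norm)
  qed auto
  then obtain t where t: "t \<ge> s" "approx_null S {\<lambda>y. T y - complex_of_real t *\<^sub>C y}" by blast
  have bm: "bounded_op_on S (\<lambda>y. X y - c *\<^sub>C y)" if "bounded_op_on S X" for X c
    by (rule bounded_op_subtract[OF S that bounded_op_scaleC[OF S bounded_op_ident]])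
  have cT: "T (N y) = N (T y)" if "bounded_op_on S N" "\<And>y. y \<in> S \<Longrightarrow> P (N y) = N (P y)"
    "\<And>y. y \<in> S \<Longrightarrow> ?P (N y) = N (?P y)" "y \<in> S" for N y
    using that cl by (simp add: T_def bounded_opD(3)[OF that(1)])
  let ?F1 = "{\<lambda>y. T y - complex_of_real t *\<^sub>C y}"
  have "\<exists>p. approx_null S ({\<lambda>x. P x - p *\<^sub>C x, \<lambda>x. ?P x - cnj p *\<^sub>C x} \<union> ?F1)"
  proof (rule approx_null_extend_normal[OF S _ _ nP _ _ t(2)])
    show "R (P y) = P (R y)" "R (?P y) = ?P (R y)" if "R \<in> ?F1" "y \<in> S" for R y
      using that commute_minus_scalar[OF S bT P(1) that(2) cT[OF P(1) _ _ that(2)]]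
        commute_minus_scalar[OF S bT P(2) that(2) cT[OF P(2) _ _ that(2)]] P(3) by auto
  qed (use bm[OF bT] in auto)
  then obtain p where p: "approx_null S ({\<lambda>x. P x - p *\<^sub>C x, \<lambda>x. ?P x - cnj p *\<^sub>C x} \<union> ?F1)" by blast
  let ?F2 = "{\<lambda>x. P x - p *\<^sub>C x, \<lambda>x. ?P x - cnj p *\<^sub>C x} \<union> ?F1"
  have "\<exists>a. approx_null S ({\<lambda>x. A x - a *\<^sub>C x, \<lambda>x. ?A x - cnj a *\<^sub>C x} \<union> ?F2)"
  proof (rule approx_null_extend_normal[OF S _ _ nA _ _ p])
    show "R (A y) = A (R y)" if R: "R \<in> ?F2" and y: "y \<in> S" for R y
    proof -
      have TA: "T (A y) = A (T y)" by (rule cT[OF A(1) _ _ y]) (simp_all add: c f1)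
      show ?thesis
        using R commute_minus_scalar[OF S bT A(1) y TA, of t]
          commute_minus_scalar[OF S P(1) A(1) y c(2)[OF y, symmetric], of p]
          commute_minus_scalar[OF S P(2) A(1) y f1(1)[OF y, symmetric], of "cnj p"] by auto
    qed
    show "R (?A y) = ?A (R y)" if R: "R \<in> ?F2" and y: "y \<in> S" for R y
    proof -
      have TA: "T (?A y) = ?A (T y)" by (rule cT[OF A(2) _ _ y]) (simp_all add: f2 f1)
      show ?thesis
        using R commute_minus_scalar[OF S bT A(2) y TA, of t]
          commute_minus_scalar[OF S P(1) A(2) y f1(3)[OF y], of p]
          commute_minus_scalar[OF S P(2) A(2) y f2(1)[OF y], of "cnj p"] by auto
    qed
  qed (use bm[OF bT] bm[OF P(1)] bm[OF P(2)] in auto)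
  then obtain a where a: "approx_null S ({\<lambda>x. A x - a *\<^sub>C x, \<lambda>x. ?A x - cnj a *\<^sub>C x} \<union> ?F2)" by blast
  let ?F3 = "{\<lambda>x. A x - a *\<^sub>C x, \<lambda>x. ?A x - cnj a *\<^sub>C x} \<union> ?F2"
  have "\<exists>b. approx_null S ({\<lambda>x. B x - b *\<^sub>C x, \<lambda>x. ?B x - cnj b *\<^sub>C x} \<union> ?F3)"
  proof (rule approx_null_extend_normal[OF S _ _ nB _ _ a])
    show "R (B y) = B (R y)" if R: "R \<in> ?F3" and y: "y \<in> S" for R y
    proof -
      have TB: "T (B y) = B (T y)" by (rule cT[OF B(1) _ _ y]) (simp_all add: c f1)
      show ?thesis
        using R commute_minus_scalar[OF S bT B(1) y TB, of t]
          commute_minus_scalar[OF S P(1) B(1) y c(3)[OF y, symmetric], of p]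
          commute_minus_scalar[OF S P(2) B(1) y f1(2)[OF y, symmetric], of "cnj p"]
          commute_minus_scalar[OF S A(1) B(1) y c(1)[OF y], of a]
          commute_minus_scalar[OF S A(2) B(1) y f1(6)[OF y, symmetric], of "cnj a"] by auto
    qed
    show "R (?B y) = ?B (R y)" if R: "R \<in> ?F3" and y: "y \<in> S" for R y
    proof -
      have TB: "T (?B y) = ?B (T y)" by (rule cT[OF B(2) _ _ y]) (simp_all add: f2 f1)
      show ?thesis
        using R commute_minus_scalar[OF S bT B(2) y TB, of t]
          commute_minus_scalar[OF S P(1) B(2) y f1(4)[OF y], of p]
          commute_minus_scalar[OF S P(2) B(2) y f2(2)[OF y], of "cnj p"]
          commute_minus_scalar[OF S A(1) B(2) y f1(5)[OF y], of a]
          commute_minus_scalar[OF S A(2) B(2) y f2(3)[OF y], of "cnj a"] by auto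
    qed
  qed (use bm[OF bT] bm[OF P(1)] bm[OF P(2)] bm[OF A(1)] bm[OF A(2)] in auto)
  then obtain b where b: "approx_null S ({\<lambda>x. B x - b *\<^sub>C x, \<lambda>x. ?B x - cnj b *\<^sub>C x} \<union> ?F3)" by blast
  have near: "\<exists>y\<in>S. norm y = 1 \<and> norm (T y - complex_of_real t *\<^sub>C y) \<le> e \<and> norm (P y - p *\<^sub>C y) \<le> e
      \<and> norm (?P y - cnj p *\<^sub>C y) \<le> e \<and> norm (?A y - cnj a *\<^sub>C y) \<le> e \<and> norm (?B y - cnj b *\<^sub>C y) \<le> e"
    if "e > 0" for e
    using b that unfolding approx_null_def by auto
  have "(cmod p)\<^sup>2 = \<sigma> * t"
  proof -
    obtain C where C: "C > 0" "\<And>y. y \<in> S \<Longrightarrow> norm (?P y) \<le> C * norm y" using bounded_op_bound[OF P(2)] by blast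
    have le: "\<bar>\<sigma> * t - (cmod p)\<^sup>2\<bar> \<le> (1 + C + cmod p) * e" if e: "e > 0" for e
    proof -
      obtain y where y: "y \<in> S" "norm y = 1" "norm (T y - complex_of_real t *\<^sub>C y) \<le> e"
        "norm (P y - p *\<^sub>C y) \<le> e" "norm (?P y - cnj p *\<^sub>C y) \<le> e" using near[OF e] by blast
      have pS: "P y - p *\<^sub>C y \<in> S" by (rule SD(5)[OF cl(5)[OF y(1)] SD(3)[OF y(1)]])
      have Ppy: "?P (P y - p *\<^sub>C y) = ?P (P y) - p *\<^sub>C ?P y"
        using bounded_op_diff[OF P(2) S cl(5)[OF y(1)] SD(3)[OF y(1), of p]] bounded_opD(3)[OF P(2) y(1)] by simp
      have PP: "?P (P y) = complex_of_real \<sigma> *\<^sub>C T y"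
        using \<sigma> by (simp add: T_def scaleC_scaleC flip: of_real_mult)
      have "complex_of_real (\<sigma> * t - (cmod p)\<^sup>2) *\<^sub>C y
          = ?P (P y - p *\<^sub>C y) + p *\<^sub>C (?P y - cnj p *\<^sub>C y) - complex_of_real \<sigma> *\<^sub>C (T y - complex_of_real t *\<^sub>C y)"
        unfolding Ppy PP by (simp add: scaleC_ring complex_norm_square[symmetric])
      then have "norm (complex_of_real (\<sigma> * t - (cmod p)\<^sup>2) *\<^sub>C y)
          \<le> norm (?P (P y - p *\<^sub>C y)) + norm (p *\<^sub>C (?P y - cnj p *\<^sub>C y)) + norm (complex_of_real \<sigma> *\<^sub>C (T y - complex_of_real t *\<^sub>C y))"
        by (simp only:) (rule order_trans[OF norm_triangle_ineq4 add_right_mono[OF norm_triangle_ineq]])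
      moreover have "norm (?P (P y - p *\<^sub>C y)) \<le> C * e"
        using order_trans[OF C(2)[OF pS] mult_left_mono[OF y(4)]] C(1) by simp
      moreover have "norm (p *\<^sub>C (?P y - cnj p *\<^sub>C y)) \<le> cmod p * e"
        unfolding norm_scaleC by (rule mult_left_mono[OF y(5)]) simp
      moreover have "norm (complex_of_real \<sigma> *\<^sub>C (T y - complex_of_real t *\<^sub>C y)) \<le> e"
        using y(3) by (simp add: norm_scaleC \<sigma>_def)
      moreover have "norm (complex_of_real (\<sigma> * t - (cmod p)\<^sup>2) *\<^sub>C y) = \<bar>\<sigma> * t - (cmod p)\<^sup>2\<bar>"
        unfolding norm_scaleC y(2) norm_of_real by simp
      ultimately show ?thesis by (simp add: algebra_simps)
    qed
    have "\<bar>\<sigma> * t - (cmod p)\<^sup>2\<bar> \<le> 0"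
    proof (rule field_le_epsilon)
      fix e :: real assume e: "e > 0"
      have pos: "1 + C + cmod p > 0" using C(1) by (simp add: add_pos_nonneg)
      then have "e / (1 + C + cmod p) > 0" using e by simp
      from le[OF this] show "\<bar>\<sigma> * t - (cmod p)\<^sup>2\<bar> \<le> 0 + e" using pos by simp
    qed
    then show ?thesis by simp
  qed
  moreover have "\<sigma> * t \<noteq> 1" using s t(1) by (auto simp: \<sigma>_def split: if_splits)
  ultimately have "cmod p \<noteq> 1" by auto
  then have "(a, b, p) \<notin> taylor_spectrum_on S A B P"
    using spec unfolding tetrablock_dist_boundary_def by auto
  moreover have "(a, b, p) \<in> taylor_spectrum_on S A B P"
    by (rule approx_eigenvalue_in_taylor_spectrum[OF S A(1) B(1) P(1)]) (use near in blast)
  ultimately show False by blast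
qed

section \<open>Levan's decomposition of a tetrablock contraction\<close>

lemma contraction_lim_norm_le:
  assumes "contraction_on UNIV P"
  shows "lim (\<lambda>k. norm ((P ^^ k) x)) \<le> norm ((P ^^ n) x)"
proof -
  have dec: "decseq (\<lambda>k. norm ((P ^^ k) x))"
    using assms unfolding contraction_on_def by (intro decseq_SucI) simp
  then have "convergent (\<lambda>k. norm ((P ^^ k) x))"
    by (intro Bseq_monoseq_convergent decseq_imp_monoseq decseq_bounded[where B = 0]) auto
  then show ?thesis
    using decseq_ge[OF dec, of "lim (\<lambda>k. norm ((P ^^ k) x))"] by (simp add: convergent_LIMSEQ_iff)
qed

text \<open>
  The norms \<open>\<parallel>P\<^sup>k x\<parallel>\<close> decrease, so their limit is smaller than \<open>\<parallel>x\<parallel>\<close> as soon as one of them is.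
\<close>

lemma levan_strict_iff:
  assumes P: "contraction_on UNIV P"
  shows "levan_strict P M \<longleftrightarrow> M \<inter> isometric_part P \<subseteq> {0}"
proof -
  have "lim (\<lambda>k. norm ((P ^^ k) x)) < norm x \<longleftrightarrow> x \<notin> isometric_part P" for x
  proof
    assume "lim (\<lambda>k. norm ((P ^^ k) x)) < norm x"
    moreover have "lim (\<lambda>k. norm ((P ^^ k) x)) = norm x" if "x \<in> isometric_part P"
      using that by (simp add: isometric_part_def)
    ultimately show "x \<notin> isometric_part P" by auto
  next
    assume "x \<notin> isometric_part P"
    then obtain k where "norm ((P ^^ k) x) \<noteq> norm x" by (auto simp: isometric_part_def)
    moreover have "norm ((P ^^ k) x) \<le> norm x"
    proof (induction k)
      case (Suc k)
      have "norm (P ((P ^^ k) x)) \<le> norm ((P ^^ k) x)" using P unfolding contraction_on_def by simp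
      then show ?case using Suc by simp
    qed simp
    ultimately show "lim (\<lambda>k. norm ((P ^^ k) x)) < norm x"
      using contraction_lim_norm_le[OF P, of x k] by linarith
  qed
  then show ?thesis unfolding levan_strict_def by blast
qed

text \<open>
  A piece of \<open>P\<^sup>*\<close> that is unitary is one of \<open>P\<close>, because \<open>P P\<^sup>* x = x\<close> wherever \<open>P\<^sup>*\<close> preserves
  the norm. So complete non-unitarity passes to \<open>P\<^sup>*\<close> and to its restrictions.
\<close>

lemma cnu_adjoint_restriction:
  fixes P :: "'a::complex_hilbert \<Rightarrow> 'a"
  assumes cnu: "cnu_contraction_on UNIV P" and S: "closed_csubspace S" and inv: "adj P ` S \<subseteq> S"
  shows "cnu_contraction_on S (adj P)"
proof -
  have P: "contraction_on UNIV P" using cnu unfolding cnu_contraction_on_def by blast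
  then have bd: "bounded_op_on UNIV P" and le: "\<And>x. norm (P x) \<le> 1 * norm x"
    unfolding contraction_on_def by auto
  note abd = adj_on_bounded[OF csubspace_UNIV bd]
  have ale: "norm (adj P x) \<le> norm x" for x
    using adj_on_norm_le[OF csubspace_UNIV bd UNIV_I, of 1 x] le by simp
  have acon: "contraction_on UNIV (adj P)" using abd ale unfolding contraction_on_def by blast
  have "M = {0}" if M: "closed_csubspace M" and uni: "unitary_on M (adj P)" for M
  proof -
    have onto: "adj P ` M = M" and iso: "\<And>x. x \<in> M \<Longrightarrow> norm (adj P x) = norm x"
      using uni unfolding unitary_on_def isometry_on_def by auto
    have PaP: "P (adj P x) = x" if "x \<in> M" for x
      using contraction_norm_eq_iff[OF csubspace_UNIV acon UNIV_I, of x] iso[OF that]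
        adj_on_adj_on[OF csubspace_UNIV bd UNIV_I] by simp
    have PM: "P ` M = M"
    proof -
      have "P ` M = P ` (adj P ` M)" by (simp add: onto)
      also have "\<dots> = M" unfolding image_image using PaP by simp
      finally show ?thesis .
    qed
    have "norm (P x) = norm x" if x: "x \<in> M" for x
    proof -
      have "x \<in> adj P ` M" using onto x by simp
      then obtain y where "y \<in> M" "x = adj P y" by (rule imageE)
      then show ?thesis using PaP iso by simp
    qed
    moreover have "bounded_op_on M P" by (rule bounded_op_restrict[OF bd]) (use PM in auto)
    ultimately have "unitary_on M P" using PM unfolding unitary_on_def isometry_on_def by blast
    then show ?thesis using cnu M PM onto unfolding cnu_contraction_on_def by blast
  qed
  moreover have "contraction_on S (adj P)"
    using bounded_op_restrict[OF abd subset_UNIV inv] ale unfolding contraction_on_def by blast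
  ultimately show ?thesis unfolding cnu_contraction_on_def by simp
qed

lemma isometric_subset:
  assumes inv: "P ` L \<subseteq> L" and iso: "\<And>x. x \<in> L \<Longrightarrow> norm (P x) = norm x"
  shows "L \<subseteq> isometric_part P"
proof
  fix x assume x: "x \<in> L"
  have "(P ^^ k) x \<in> L \<and> norm ((P ^^ k) x) = norm x" for k
    by (induction k) (use x inv iso in auto)
  then show "x \<in> isometric_part P" by (simp add: isometric_part_def)
qed

text \<open>
  The isometric part contains all competitors of \<open>H\<close> and is itself one of them.
\<close>

lemma maximal_isometry_eq_isometric_part:
  assumes cnu: "cnu_contraction_on UNIV P"
    and max: "maximal_subspace (\<lambda>M. P ` M \<subseteq> M \<and> isometry_on M P \<and> cnu_contraction_on M P) H"
  shows "H = isometric_part P"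
proof -
  have P: "contraction_on UNIV P" using cnu unfolding cnu_contraction_on_def by blast
  have H: "closed_csubspace H" "P ` H \<subseteq> H" "isometry_on H P"
    and top: "\<And>L. closed_csubspace L \<Longrightarrow> P ` L \<subseteq> L \<Longrightarrow> isometry_on L P \<Longrightarrow> cnu_contraction_on L P
      \<Longrightarrow> H \<subseteq> L \<Longrightarrow> L = H"
    using max unfolding maximal_subspace_def by auto
  have "H \<subseteq> isometric_part P" by (rule isometric_subset[OF H(2)]) (use H(3) in \<open>auto simp: isometry_on_def\<close>)
  then show ?thesis
    using top[OF isometric_part_csubspace[OF P] isometric_part_self_invariant] isometric_part_cnu[OF cnu] by blast
qed

theorem theorem5p7:
  fixes A B P :: "'a::complex_hilbert \<Rightarrow> 'a" and H\<^sub>1 H\<^sub>2 :: "'a set"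
  assumes "cnu_tetra_contraction_on UNIV A B P"
    and "\<forall>x. adj A (P x) = P (adj A x)"
    and "\<forall>x. adj B (P x) = P (adj B x)"
    and "orthogonal_decomposition H\<^sub>1 H\<^sub>2"
    and "maximal_subspace (\<lambda>M. P ` M \<subseteq> M \<and> isometry_on M P \<and> cnu_contraction_on M P) H\<^sub>1"
  shows "maximal_subspace (\<lambda>M. joint_invariant A B P M \<and> cnu_tetra_isometry_on M A B P) H\<^sub>1
    \<and> maximal_subspace (\<lambda>M. joint_invariant (adj A) (adj B) (adj P) M \<and>
          cnu_tetra_contraction_on M (adj A) (adj B) (adj P) \<and> levan_strict P M) H\<^sub>2"
proof -
  note U = csubspace_UNIV
  have T: "tetra_contraction_on UNIV A B P" and cnu: "cnu_contraction_on UNIV P"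
    using assms(1) unfolding cnu_tetra_contraction_on_def by auto
  have P: "contraction_on UNIV P" using cnu unfolding cnu_contraction_on_def by blast
  have ops: "bounded_op_on UNIV A" "bounded_op_on UNIV B" "bounded_op_on UNIV P"
    and comm: "\<And>x. A (P x) = P (A x)" "\<And>x. B (P x) = P (B x)"
    using T unfolding tetra_contraction_on_def commuting_triple_on_def by auto
  have dc: "\<And>x. adj A (P x) = P (adj A x)" "\<And>x. adj B (P x) = P (adj B x)"
    using assms(2,3) by auto
  have cs1: "closed_csubspace H\<^sub>1" and cs2: "closed_csubspace H\<^sub>2"
    and orth: "\<And>x y. x \<in> H\<^sub>1 \<Longrightarrow> y \<in> H\<^sub>2 \<Longrightarrow> cinner x y = 0"
    and decomp: "\<And>h. \<exists>x\<in>H\<^sub>1. \<exists>y\<in>H\<^sub>2. h = x + y"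
    using assms(4) unfolding orthogonal_decomposition_def by auto
  have H1: "H\<^sub>1 = isometric_part P" by (rule maximal_isometry_eq_isometric_part[OF cnu assms(5)])
  have PH1: "P ` H\<^sub>1 \<subseteq> H\<^sub>1" unfolding H1 by (rule isometric_part_self_invariant)
  have iso1: "isometry_on H\<^sub>1 P" and cnu1: "cnu_contraction_on H\<^sub>1 P"
    using isometric_part_cnu[OF cnu] H1 by auto

  \<comment> \<open>\<open>A\<close>, \<open>B\<close> and their adjoints commute with \<open>P\<close> and \<open>P\<^sup>*\<close>, so \<open>H\<^sub>1\<close> reduces \<open>A\<close> and \<open>B\<close>\<close>
  have ca: "T (adj P x) = adj P (T x)" if "bounded_op_on UNIV T" "\<And>x. adj T (P x) = P (adj T x)" for T x
    using adj_on_commute[OF U adj_on_bounded[OF U that(1)] ops(3) that(2), of x]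
    by (simp add: adj_on_adj_on[OF U that(1)])
  have caa: "adj T (adj P x) = adj P (adj T x)" if "bounded_op_on UNIV T" "\<And>x. T (P x) = P (T x)" for T x
    by (rule adj_on_commute[OF U that(1) ops(3) that(2)]) auto
  have inv1: "A ` H\<^sub>1 \<subseteq> H\<^sub>1" "B ` H\<^sub>1 \<subseteq> H\<^sub>1" "adj A ` H\<^sub>1 \<subseteq> H\<^sub>1" "adj B ` H\<^sub>1 \<subseteq> H\<^sub>1"
    unfolding H1
    by (rule isometric_part_invariant[OF P comm(1) ca[OF ops(1) dc(1)]])
      (rule isometric_part_invariant[OF P comm(2) ca[OF ops(2) dc(2)]]
        isometric_part_invariant[OF P dc(1) caa[OF ops(1) comm(1)]]
        isometric_part_invariant[OF P dc(2) caa[OF ops(2) comm(2)]])+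
  have inv2: "adj T ` H\<^sub>2 \<subseteq> H\<^sub>2" if T: "bounded_op_on UNIV T" "T ` H\<^sub>1 \<subseteq> H\<^sub>1" for T
  proof clarify
    fix y assume y: "y \<in> H\<^sub>2"
    obtain u v where uv: "u \<in> H\<^sub>1" "v \<in> H\<^sub>2" "adj T y = u + v" using decomp by blast
    have "cinner u (adj T y) = cinner (T u) y" using cinner_adj_on[OF U T(1), of y u] by simp
    also have "\<dots> = 0" using orth y T(2) uv(1) by blast
    finally have "cinner u u = 0" using uv orth[OF uv(1,2)] by (simp add: cinner_add_right)
    then have "u = 0" by (simp add: cinner_self)
    then show "adj T y \<in> H\<^sub>2" using uv by simp
  qed

  have zero: "A x = 0" "B x = 0" if "x \<in> H\<^sub>1" for x
    using doubly_commuting_vanish[OF T dc cs1 iso1 cnu1 inv1(2,3,4) that] by auto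
  have first: "maximal_subspace (\<lambda>M. joint_invariant A B P M \<and> cnu_tetra_isometry_on M A B P) H\<^sub>1"
    unfolding maximal_subspace_def
  proof (intro conjI allI impI)
    show "joint_invariant A B P H\<^sub>1" unfolding joint_invariant_def using inv1 PH1 by blast
    show "cnu_tetra_isometry_on H\<^sub>1 A B P"
      unfolding cnu_tetra_isometry_on_def
      by (intro conjI cnu_isometry_tetra_isometry[OF cs1 iso1 cnu1] cnu1 zero)
    fix L assume L: "closed_csubspace L \<and> (joint_invariant A B P L \<and> cnu_tetra_isometry_on L A B P) \<and> H\<^sub>1 \<subseteq> L"
    then have "tetra_isometry_on L A B P" and PL: "P ` L \<subseteq> L"
      unfolding cnu_tetra_isometry_on_def joint_invariant_def by auto
    then obtain K :: "'a ell2 set" and N1 N2 U V where K: "closed_csubspace K" "tetra_unitary_on K N1 N2 U" "V ` L \<subseteq> K"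
      and V: "\<forall>x\<in>L. norm (V x) = norm x"
        "\<forall>x\<in>L. V (A x) = N1 (V x) \<and> V (B x) = N2 (V x) \<and> V (P x) = U (V x)"
      unfolding tetra_isometry_on_def by (elim conjE exE) (rule that; assumption)
    have "norm (P x) = norm x" if x: "x \<in> L" for x
    proof -
      have "norm (P x) = norm (V (P x))" using V(1) PL x by auto
      also have "\<dots> = norm (U (V x))" using V(2) x by simp
      also have "\<dots> = norm (V x)" by (rule tetra_unitary_isometric[OF K(1,2)]) (use K(3) x in auto)
      finally show ?thesis using V(1) x by simp
    qed
    then have "L \<subseteq> H\<^sub>1" unfolding H1 by (intro isometric_subset[OF PL]) auto
    then show "L = H\<^sub>1" using L by blast
  qed (rule cs1)

  have second: "maximal_subspace (\<lambda>M. joint_invariant (adj A) (adj B) (adj P) M \<and>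
      cnu_tetra_contraction_on M (adj A) (adj B) (adj P) \<and> levan_strict P M) H\<^sub>2"
    unfolding maximal_subspace_def
  proof (intro conjI allI impI)
    note invs = inv2[OF ops(1) inv1(1)] inv2[OF ops(2) inv1(2)] inv2[OF ops(3) PH1]
    show "joint_invariant (adj A) (adj B) (adj P) H\<^sub>2" unfolding joint_invariant_def using invs by blast
    show "cnu_tetra_contraction_on H\<^sub>2 (adj A) (adj B) (adj P)"
      unfolding cnu_tetra_contraction_on_def
      using adjoint_restriction_tetra_contraction[OF T cs2 invs] cnu_adjoint_restriction[OF cnu cs2 invs(3)] by blast
    have "x = 0" if "x \<in> H\<^sub>2" "x \<in> H\<^sub>1" for x using orth[OF that(2,1)] by (simp add: cinner_self)
    then show "levan_strict P H\<^sub>2" unfolding levan_strict_iff[OF P] H1 by blast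
    fix L assume L: "closed_csubspace L \<and> (joint_invariant (adj A) (adj B) (adj P) L \<and>
        cnu_tetra_contraction_on L (adj A) (adj B) (adj P) \<and> levan_strict P L) \<and> H\<^sub>2 \<subseteq> L"
    have "x \<in> H\<^sub>2" if x: "x \<in> L" for x
    proof -
      obtain u v where uv: "u \<in> H\<^sub>1" "v \<in> H\<^sub>2" "x = u + v" using decomp by blast
      have "u = x - v" using uv by simp
      then have "u \<in> L" using csubspaceD(5)[of L x v] L x uv(2) by blast
      then have "u = 0" using L uv(1) unfolding levan_strict_iff[OF P] H1 by blast
      then show ?thesis using uv by simp
    qed
    then show "L = H\<^sub>2" using L by blast
  qed (rule cs2)
  from first second show ?thesis by blast
qed

end
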